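(* Let $n\ge1$, let $m$ be a non-negative integer, let $\alpha>0$, let $1<p\le q\le\infty$ with $p\ne\infty$, and let $u:\mathbb{C}^n\to\mathbb{C}$ and $\psi:\mathbb{C}^n\to\mathbb{C}^n$ be entire. If $uC_\psi:\mathcal{F}^p_{(m,\alpha)}\to\mathcal{F}^q_{(m,\alpha)}$ is bounded, then $$\|uC_\psi\|_e\simeq\begin{cases}\Big(\limsup_{|w|\to\infty}B_{(m,\psi)}(|u|^q)(w)\Big)^{1/q}, & q<\infty,\\[1mm] \limsup_{|\psi(w)|\to\infty}B^\infty_{(m,\psi)}(|u|)(w), & q=\infty.\end{cases}$$
   Context: $dV$ is Lebesgue measure on $\mathbb{C}^n$, $\langle z,w\rangle=\sum_j z_j\overline{w_j}$, $|z|=\sqrt{\langle z,z\rangle}$. For $0<p<\infty$ put $\|f\|_p^p=(\frac{\alpha p}{2\pi})^n\int_{\mathbb{C}^n}|f(z)|^pe^{-\frac{\alpha p}{2}|z|^2}dV(z)$, and $\|f\|_\infty=\sup_z|f(z)|e^{-\frac{\alpha}{2}|z|^2}$. The Fock--Sobolev space $\mathcal{F}^p_{(m,\alpha)}$ ($0<p\le\infty$) of order $m$ consists of the entire functions $f$ on $\mathbb{C}^n$ with $\sum_{\beta_1+\dots+\beta_n\le m}\|\partial^\beta f\|_p<\infty$. It is equipped throughout with the equivalent norm $\|f\|_{(p,m)}=\big(C_{(p,m,n)}\int_{\mathbb{C}^n}|z|^{mp}|f(z)|^pe^{-\frac{\alpha p}{2}|z|^2}dV(z)\big)^{1/p}$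 for $p<\infty$, where $C_{(p,m,n)}=(\frac{\alpha p}{2})^{\frac{mp}{2}+n}\frac{\Gamma(n)}{\pi^n\Gamma(\frac{mp}{2}+n)}$, and $\|f\|_{(\infty,m)}=\sup_z|z|^m|f(z)|e^{-\frac{\alpha}{2}|z|^2}$ for $p=\infty$. The weighted composition operator is $uC_\psi f=u\cdot(f\circ\psi)$. The essential norm $\|T\|_e$ of a bounded operator $T:\mathscr{H}_1\to\mathscr{H}_2$ between Banach spaces is the distance (in operator norm) from $T$ to the space of compact operators from $\mathscr{H}_1$ to $\mathscr{H}_2$. With $k_w(z)=e^{\alpha\langle z,w\rangle-\frac{\alpha}{2}|w|^2}$, $$B_{(m,\psi)}(|u|^q)(w)=\int_{\mathbb{C}^n}\frac{|k_w(\psi(z))|^q}{(1+|\psi(z)|)^{mq}}|u(z)|^q|z|^{qm}e^{-\frac{\alpha q}{2}|z|^2}dV(z)\quad(0<q<\infty),$$ $$B^\infty_{(m,\psi)}(|u|)(z)=\frac{|z|^m|u(z)|}{(1+|\psi(z)|)^m}e^{\frac{\alpha}{2}(|\psi(z)|^2-|z|^2)}.$$ $\limsup_{|\psi(w)|\to\infty}F(w)=\lim_{\delta\to\infty}\sup_{|\psi(w)|\ge\delta}F(w)$, taken to be $0$ if $\psi$ is bounded. $U\simeq V$ means $U\le CV$ and $V\le CU$ with a constant $C$ independent of $u,\psi$. *)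

theory Defs
  imports "HOL-Analysis.Analysis"
begin

section \<open>Entire functions on \<open>\<complex>\<^sup>n\<close>\<close>

text \<open>
  The space \<open>\<complex>\<^sup>n\<close> is \<^typ>\<open>complex ^ 'n\<close> with \<open>n = CARD('n) \<ge> 1\<close>; its library norm is the Euclidean
  norm and \<^const>\<open>lborel\<close> is Lebesgue measure on its Borel sets (all integrands below are Borel).
\<close>

text \<open>Complex Frechet differentiability everywhere: the real derivative exists and is complex linear.\<close>

definition entire_fun :: "(complex ^ 'n \<Rightarrow> complex) \<Rightarrow> bool" where
  "entire_fun f \<longleftrightarrow> (\<forall>z. \<exists>D. (f has_derivative D) (at z) \<and> (\<forall>c h. D (c *s h) = c * D h))"

definition entire_map :: "(complex ^ 'n \<Rightarrow> complex ^ 'n) \<Rightarrow> bool" where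
  "entire_map \<psi> \<longleftrightarrow> (\<forall>i. entire_fun (\<lambda>z. \<psi> z $ i))"

definition partial_deriv :: "'n \<Rightarrow> (complex ^ 'n \<Rightarrow> complex) \<Rightarrow> complex ^ 'n \<Rightarrow> complex" where
  "partial_deriv j f z = deriv (\<lambda>t. f (z + axis j t)) 0"

text \<open>
  The derivative \<open>\<partial>\<^sup>\<beta> f\<close> for a multi-index \<open>\<beta>\<close>. The index type carries no order, so the partial
  derivatives are taken along an arbitrary enumeration of it; this is immaterial for entire \<open>f\<close>,
  whose partial derivatives commute.
\<close>

definition multi_deriv ::
  "('n::finite \<Rightarrow> nat) \<Rightarrow> (complex ^ 'n \<Rightarrow> complex) \<Rightarrow> complex ^ 'n \<Rightarrow> complex" where
  "multi_deriv \<beta> f =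
     foldr (\<lambda>j. partial_deriv j ^^ \<beta> j) (SOME js. distinct js \<and> set js = (UNIV :: 'n set)) f"


section \<open>Fock--Sobolev spaces\<close>

text \<open>
  Norms, integrals and suprema take values in \<^typ>\<open>ennreal\<close>, so that they are meaningful for all
  functions. Powers are only taken with positive exponents.
\<close>

definition epowr :: "ennreal \<Rightarrow> real \<Rightarrow> ennreal" where
  "epowr x a = (if x = \<infinity> then \<infinity> else ennreal (enn2real x powr a))"

definition fock_norm :: "real \<Rightarrow> ennreal \<Rightarrow> (complex ^ 'n \<Rightarrow> complex) \<Rightarrow> ennreal" where
  "fock_norm \<alpha> p f =
    (if p = \<infinity> then (SUP z. ennreal (norm (f z) * exp (- (\<alpha> / 2) * (norm z)\<^sup>2)))
     else let r = enn2real p in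
       epowr (ennreal ((\<alpha> * r / (2 * pi)) ^ CARD('n)) *
              (\<integral>\<^sup>+z. ennreal (norm (f z) powr r * exp (- (\<alpha> * r / 2) * (norm z)\<^sup>2)) \<partial>lborel))
             (1 / r))"

definition fock_sobolev ::
  "nat \<Rightarrow> real \<Rightarrow> ennreal \<Rightarrow> (complex ^ 'n::finite \<Rightarrow> complex) set" where
  "fock_sobolev m \<alpha> p =
    {f. entire_fun f \<and>
        (\<Sum>\<beta> | (\<Sum>j\<in>UNIV. \<beta> j) \<le> m. fock_norm \<alpha> p (multi_deriv \<beta> f)) < \<infinity>}"

definition fs_const :: "nat \<Rightarrow> real \<Rightarrow> real \<Rightarrow> nat \<Rightarrow> real" where
  "fs_const m \<alpha> r n =
    (\<alpha> * r / 2) powr (real m * r / 2 + real n) *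
    (Gamma (real n) / (pi ^ n * Gamma (real m * r / 2 + real n)))"

text \<open>
  The factor \<open>|z|\<^bsup>mp\<^esup>\<close> is written \<open>(|z|\<^sup>m)\<^sup>p\<close> because of the convention \<open>0 powr 0 = 0\<close>, which would
  give the wrong value at \<open>z = 0\<close> for \<open>m = 0\<close>.
\<close>

definition fs_norm :: "nat \<Rightarrow> real \<Rightarrow> ennreal \<Rightarrow> (complex ^ 'n \<Rightarrow> complex) \<Rightarrow> ennreal" where
  "fs_norm m \<alpha> p f =
    (if p = \<infinity> then (SUP z. ennreal (norm z ^ m * norm (f z) * exp (- (\<alpha> / 2) * (norm z)\<^sup>2)))
     else let r = enn2real p in
       epowr (ennreal (fs_const m \<alpha> r CARD('n)) *
              (\<integral>\<^sup>+z. ennreal ((norm z ^ m) powr r * norm (f z) powr r *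
                             exp (- (\<alpha> * r / 2) * (norm z)\<^sup>2)) \<partial>lborel))
             (1 / r))"


section \<open>Operators between normed spaces of functions\<close>

text \<open>
  A normed space of complex functions is given by its carrier \<open>X\<close> and its norm \<open>N\<close>, which is finite
  on \<open>X\<close>. An operator is considered only on \<open>X\<close>; its values elsewhere are irrelevant.
\<close>

definition linear_op ::
  "('a \<Rightarrow> complex) set \<Rightarrow> ('b \<Rightarrow> complex) set \<Rightarrow>
   (('a \<Rightarrow> complex) \<Rightarrow> ('b \<Rightarrow> complex)) \<Rightarrow> bool" where
  "linear_op X Y T \<longleftrightarrow>
    T ` X \<subseteq> Y \<and>
    (\<forall>f\<in>X. \<forall>g\<in>X. \<forall>a b. T (\<lambda>z. a * f z + b * g z) = (\<lambda>z. a * T f z + b * T g z))"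

definition bounded_op ::
  "('a \<Rightarrow> complex) set \<Rightarrow> (('a \<Rightarrow> complex) \<Rightarrow> ennreal) \<Rightarrow>
   ('b \<Rightarrow> complex) set \<Rightarrow> (('b \<Rightarrow> complex) \<Rightarrow> ennreal) \<Rightarrow>
   (('a \<Rightarrow> complex) \<Rightarrow> ('b \<Rightarrow> complex)) \<Rightarrow> bool" where
  "bounded_op X N Y M T \<longleftrightarrow>
    linear_op X Y T \<and> (\<exists>C::real. \<forall>f\<in>X. M (T f) \<le> ennreal C * N f)"

definition compact_op ::
  "('a \<Rightarrow> complex) set \<Rightarrow> (('a \<Rightarrow> complex) \<Rightarrow> ennreal) \<Rightarrow>
   ('b \<Rightarrow> complex) set \<Rightarrow> (('b \<Rightarrow> complex) \<Rightarrow> ennreal) \<Rightarrow>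
   (('a \<Rightarrow> complex) \<Rightarrow> ('b \<Rightarrow> complex)) \<Rightarrow> bool" where
  "compact_op X N Y M K \<longleftrightarrow>
    linear_op X Y K \<and>
    (\<forall>f :: nat \<Rightarrow> 'a \<Rightarrow> complex. (\<forall>k. f k \<in> X \<and> N (f k) \<le> 1) \<longrightarrow>
       (\<exists>g\<in>Y. \<exists>s :: nat \<Rightarrow> nat. strict_mono s \<and>
          (\<lambda>k. M (\<lambda>z. K (f (s k)) z - g z)) \<longlonglongrightarrow> 0))"

definition op_norm ::
  "('a \<Rightarrow> complex) set \<Rightarrow> (('a \<Rightarrow> complex) \<Rightarrow> ennreal) \<Rightarrow> (('b \<Rightarrow> complex) \<Rightarrow> ennreal) \<Rightarrow>
   (('a \<Rightarrow> complex) \<Rightarrow> ('b \<Rightarrow> complex)) \<Rightarrow> ennreal" where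
  "op_norm X N M T = (SUP f\<in>{f \<in> X. N f \<le> 1}. M (T f))"

definition essential_norm ::
  "('a \<Rightarrow> complex) set \<Rightarrow> (('a \<Rightarrow> complex) \<Rightarrow> ennreal) \<Rightarrow>
   ('b \<Rightarrow> complex) set \<Rightarrow> (('b \<Rightarrow> complex) \<Rightarrow> ennreal) \<Rightarrow>
   (('a \<Rightarrow> complex) \<Rightarrow> ('b \<Rightarrow> complex)) \<Rightarrow> ennreal" where
  "essential_norm X N Y M T =
    (INF K\<in>{K. compact_op X N Y M K}. op_norm X N M (\<lambda>f z. T f z - K f z))"


section \<open>Weighted composition operators and their Berezin-type transforms\<close>

definition weighted_comp ::
  "('a \<Rightarrow> complex) \<Rightarrow> ('a \<Rightarrow> 'a) \<Rightarrow> ('a \<Rightarrow> complex) \<Rightarrow> ('a \<Rightarrow> complex)" where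
  "weighted_comp u \<psi> f = (\<lambda>z. u z * f (\<psi> z))"

definition cinner :: "complex ^ 'n \<Rightarrow> complex ^ 'n \<Rightarrow> complex" where
  "cinner z w = (\<Sum>j\<in>UNIV. z $ j * cnj (w $ j))"

definition fock_kernel :: "real \<Rightarrow> complex ^ 'n \<Rightarrow> complex ^ 'n \<Rightarrow> complex" where
  "fock_kernel \<alpha> w z = exp (of_real \<alpha> * cinner z w - of_real (\<alpha> / 2 * (norm w)\<^sup>2))"

definition berezin ::
  "nat \<Rightarrow> real \<Rightarrow> real \<Rightarrow> (complex ^ 'n \<Rightarrow> complex) \<Rightarrow> (complex ^ 'n \<Rightarrow> complex ^ 'n) \<Rightarrow>
   complex ^ 'n \<Rightarrow> ennreal" where
  "berezin m \<alpha> r u \<psi> w =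
    (\<integral>\<^sup>+z. ennreal (norm (fock_kernel \<alpha> w (\<psi> z)) powr r / (1 + norm (\<psi> z)) powr (real m * r) *
                  norm (u z) powr r * (norm z ^ m) powr r *
                  exp (- (\<alpha> * r / 2) * (norm z)\<^sup>2)) \<partial>lborel)"

definition berezin_inf ::
  "nat \<Rightarrow> real \<Rightarrow> (complex ^ 'n \<Rightarrow> complex) \<Rightarrow> (complex ^ 'n \<Rightarrow> complex ^ 'n) \<Rightarrow>
   complex ^ 'n \<Rightarrow> ennreal" where
  "berezin_inf m \<alpha> u \<psi> z =
    ennreal (norm z ^ m * norm (u z) / (1 + norm (\<psi> z)) ^ m *
             exp (\<alpha> / 2 * ((norm (\<psi> z))\<^sup>2 - (norm z)\<^sup>2)))"

text \<open>
  The upper limit of \<open>F w\<close> as \<open>|\<psi> w| \<rightarrow> \<infinity>\<close>. If \<open>\<psi>\<close> is bounded, the supremum is eventually taken over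
  the empty set, where it is \<open>0\<close> in \<^typ>\<open>ennreal\<close>.
\<close>

definition limsup_along :: "('a \<Rightarrow> 'b::real_normed_vector) \<Rightarrow> ('a \<Rightarrow> ennreal) \<Rightarrow> ennreal" where
  "limsup_along \<psi> F = Lim at_top (\<lambda>\<delta>::real. SUP w\<in>{w. \<delta> \<le> norm (\<psi> w)}. F w)"

lemma limsup_along_eq_Inf:
  "limsup_along \<psi> F = (INF \<delta>::real. SUP w\<in>{w. \<delta> \<le> norm (\<psi> w)}. F w)"
proof -
  define S where "S \<delta> = (SUP w\<in>{w. \<delta> \<le> norm (\<psi> w)}. F w)" for \<delta> :: real
  have anti: "S \<delta> \<le> S \<epsilon>" if "\<epsilon> \<le> \<delta>" for \<delta> \<epsilon>
    unfolding S_def by (rule SUP_subset_mono) (use that in auto)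
  have "(S \<longlongrightarrow> (INF \<delta>. S \<delta>)) at_top"
  proof (rule decreasing_tendsto)
    show "\<forall>\<^sub>F \<delta> in at_top. (INF \<delta>. S \<delta>) \<le> S \<delta>"
      by (intro always_eventually allI INF_lower UNIV_I)
  next
    fix x assume "(INF \<delta>. S \<delta>) < x"
    then obtain \<epsilon> where \<epsilon>: "S \<epsilon> < x" by (auto simp: INF_less_iff)
    show "\<forall>\<^sub>F \<delta> in at_top. S \<delta> < x"
      by (rule eventually_mono[OF eventually_ge_at_top[of \<epsilon>]]) (rule le_less_trans[OF anti \<epsilon>])
  qed
  then have "Lim at_top S = (INF \<delta>. S \<delta>)"
    by (intro tendsto_Lim) simp_all
  then show ?thesis
    unfolding limsup_along_def S_def .
qed

lemma limsup_along_bounded: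
  assumes "bounded (range \<psi>)"
  shows "limsup_along \<psi> F = 0"
proof -
  obtain B where B: "\<And>w. norm (\<psi> w) \<le> B"
    using assms by (auto simp: bounded_iff)
  have "{w. B + 1 \<le> norm (\<psi> w)} = {}"
  proof (intro equals0I)
    fix w assume "w \<in> {w. B + 1 \<le> norm (\<psi> w)}"
    then show False using B[of w] by simp
  qed
  then have "(SUP w\<in>{w. B + 1 \<le> norm (\<psi> w)}. F w) = 0"
    by (simp add: bot_ennreal)
  moreover have "limsup_along \<psi> F \<le> (SUP w\<in>{w. B + 1 \<le> norm (\<psi> w)}. F w)"
    unfolding limsup_along_eq_Inf by (rule INF_lower) simp
  ultimately show ?thesis by simp
qed

end

theory Submission
  imports Defs "HOL-Complex_Analysis.Complex_Analysis"
begin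

text \<open>
Write \<open>\<Phi>\<^sub>f(z) = (1 + |z|)\<^sup>m |f(z)| e\<^bsup>-\<alpha>|z|\<^sup>2/2\<^esup>\<close> and \<open>\<lambda>(z) = |z|\<^sup>m |u(z)| (1 + |\<psi>(z)|)\<^bsup>-m\<^esup> e\<^bsup>\<alpha>(|\<psi>(z)|\<^sup>2 - |z|\<^sup>2)/2\<^esup>\<close>
(\<open>Wmod\<close> and \<open>pull_weight\<close> below). The weighted modulus of \<open>u \<cdot> (g \<circ> \<psi>)\<close> at \<open>z\<close> is \<open>\<lambda>(z) \<Phi>\<^sub>g(\<psi>(z))\<close>, the
transform for \<open>q = \<infinity>\<close> is \<open>\<lambda>\<close> itself, and for \<open>q < \<infinity>\<close> it is the Gaussian average
\<open>B(w) = \<integral> \<lambda>(z)\<^sup>q e\<^bsup>-\<alpha>q|\<psi>(z) - w|\<^sup>2/2\<^esup> dz\<close>. So everything is about integrating \<open>\<Phi>\<^sub>g\<^sup>q\<close> against the image under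
\<open>\<psi>\<close> of the measure with density \<open>\<lambda>\<^sup>q\<close>, in the manner of Carleson measures.

Local control. Lebesgue measure is invariant under \<open>x \<mapsto> e\<^bsup>i\<theta>\<^esup> x\<close>, so an entire function has the mean value
property against every radial weight (\<open>radial_mean_value\<close>). Applied to the twisted translates
\<open>x \<mapsto> f(z + x) e\<^bsup>-\<alpha>\<langle>x,z\<rangle>\<^esup>\<close>, this bounds \<open>\<Phi>\<^sub>f(z)\<close> by an integral of \<open>|y|\<^sup>m |f(y)| e\<^bsup>-\<alpha>|y|\<^sup>2/2\<^esup>\<close> over a ball
around \<open>z\<close> (\<open>pointwise_le_local_mean\<close>) and gives the reproducing formula (\<open>reproducing_formula\<close>).
All later estimates use the single kernel \<open>e\<^bsup>-|z-y|\<^esup>\<close>, which changes by at most a constant factor when a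
point is moved by a bounded amount.

Upper bound. Replace the integral in the reproducing formula by a Riemann sum over finitely many small
cells of a large ball. The result is an operator \<open>P\<close> of finite rank with values in linear combinations of
the exponentials \<open>e\<^bsup>\<alpha>\<langle>z,w\<rangle>\<^esup>\<close>. On the unit ball of the space, \<open>f - P f\<close> is uniformly small on a given compact set,
while \<open>\<Phi>\<^bsub>f - P f\<^esub>\<close> is dominated everywhere by the mean of \<open>f\<close> against \<open>e\<^bsup>-|z-y|\<^esup>\<close>, with a constant that does
not depend on \<open>P\<close> (\<open>finite_rank_approximation\<close>). Then \<open>u C\<^sub>\<psi> P\<close> is compact, and in \<open>u C\<^sub>\<psi> (f - P f)\<close> the part
with \<open>|\<psi>(z)| \<le> R\<close> is negligible and the part with \<open>|\<psi>(z)| > R\<close> is controlled by the supremum of the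
transform far out (\<open>truncated_transform_bound\<close>).

Lower bound. The normalised kernels \<open>k\<^sub>w (1 + |w|)\<^bsup>-m\<^esup>\<close> (\<open>test_fun\<close>) are bounded in norm, and the transform is
controlled by the norms of their images. It remains to see that a compact \<open>K\<close> sends them to \<open>0\<close> as
\<open>|w| \<rightarrow> \<infinity>\<close>. If it does not, then along a sparse sequence \<open>w\<^sub>j\<close> the images converge to some
\<open>g \<noteq> 0\<close>. The kernels at sparse points overlap little, so a sum of \<open>N\<close> of them has norm \<open>O(N\<^bsup>1/p\<^esup>)\<close>, while its image is
close to \<open>N g\<close>; for \<open>p > 1\<close> this contradicts boundedness (\<open>compact_perturbation_test_fun\<close>).
\<close>

section \<open>Lebesgue measure on Euclidean spaces\<close>

lemma nn_integral_lincomb: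
  fixes a b :: ennreal
  assumes [measurable]: "f \<in> borel_measurable M" "g \<in> borel_measurable M"
  shows "(\<integral>\<^sup>+x. a * f x + b * g x \<partial>M) = a * (\<integral>\<^sup>+x. f x \<partial>M) + b * (\<integral>\<^sup>+x. g x \<partial>M)"
  by (subst nn_integral_add) (auto simp: nn_integral_cmult)

lemma nn_integral_translate:
  fixes h :: "'a::euclidean_space \<Rightarrow> ennreal"
  assumes [measurable]: "h \<in> borel_measurable borel"
  shows "(\<integral>\<^sup>+x. h (c + x) \<partial>lborel) = (\<integral>\<^sup>+x. h x \<partial>lborel)"
proof -
  have "(\<integral>\<^sup>+x. h x \<partial>lborel) = (\<integral>\<^sup>+x. h x \<partial>(distr lborel borel ((+) c)))"
    by (simp add: lborel_distr_plus)
  also have "\<dots> = (\<integral>\<^sup>+x. h (c + x) \<partial>lborel)"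
    by (subst nn_integral_distr) auto
  finally show ?thesis ..
qed

lemma lborel_ball_finite_pos:
  fixes x :: "'a::euclidean_space"
  assumes "r > 0"
  shows "0 < emeasure lborel (ball x r)" "emeasure lborel (ball x r) < \<infinity>"
proof -
  show "emeasure lborel (ball x r) < \<infinity>"
    by (rule emeasure_bounded_finite) simp
  show "0 < emeasure lborel (ball x r)"
    using assms content_ball_pos[of r x] by (simp add: measure_def enn2real_positive_iff)
qed

text \<open>
Let \<open>B\<close> be the indicator of the unit ball. Integrating \<open>h(T x) B(y - T x)\<close> over both variables gives
\<open>|B| \<integral> h \<circ> T\<close> when \<open>y\<close> is integrated first. Substituting \<open>x \<rightarrow> T\<^sup>-\<^sup>1 y + x\<close> first, and using that \<open>B\<close> is
invariant under \<open>T\<close>, gives \<open>|B| \<integral> h\<close>. Thus invariance under \<open>T\<close> follows from translation invariance.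
\<close>

lemma nn_integral_orthogonal:
  fixes h :: "'a::euclidean_space \<Rightarrow> ennreal" and T :: "'a \<Rightarrow> 'a"
  assumes T: "orthogonal_transformation T" and [measurable]: "h \<in> borel_measurable borel"
  shows "(\<integral>\<^sup>+x. h (T x) \<partial>lborel) = (\<integral>\<^sup>+x. h x \<partial>lborel)"
proof -
  have lin: "linear T" and nT: "\<And>x. norm (T x) = norm x"
    using T by (auto simp: orthogonal_transformation)
  have [measurable]: "T \<in> borel_measurable borel"
    by (intro borel_measurable_continuous_onI linear_continuous_on lin[unfolded linear_conv_bounded_linear])
  define B :: "'a \<Rightarrow> ennreal" where "B x = indicator {..<1} (norm x)" for x
  have [measurable]: "B \<in> borel_measurable borel" unfolding B_def by measurable
  have B_ball: "B = indicator (ball 0 1)" by (auto simp: B_def indicator_def fun_eq_iff)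
  let ?c = "emeasure lborel (ball (0::'a) 1)"
  have IB: "(\<integral>\<^sup>+x. B x \<partial>lborel) = ?c" by (simp add: B_ball)
  have sym: "B (T x) = B x" "B (- x) = B x" for x
    by (auto simp: B_def nT)
  have shift: "(\<integral>\<^sup>+x. h (T x) * B (y - T x) \<partial>lborel) = (\<integral>\<^sup>+x. h (y + T x) * B x \<partial>lborel)" for y
  proof -
    obtain b where b: "T b = y"
      using orthogonal_transformation_surj[OF T] by (metis surjD)
    have "(\<integral>\<^sup>+x. h (T x) * B (y - T x) \<partial>lborel) = (\<integral>\<^sup>+x. h (T (b + x)) * B (y - T (b + x)) \<partial>lborel)"
      by (rule nn_integral_translate[symmetric]) measurable
    then show ?thesis
      by (simp add: linear_add[OF lin] b sym)
  qed
  have "(\<integral>\<^sup>+x. h (T x) \<partial>lborel) * ?c = (\<integral>\<^sup>+x. \<integral>\<^sup>+y. h (T x) * B (y - T x) \<partial>lborel \<partial>lborel)"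
  proof -
    have "(\<integral>\<^sup>+y. B (y - T x) \<partial>lborel) = ?c" for x
      using nn_integral_translate[of B "- T x"] IB by simp
    then show ?thesis
      by (simp add: nn_integral_cmult nn_integral_multc)
  qed
  also have "\<dots> = (\<integral>\<^sup>+y. \<integral>\<^sup>+x. h (T x) * B (y - T x) \<partial>lborel \<partial>lborel)"
    by (rule lborel_pair.Fubini') measurable
  also have "\<dots> = (\<integral>\<^sup>+y. \<integral>\<^sup>+x. h (y + T x) * B x \<partial>lborel \<partial>lborel)"
    by (simp add: shift)
  also have "\<dots> = (\<integral>\<^sup>+x. \<integral>\<^sup>+y. h (y + T x) * B x \<partial>lborel \<partial>lborel)"
    by (rule lborel_pair.Fubini') measurable
  also have "\<dots> = (\<integral>\<^sup>+x. h x \<partial>lborel) * ?c"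
  proof -
    have "(\<integral>\<^sup>+y. h (y + T x) \<partial>lborel) = (\<integral>\<^sup>+y. h y \<partial>lborel)" for x
      using nn_integral_translate[of h "T x"] by (simp add: add.commute)
    then show ?thesis
      by (simp add: nn_integral_cmult nn_integral_multc IB)
  qed
  finally have "(\<integral>\<^sup>+x. h (T x) \<partial>lborel) * ?c / ?c = (\<integral>\<^sup>+x. h x \<partial>lborel) * ?c / ?c"
    by simp
  then show ?thesis
    using lborel_ball_finite_pos[of 1 "0::'a"] by (subst (asm) (1 2) ennreal_mult_divide_eq) auto
qed

lemma nn_integral_exp_neg_norm_finite:
  "(\<integral>\<^sup>+x. ennreal (exp (- norm (x::'a::euclidean_space))) \<partial>lborel) < \<infinity>"
proof -
  define d where "d = real DIM('a)"
  have d: "d > 0" by (simp add: d_def)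
  have le: "ennreal (exp (- norm x)) \<le> (\<Prod>b\<in>Basis. ennreal (exp (- \<bar>x \<bullet> b\<bar> / d)))" for x :: 'a
  proof -
    have "(\<Sum>b\<in>Basis. \<bar>x \<bullet> b\<bar>) \<le> (\<Sum>b\<in>(Basis::'a set). norm x)"
      by (intro sum_mono) (simp add: Basis_le_norm)
    then have "(\<Sum>b\<in>Basis. \<bar>x \<bullet> b\<bar> / d) \<le> norm x"
      using d by (simp add: sum_divide_distrib[symmetric] divide_simps d_def mult.commute)
    then have "exp (- norm x) \<le> (\<Prod>b\<in>Basis. exp (- \<bar>x \<bullet> b\<bar> / d))"
      by (simp add: exp_sum[symmetric] sum_negf)
    then show ?thesis by (simp add: prod_ennreal ennreal_leI)
  qed
  have one: "(\<integral>\<^sup>+t. ennreal (exp (- \<bar>t\<bar> / d)) \<partial>lborel) < \<infinity>"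
  proof -
    have half: "(\<integral>\<^sup>+t. ennreal (exp (- t / d)) * indicator {0..} t \<partial>lborel) = ennreal d"
    proof -
      have "((\<lambda>t. - d * exp (- t / d)) \<longlongrightarrow> 0) at_top"
        using d by real_asymp
      then have "(\<integral>\<^sup>+t. ennreal (exp (- t / d)) * indicator {0..} t \<partial>lborel) = ennreal (0 - (- d * exp (- 0 / d)))"
        using d by (intro nn_integral_FTC_atLeast)
          (auto intro!: derivative_eq_intros simp: field_simps)
      then show ?thesis by simp
    qed
    have "(\<integral>\<^sup>+t. ennreal (exp (- \<bar>t\<bar> / d)) \<partial>lborel) \<le>
       (\<integral>\<^sup>+t. ennreal (exp (- t / d)) * indicator {0..} t + ennreal (exp (- (- t) / d)) * indicator {0..} (- t) \<partial>lborel)"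
      by (intro nn_integral_mono) (auto simp: indicator_def)
    also have "\<dots> = ennreal d + (\<integral>\<^sup>+t. ennreal (exp (- (- t) / d)) * indicator {0..} (- t) \<partial>lborel)"
      by (subst nn_integral_add) (measurable, simp only: half)
    also have "(\<integral>\<^sup>+t. ennreal (exp (- (- t) / d)) * indicator {0..} (- t) \<partial>lborel) = ennreal d"
      using nn_integral_orthogonal[of "\<lambda>t. - t" "\<lambda>t::real. ennreal (exp (- t / d)) * indicator {0..} t"]
      by (simp only: half) (simp add: orthogonal_transformation_neg)
    finally show ?thesis by (simp add: le_less_trans)
  qed
  have "(\<integral>\<^sup>+x. ennreal (exp (- norm (x::'a))) \<partial>lborel) \<le> (\<integral>\<^sup>+x. (\<Prod>b\<in>Basis. ennreal (exp (- \<bar>x \<bullet> b\<bar> / d))) \<partial>(lborel :: 'a measure))"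
    by (intro nn_integral_mono le)
  also have "\<dots> = (\<Prod>b\<in>(Basis::'a set). \<integral>\<^sup>+t. ennreal (exp (- \<bar>t\<bar> / d)) \<partial>lborel)"
    by (rule nn_integral_lborel_prod) auto
  also have "\<dots> < \<infinity>"
    using one by (simp add: power_less_top_ennreal)
  finally show ?thesis .
qed

section \<open>Entire functions and the mean value property\<close>

lemma entire_fun_continuous:
  fixes f :: "complex ^ 'n::finite \<Rightarrow> complex"
  assumes "entire_fun f"
  shows "continuous_on A f"
  using assms unfolding entire_fun_def
  by (intro continuous_at_imp_continuous_on ballI) (metis has_derivative_continuous)

lemma entire_fun_measurable:
  fixes f :: "complex ^ 'n::finite \<Rightarrow> complex"
  assumes "entire_fun f"
  shows "f \<in> borel_measurable borel"
  by (intro borel_measurable_continuous_onI entire_fun_continuous assms)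

lemma entire_map_continuous:
  fixes f :: "complex ^ 'n::finite \<Rightarrow> complex ^ 'n"
  assumes "entire_map f"
  shows "continuous_on A f"
proof -
  have "continuous_on A (\<lambda>z. \<chi> i. f z $ i)"
    using assms unfolding entire_map_def
    by (intro continuous_on_vec_lambda entire_fun_continuous) auto
  then show ?thesis by simp
qed

lemma entire_map_measurable:
  fixes f :: "complex ^ 'n::finite \<Rightarrow> complex ^ 'n"
  assumes "entire_map f"
  shows "f \<in> borel_measurable borel"
  by (intro borel_measurable_continuous_onI entire_map_continuous assms)

lemma entire_fun_lincomb:
  assumes "entire_fun f" "entire_fun g"
  shows "entire_fun (\<lambda>z. a * f z + b * g z)"
  unfolding entire_fun_def
proof
  fix z
  obtain D E where D: "(f has_derivative D) (at z)" "\<forall>c h. D (c *s h) = c * D h"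
    and E: "(g has_derivative E) (at z)" "\<forall>c h. E (c *s h) = c * E h"
    using assms unfolding entire_fun_def by metis
  have "((\<lambda>z. a * f z + b * g z) has_derivative (\<lambda>h. a * D h + b * E h)) (at z)"
    by (intro derivative_intros D E)
  then show "\<exists>D. ((\<lambda>z. a * f z + b * g z) has_derivative D) (at z) \<and> (\<forall>c h. D (c *s h) = c * D h)"
    using D E by (intro exI[of _ "\<lambda>h. a * D h + b * E h"]) (auto simp: algebra_simps)
qed

lemma entire_fun_const: "entire_fun (\<lambda>_. c)"
  unfolding entire_fun_def by (intro allI exI[of _ "\<lambda>_. 0"]) auto

lemma entire_fun_mult:
  assumes "entire_fun f" "entire_fun g"
  shows "entire_fun (\<lambda>z. f z * g z)"
  unfolding entire_fun_def
proof
  fix z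
  obtain D E where D: "(f has_derivative D) (at z)" "\<forall>c h. D (c *s h) = c * D h"
    and E: "(g has_derivative E) (at z)" "\<forall>c h. E (c *s h) = c * E h"
    using assms unfolding entire_fun_def by metis
  have "((\<lambda>z. f z * g z) has_derivative (\<lambda>h. f z * E h + D h * g z)) (at z)"
    by (intro derivative_intros D E)
  then show "\<exists>D. ((\<lambda>z. f z * g z) has_derivative D) (at z) \<and> (\<forall>c h. D (c *s h) = c * D h)"
    using D E by (intro exI[of _ "\<lambda>h. f z * E h + D h * g z"]) (auto simp: algebra_simps)
qed

lemma entire_fun_translate:
  assumes "entire_fun f"
  shows "entire_fun (\<lambda>x. f (z + x))"
  unfolding entire_fun_def
proof
  fix x
  obtain D where D: "(f has_derivative D) (at (z + x))" "\<forall>c h. D (c *s h) = c * D h"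
    using assms unfolding entire_fun_def by metis
  have "((\<lambda>x. f (z + x)) has_derivative D) (at x)"
    by (rule has_derivative_compose[of "\<lambda>x. z + x" "\<lambda>h. h", OF _ D(1)])
       (auto intro!: derivative_eq_intros)
  then show "\<exists>D. ((\<lambda>x. f (z + x)) has_derivative D) (at x) \<and> (\<forall>c h. D (c *s h) = c * D h)"
    using D(2) by blast
qed

lemma bounded_linear_vector_scalar_mult:
  "bounded_linear (\<lambda>t::complex. t *s (x :: complex ^ 'n::finite))"
  unfolding vector_scalar_mult_def
  unfolding linear_conv_bounded_linear[symmetric]
  by (intro linearI) (auto simp: vec_eq_iff algebra_simps)

lemma entire_fun_along_line:
  assumes "entire_fun f"
  shows "(\<lambda>t. f (z + t *s x)) holomorphic_on S"
proof (rule holomorphic_onI)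
  fix t assume "t \<in> S"
  obtain D where D: "(f has_derivative D) (at (z + t *s x))" "\<forall>c h. D (c *s h) = c * D h"
    using assms unfolding entire_fun_def by metis
  have "((\<lambda>t. z + t *s x) has_derivative (\<lambda>h. h *s x)) (at t)"
    by (auto intro!: derivative_eq_intros bounded_linear_imp_has_derivative bounded_linear_vector_scalar_mult)
  from has_derivative_compose[OF this D(1)]
  have "((\<lambda>t. f (z + t *s x)) has_derivative (\<lambda>h. D x * h)) (at t)"
    using D(2) by (simp add: mult.commute)
  then have "((\<lambda>t. f (z + t *s x)) has_field_derivative D x) (at t)"
    by (simp add: has_field_derivative_def)
  then show "(\<lambda>t. f (z + t *s x)) field_differentiable (at t within S)"
    using field_differentiable_at_within field_differentiable_def by blast
qed

lemma norm_vector_scalar_mult: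
  "norm (c *s (x :: complex ^ 'n::finite)) = norm c * norm x"
proof -
  have "norm (c *s x) = L2_set (\<lambda>i. norm c * norm (x $ i)) UNIV"
    by (simp add: norm_vec_def norm_mult)
  also have "\<dots> = norm c * norm x"
    by (simp add: norm_vec_def L2_set_right_distrib)
  finally show ?thesis .
qed

lemma orthogonal_vector_scalar_mult:
  assumes "norm c = 1"
  shows "orthogonal_transformation (\<lambda>x :: complex ^ 'n::finite. c *s x)"
  unfolding orthogonal_transformation
  using assms by (auto simp: norm_vector_scalar_mult vec_eq_iff algebra_simps intro!: linearI)

text \<open>
Cauchy's integral formula at the centre of the unit circle, written as a mean over \<open>[0,1]\<close>.
\<close>

lemma circle_mean:
  assumes "f holomorphic_on UNIV"
  shows "((\<lambda>t. f (exp (2 * of_real pi * \<i> * of_real t))) has_integral f 0) {0..1}"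
proof -
  have "((\<lambda>u. f u / (u - 0)) has_contour_integral (2 * of_real pi * \<i> * f 0)) (circlepath 0 1)"
    by (rule Cauchy_integral_circlepath_simple) (use assms in \<open>auto intro: holomorphic_on_subset\<close>)
  then have "((\<lambda>t. f (exp (2 * of_real pi * \<i> * of_real t)) / exp (2 * of_real pi * \<i> * of_real t) * 
       (2 * of_real pi * \<i> * exp (2 * of_real pi * \<i> * of_real t))) has_integral (2 * of_real pi * \<i> * f 0)) {0..1}"
    unfolding has_contour_integral_def
    by (rule has_integral_eq[rotated])
       (simp add: vector_derivative_circlepath01, simp add: circlepath)
  then have "((\<lambda>t. (2 * of_real pi * \<i>) * f (exp (2 * of_real pi * \<i> * of_real t))) has_integral (2 * of_real pi * \<i> * f 0)) {0..1}"
    by (rule has_integral_eq[rotated]) simp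
  then show ?thesis
    by (subst (asm) has_integral_mult_right_iff) auto
qed

text \<open>
By rotation invariance \<open>\<integral> W g\<close> does not change when \<open>g(x)\<close> is replaced by \<open>g(e\<^bsup>2\<pi>it\<^esup> x)\<close>. Averaging over
\<open>t \<in> [0,1]\<close> and exchanging the integrals turns the latter into \<open>g(0)\<close> for each \<open>x\<close>.
\<close>

lemma radial_mean_value:
  fixes g :: "complex ^ 'n::finite \<Rightarrow> complex" and W :: "complex ^ 'n \<Rightarrow> real"
  assumes g: "entire_fun g"
    and W: "integrable lborel W" "\<And>c x. norm c = 1 \<Longrightarrow> W (c *s x) = W x"
    and gW: "integrable lborel (\<lambda>x. W x *\<^sub>R g x)"
  shows "(LINT x|lborel. W x *\<^sub>R g x) = (LINT x|lborel. W x) *\<^sub>R g 0"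
proof -
  define e where "e t = exp (2 * of_real pi * \<i> * of_real t)" for t :: real
  have [simp]: "norm (e t) = 1" for t
    by (simp add: e_def norm_exp_eq_Re)
  have [measurable]: "e \<in> borel_measurable borel"
    unfolding e_def by (intro borel_measurable_continuous_onI continuous_intros)
  have [measurable]: "W \<in> borel_measurable borel"
    using W(1) by (auto dest: borel_measurable_integrable)
  have [measurable]: "g \<in> borel_measurable borel"
    by (rule entire_fun_measurable[OF g])
  have "continuous_on UNIV (\<lambda>p. fst p *s snd p :: complex ^ 'n)"
    unfolding vector_scalar_mult_def by (intro continuous_intros)
  then have [measurable]: "(\<lambda>p. fst p *s snd p :: complex ^ 'n) \<in> borel_measurable (borel \<Otimes>\<^sub>M borel)"
    unfolding borel_prod by (rule borel_measurable_continuous_onI)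
  have [measurable]: "(\<lambda>p. e (fst p) *s snd p :: complex ^ 'n) \<in> borel_measurable (borel \<Otimes>\<^sub>M borel)"
    using measurable_compose[of "\<lambda>p. (e (fst p), snd p)" "borel \<Otimes>\<^sub>M borel" "borel \<Otimes>\<^sub>M borel" "\<lambda>p. fst p *s snd p :: complex ^ 'n" borel]
    by simp
  have [measurable]: "(\<lambda>x. e t *s x :: complex ^ 'n) \<in> borel_measurable borel" for t
    by (rule measurable_compose_Pair1[of t borel "\<lambda>p. e (fst p) *s snd p" borel borel, simplified]) measurable
  define I :: "real \<Rightarrow> real" where "I = indicator {0..1}"
  have [measurable]: "I \<in> borel_measurable borel" unfolding I_def by measurable
  have intI: "(LINT t|lborel. I t) = 1" "integrable lborel I"
    unfolding I_def by (auto simp: integrable_indicator_iff)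
  define F where "F t x = (I t * W x) *\<^sub>R g (e t *s x)" for t x
  have [measurable]: "case_prod F \<in> borel_measurable (lborel \<Otimes>\<^sub>M lborel)"
    unfolding F_def case_prod_beta' by measurable
  have rot: "(\<integral>\<^sup>+x. ennreal (norm (W x *\<^sub>R g (e t *s x))) \<partial>lborel) = (\<integral>\<^sup>+x. ennreal (norm (W x *\<^sub>R g x)) \<partial>lborel)" for t
    using nn_integral_orthogonal[OF orthogonal_vector_scalar_mult, of "e t" "\<lambda>x. ennreal (norm (W x *\<^sub>R g x))"]
    by (simp add: W(2))
  have "integrable (lborel \<Otimes>\<^sub>M lborel) (case_prod F)"
  proof (rule integrableI_bounded)
    have "(\<integral>\<^sup>+p. ennreal (norm (case_prod F p)) \<partial>(lborel \<Otimes>\<^sub>M lborel)) 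
       = (\<integral>\<^sup>+t. \<integral>\<^sup>+x. ennreal (norm (F t x)) \<partial>lborel \<partial>lborel)"
      by (subst lborel.nn_integral_fst[symmetric]) auto
    also have "\<dots> = (\<integral>\<^sup>+t. \<integral>\<^sup>+x. ennreal \<bar>I t\<bar> * ennreal (norm (W x *\<^sub>R g (e t *s x))) \<partial>lborel \<partial>lborel)"
      by (simp add: F_def abs_mult ennreal_mult'' mult.assoc)
    also have "\<dots> = (\<integral>\<^sup>+t. ennreal \<bar>I t\<bar> * (\<integral>\<^sup>+x. ennreal (norm (W x *\<^sub>R g x)) \<partial>lborel) \<partial>lborel)"
      by (subst nn_integral_cmult) (measurable, simp only: rot)
    also have "\<dots> = (\<integral>\<^sup>+x. ennreal (norm (W x *\<^sub>R g x)) \<partial>lborel) * (\<integral>\<^sup>+t. ennreal \<bar>I t\<bar> \<partial>lborel)"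
      by (subst nn_integral_multc) (auto simp: mult.commute)
    also have "\<dots> < \<infinity>"
      using gW intI(2) by (auto simp: integrable_iff_bounded ennreal_mult_less_top)
    finally show "(\<integral>\<^sup>+p. ennreal (norm (case_prod F p)) \<partial>(lborel \<Otimes>\<^sub>M lborel)) < \<infinity>" .
  qed measurable
  from lborel_pair.Fubini_integral[OF this]
  have sw: "(LINT x|lborel. LINT t|lborel. F t x) = (LINT t|lborel. LINT x|lborel. F t x)" .
  have rot': "(LINT x|lborel. W x *\<^sub>R g (e t *s x)) = (LINT x|lborel. W x *\<^sub>R g x)" for t
  proof -
    have inv: "distr lborel borel (\<lambda>x. e t *s x) = (lborel :: (complex ^ 'n) measure)"
    proof (rule measure_eqI)
      fix A assume "A \<in> sets (distr lborel borel (\<lambda>x. e t *s x :: complex ^ 'n))"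
      then have [measurable]: "A \<in> sets borel" by simp
      have "emeasure (distr lborel borel (\<lambda>x. e t *s x)) A = (\<integral>\<^sup>+x. indicator A x \<partial>(distr lborel borel (\<lambda>x. e t *s x)))"
        by simp
      also have "\<dots> = (\<integral>\<^sup>+x. indicator A (e t *s x) \<partial>lborel)"
        by (subst nn_integral_distr) auto
      also have "\<dots> = emeasure lborel A"
        by (subst nn_integral_orthogonal[OF orthogonal_vector_scalar_mult]) auto
      finally show "emeasure (distr lborel borel (\<lambda>x. e t *s x)) A = emeasure lborel A" .
    qed simp
    have "(LINT x|lborel. W x *\<^sub>R g x) = (LINT x|distr lborel borel (\<lambda>x. e t *s x). W x *\<^sub>R g x)"
      by (simp add: inv)
    also have "\<dots> = (LINT x|lborel. W x *\<^sub>R g (e t *s x))"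
      by (subst integral_distr) (auto simp: W(2))
    finally show ?thesis ..
  qed
  have "(LINT t|lborel. LINT x|lborel. F t x) = (LINT t|lborel. I t *\<^sub>R (LINT x|lborel. W x *\<^sub>R g x))"
    unfolding F_def by (simp add: scaleR_scaleR[symmetric] rot' del: scaleR_scaleR)
  also have "\<dots> = (LINT x|lborel. W x *\<^sub>R g x)"
    using intI by (subst integral_scaleR_left) auto
  finally have 1: "(LINT x|lborel. LINT t|lborel. F t x) = (LINT x|lborel. W x *\<^sub>R g x)"
    using sw by simp
  have mean: "(LINT t|lborel. I t *\<^sub>R g (e t *s x)) = g 0" for x
  proof -
    have "((\<lambda>t. g (0 + e t *s x)) has_integral g (0 + 0 *s x)) {0..1}"
      unfolding e_def by (rule circle_mean entire_fun_along_line g)+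
    moreover have "(LBINT t:{0..1}. g (e t *s x)) = integral {0..1} (\<lambda>t. g (e t *s x))"
    proof (rule set_borel_integral_eq_integral(2))
      have "continuous_on {0..1} (\<lambda>t. g (e t *s x))"
        unfolding e_def vector_scalar_mult_def 
        by (intro continuous_on_compose2[OF entire_fun_continuous[OF g, of UNIV]] continuous_intros) auto
      then show "set_integrable lborel {0..1} (\<lambda>t. g (e t *s x))"
        unfolding set_integrable_def by (intro borel_integrable_compact) auto
    qed
    ultimately show ?thesis
      by (simp add: I_def set_lebesgue_integral_def integral_unique)
  qed
  have "(LINT x|lborel. LINT t|lborel. F t x) = (LINT x|lborel. W x *\<^sub>R g 0)"
  proof (rule Bochner_Integration.integral_cong)
    fix x
    have "(LINT t|lborel. F t x) = (LINT t|lborel. W x *\<^sub>R (I t *\<^sub>R g (e t *s x)))"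
      by (simp add: F_def mult.commute)
    then show "(LINT t|lborel. F t x) = W x *\<^sub>R g 0"
      using mean[of x] by (simp only: integral_scaleR_right)
  qed simp
  also have "\<dots> = (LINT x|lborel. W x) *\<^sub>R g 0"
    using W(1) by (subst integral_scaleR_left) auto
  finally show ?thesis using 1 by simp
qed

section \<open>Weighted power means\<close>

text \<open>
The tangent inequality for the convex function \<open>s \<mapsto> s\<^sup>r\<close> at \<open>t\<close>, solved for \<open>s\<close>.
\<close>

lemma le_powr_average:
  fixes s t r :: real
  assumes "1 \<le> r" "0 < t" "0 \<le> s"
  shows "s \<le> t * (1 - 1 / r) + t powr (1 - r) / r * s powr r"
proof -
  have "s / t \<le> (1 - 1 / r) + (s / t) powr r / r"
  proof (cases "r = 1")
    case True
    then show ?thesis using assms by simp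
  next
    case False
    then show ?thesis
      using Youngs_inequality[of "1 / (1 - 1 / r)" r "1" "s / t"] assms
      by (simp add: field_simps)
  qed
  then have "s \<le> t * ((1 - 1 / r) + (s / t) powr r / r)"
    using assms by (simp add: field_simps)
  also have "\<dots> = t * (1 - 1 / r) + t powr (1 - r) / r * s powr r"
    using assms by (simp add: powr_divide powr_diff field_simps)
  finally show ?thesis .
qed

text \<open>
Jensen's inequality for the measure with density \<open>K\<close>. The tangent inequality at a constant \<open>t\<close>, integrated,
bounds the integral of \<open>K g\<close> by that of \<open>K g\<^sup>r\<close>; the best \<open>t\<^sup>r\<close> is the mean of \<open>g\<^sup>r\<close>, which is enlarged by
\<open>e > 0\<close> in order to keep \<open>t\<close> positive.
\<close>

lemma powr_le_weighted_integral:
  fixes K g :: "'a \<Rightarrow> real"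
  assumes [measurable]: "K \<in> borel_measurable M" "g \<in> borel_measurable M"
    and K: "\<And>y. 0 \<le> K y" and g: "\<And>y. 0 \<le> g y"
    and k: "(\<integral>\<^sup>+y. ennreal (K y) \<partial>M) \<le> ennreal k" "0 < k"
    and r: "1 \<le> r" and x: "0 \<le> x" and C: "0 < C"
    and le: "ennreal x \<le> ennreal C * (\<integral>\<^sup>+y. ennreal (K y * g y) \<partial>M)"
  shows "ennreal (x powr r) \<le> ennreal (C powr r * k powr (r - 1)) * (\<integral>\<^sup>+y. ennreal (K y * g y powr r) \<partial>M)"
proof (cases "(\<integral>\<^sup>+y. ennreal (K y * g y powr r) \<partial>M) = \<infinity>")
  case True
  then show ?thesis using C k by (simp add: ennreal_mult_top)
next
  case False
  then obtain S where S: "(\<integral>\<^sup>+y. ennreal (K y * g y powr r) \<partial>M) = ennreal S" "0 \<le> S"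
    by (cases "\<integral>\<^sup>+y. ennreal (K y * g y powr r) \<partial>M") auto
  have *: "x powr r \<le> C powr r * k powr (r - 1) * (S + e)" if e: "e > 0" for e
  proof -
    \<comment> \<open>with this \<open>t\<close> the two terms of the tangent inequality add up to \<open>t k\<close>\<close>
    define t where "t = ((S + e) / k) powr (1 / r)"
    have t: "t > 0" "t powr r = (S + e) / k"
      using e S(2) k r by (auto simp: t_def powr_powr)
    have "(\<integral>\<^sup>+y. ennreal (K y * g y) \<partial>M) \<le> 
      (\<integral>\<^sup>+y. ennreal (t * (1 - 1 / r)) * ennreal (K y) + ennreal (t powr (1 - r) / r) * ennreal (K y * g y powr r) \<partial>M)"
    proof (rule nn_integral_mono)
      fix y
      have "K y * g y \<le> K y * (t * (1 - 1 / r) + t powr (1 - r) / r * g y powr r)"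
        by (intro mult_left_mono le_powr_average r t g K)
      also have "\<dots> = t * (1 - 1 / r) * K y + t powr (1 - r) / r * (K y * g y powr r)"
        by (simp add: algebra_simps)
      finally show "ennreal (K y * g y) \<le> ennreal (t * (1 - 1 / r)) * ennreal (K y) + ennreal (t powr (1 - r) / r) * ennreal (K y * g y powr r)"
        using K t r by (simp add: ennreal_mult'[symmetric] ennreal_plus[symmetric] ennreal_leI del: ennreal_plus)
    qed
    also have "\<dots> = ennreal (t * (1 - 1 / r)) * (\<integral>\<^sup>+y. ennreal (K y) \<partial>M) + ennreal (t powr (1 - r) / r) * ennreal S"
      by (subst nn_integral_add) (auto simp: nn_integral_cmult S(1))
    also have "\<dots> \<le> ennreal (t * (1 - 1 / r)) * ennreal k + ennreal (t powr (1 - r) / r) * ennreal S"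
      by (intro add_right_mono mult_left_mono k) simp
    also have "\<dots> = ennreal (t * (1 - 1 / r) * k + t powr (1 - r) / r * S)"
      using t r k S(2) by (simp add: ennreal_mult'[symmetric] ennreal_plus[symmetric] del: ennreal_plus)
    also have "\<dots> \<le> ennreal (t * k)"
    proof (rule ennreal_leI)
      have "t powr (1 - r) * S \<le> t powr (1 - r) * (S + e)"
        using e by (intro mult_left_mono) auto
      also have "\<dots> = t * k"
        using t k e S(2) r by (simp add: powr_diff divide_simps mult.commute)
      finally have "t powr (1 - r) / r * S \<le> t * k / r"
        using r by (simp add: divide_right_mono)
      then show "t * (1 - 1 / r) * k + t powr (1 - r) / r * S \<le> t * k"
        by (simp add: algebra_simps)
    qed
    finally have "ennreal x \<le> ennreal C * ennreal (t * k)"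
      using le by (meson mult_left_mono order_trans zero_le)
    then have "x \<le> C * (t * k)"
      using C t k by (simp add: ennreal_mult'[symmetric])
    then have "x powr r \<le> (C * (t * k)) powr r"
      using x r by (intro powr_mono2) auto
    also have "\<dots> = C powr r * k powr (r - 1) * (S + e)"
      using C t k by (simp add: powr_mult powr_diff)
    finally show ?thesis .
  qed
  have "x powr r \<le> C powr r * k powr (r - 1) * S"
  proof (rule field_le_epsilon)
    fix e :: real assume e: "e > 0"
    have p: "C powr r * k powr (r - 1) > 0" using C k by simp
    have "x powr r \<le> C powr r * k powr (r - 1) * (S + e / (C powr r * k powr (r - 1)))"
      by (rule *) (use e p in simp)
    also have "\<dots> = C powr r * k powr (r - 1) * S + e"
      using p by (simp only: distrib_left) (use C k in simp)
    finally show "x powr r \<le> C powr r * k powr (r - 1) * S + e" .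
  qed
  then show ?thesis
    using C k S by (simp add: ennreal_mult'[symmetric] ennreal_leI)
qed

section \<open>Pointwise estimates for entire functions\<close>

lemma Re_cinner: "Re (cinner z w) = z \<bullet> w"
  unfolding cinner_def by (simp add: inner_vec_def inner_complex_def)

lemma cnj_cinner: "cnj (cinner z w) = cinner w z"
  unfolding cinner_def by (simp add: mult.commute)

lemma cinner_self: "cinner z z = of_real ((norm z)\<^sup>2)"
proof (rule complex_eqI)
  have "cnj (cinner z z) = cinner z z" by (rule cnj_cinner)
  then show "Im (cinner z z) = Im (of_real ((norm z)\<^sup>2))"
    by (metis Im_complex_of_real cnj.simps(2) complex_cnj_complex_of_real equal_neg_zero)
qed (simp add: Re_cinner power2_norm_eq_inner)

lemma cinner_add: "cinner (x + y) w = cinner x w + cinner y w" "cinner w (x + y) = cinner w x + cinner w y"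
  unfolding cinner_def by (simp_all add: algebra_simps sum.distrib)

lemma cinner_zero [simp]: "cinner 0 w = 0" "cinner w 0 = 0"
  unfolding cinner_def by simp_all

lemma cinner_scale: "cinner (c *s x) w = c * cinner x w"
  unfolding cinner_def by (simp add: sum_distrib_left algebra_simps)

lemma bounded_linear_cinner: "bounded_linear (\<lambda>x :: complex ^ 'n::finite. cinner x w)"
  unfolding linear_conv_bounded_linear[symmetric]
  by (intro linearI) (auto simp: cinner_def algebra_simps sum.distrib sum_distrib_left scaleR_sum_right)

lemma continuous_on_cinner [continuous_intros]:
  fixes f g :: "'a::topological_space \<Rightarrow> complex ^ 'n::finite"
  assumes "continuous_on S f" "continuous_on S g"
  shows "continuous_on S (\<lambda>x. cinner (f x) (g x))"
  unfolding cinner_def using assms by (intro continuous_intros)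

lemma entire_fun_exp_cinner:
  "entire_fun (\<lambda>x :: complex ^ 'n::finite. exp (c * cinner x w))"
  unfolding entire_fun_def
proof
  fix z :: "complex ^ 'n"
  have "((\<lambda>x. c * cinner x w) has_derivative (\<lambda>h. c * cinner h w)) (at z)"
    by (intro has_derivative_mult_right bounded_linear_imp_has_derivative bounded_linear_cinner)
  from has_derivative_compose[OF this has_field_derivative_imp_has_derivative[OF DERIV_exp]]
  show "\<exists>D. ((\<lambda>x. exp (c * cinner x w)) has_derivative D) (at z) \<and> (\<forall>c h. D (c *s h) = c * D h)"
    by (intro exI conjI allI, assumption) (auto simp: cinner_scale)
qed

text \<open>
Up to a factor \<open>e\<^bsup>-\<alpha>|z|\<^sup>2/2\<^esup>\<close> this is the Weyl translation of \<open>f\<close>, which is isometric for the Gaussian weight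
(see \<open>norm_twisted_shift\<close>) and keeps functions entire.
\<close>

definition twisted_shift :: "real \<Rightarrow> complex ^ 'n \<Rightarrow> (complex ^ 'n \<Rightarrow> complex) \<Rightarrow> complex ^ 'n \<Rightarrow> complex" where
  "twisted_shift \<alpha> z f x = f (z + x) * exp (- of_real \<alpha> * cinner x z)"

lemma entire_twisted_shift:
  fixes f :: "complex ^ 'n::finite \<Rightarrow> complex"
  assumes "entire_fun f"
  shows "entire_fun (twisted_shift \<alpha> z f)"
  unfolding twisted_shift_def
  by (intro entire_fun_mult entire_fun_translate assms entire_fun_exp_cinner)

lemma norm_plus_squared: "(norm (z + x :: 'a::real_inner))\<^sup>2 = (norm z)\<^sup>2 + 2 * (x \<bullet> z) + (norm x)\<^sup>2"
  by (simp add: power2_norm_eq_inner inner_add inner_commute)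

lemma norm_twisted_shift:
  "norm (twisted_shift \<alpha> z f x) * exp (- (\<alpha> / 2) * (norm x)\<^sup>2) =
   exp (\<alpha> / 2 * (norm z)\<^sup>2) * (norm (f (z + x)) * exp (- (\<alpha> / 2) * (norm (z + x))\<^sup>2))"
proof -
  have "norm (twisted_shift \<alpha> z f x) = norm (f (z + x)) * exp (- \<alpha> * (x \<bullet> z))"
    by (simp add: twisted_shift_def norm_mult Re_cinner)
  moreover have "exp (- \<alpha> * (x \<bullet> z)) * exp (- (\<alpha> / 2) * (norm x)\<^sup>2) = exp (\<alpha> / 2 * (norm z)\<^sup>2) * exp (- (\<alpha> / 2) * (norm (z + x))\<^sup>2)"
    unfolding exp_add[symmetric] norm_plus_squared by (simp add: algebra_simps)
  ultimately show ?thesis by (simp add: mult_ac)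
qed

definition annulus :: "real \<Rightarrow> real \<Rightarrow> (complex ^ 'n::finite) set" where
  "annulus a b = {x. a \<le> norm x \<and> norm x \<le> b}"

lemma annulus_measurable [measurable]: "annulus a b \<in> sets borel"
  unfolding annulus_def by measurable

lemma compact_annulus: "compact (annulus a b :: (complex ^ 'n::finite) set)"
proof -
  have "annulus a b = (cball 0 b - ball 0 a :: (complex ^ 'n) set)" by (auto simp: annulus_def)
  then show ?thesis by (simp add: compact_diff)
qed

text \<open>
The mean value property of the twisted translate of \<open>f\<close>, against the weight \<open>e\<^bsup>-\<alpha>|x|\<^sup>2/2\<^esup>\<close> restricted to the annulus.
\<close>

lemma annulus_mean:
  fixes a b \<alpha> :: real
  assumes "0 \<le> a" "a < b"
  shows "\<exists>c>0. \<forall>(f :: complex ^ 'n::finite \<Rightarrow> complex) z. entire_fun f \<longrightarrow>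
    ennreal (norm (f z) * exp (- (\<alpha> / 2) * (norm z)\<^sup>2)) \<le> 
    ennreal c * (\<integral>\<^sup>+x. indicator (annulus a b) x * ennreal (norm (f (z + x)) * exp (- (\<alpha> / 2) * (norm (z + x))\<^sup>2)) \<partial>lborel)"
proof -
  let ?A = "annulus a b :: (complex ^ 'n) set"
  define W :: "complex ^ 'n \<Rightarrow> real" where "W x = indicator ?A x * exp (- (\<alpha> / 2) * (norm x)\<^sup>2)" for x
  have W0: "W x \<ge> 0" for x by (simp add: W_def)
  have [measurable]: "W \<in> borel_measurable borel" unfolding W_def by measurable
  have Wint: "integrable lborel W"
    using borel_integrable_compact[OF compact_annulus, of a b "\<lambda>x. exp (- (\<alpha> / 2) * (norm x)\<^sup>2)"]
    by (simp add: W_def[abs_def] continuous_intros)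
  define J where "J = (LINT x|lborel. W x)"
  have J: "J > 0"
  proof -
    obtain x0 :: "complex ^ 'n" where x0: "norm x0 = (a + b) / 2"
      using vector_choose_size[of "(a + b) / 2"] assms by auto
    define d where "d = (b - a) / 2"
    have d: "d > 0" using assms by (simp add: d_def)
    have sub: "ball x0 d \<subseteq> ?A"
    proof
      fix x assume "x \<in> ball x0 d"
      then have "norm (x0 - x) < d" by (simp add: dist_norm)
      moreover have "norm x0 \<le> norm (x0 - x) + norm x" "norm x \<le> norm (x0 - x) + norm x0"
        using norm_triangle_sub[of x0 x] norm_triangle_sub[of x x0] by (simp_all add: norm_minus_commute)
      ultimately show "x \<in> ?A" using x0 unfolding annulus_def d_def by (simp add: field_simps)
    qed
    have "J \<ge> 0" unfolding J_def using W0 by simp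
    moreover have "J \<noteq> 0"
    proof
      assume "J = 0"
      then have "AE x in lborel. W x = 0"
        using integral_nonneg_eq_0_iff_AE[OF Wint] W0 by (auto simp: J_def)
      then have "AE x in lborel. x \<notin> ball x0 d"
        by eventually_elim (use sub in \<open>auto simp: W_def indicator_def split: if_splits\<close>)
      then have "emeasure lborel (ball x0 d) = 0"
        by (subst (asm) AE_iff_measurable[OF _ refl]) (auto simp: ball_def)
      then show False using lborel_ball_finite_pos(1)[OF d, of x0] by simp
    qed
    ultimately show ?thesis by simp
  qed
  show ?thesis
  proof (intro exI[of _ "1 / J"] conjI allI impI)
    show "1 / J > 0" using J by simp
    fix f :: "complex ^ 'n \<Rightarrow> complex" and z
    assume f: "entire_fun f"
    define g where "g = twisted_shift \<alpha> z f"
    have g: "entire_fun g" unfolding g_def by (rule entire_twisted_shift[OF f])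
    have [measurable]: "f \<in> borel_measurable borel" "g \<in> borel_measurable borel"
      by (intro entire_fun_measurable f g)+
    have gW: "integrable lborel (\<lambda>x. W x *\<^sub>R g x)"
      using borel_integrable_compact[OF compact_annulus, of a b "\<lambda>x. exp (- (\<alpha> / 2) * (norm x)\<^sup>2) *\<^sub>R g x"]
      by (simp add: W_def[abs_def] continuous_intros entire_fun_continuous g)
    have rad: "W (c *s x) = W x" if "norm c = 1" for c x
      using that by (simp add: W_def annulus_def norm_vector_scalar_mult indicator_def)
    have "J * norm (g 0) = norm (LINT x|lborel. W x *\<^sub>R g x)"
      using radial_mean_value[OF g Wint rad gW] J by (simp add: J_def)
    then have "ennreal (J * norm (g 0)) \<le> (\<integral>\<^sup>+x. ennreal (norm (W x *\<^sub>R g x)) \<partial>lborel)"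
      using integral_norm_bound_ennreal[OF gW] by simp
    also have "\<dots> = (\<integral>\<^sup>+x. ennreal (exp (\<alpha> / 2 * (norm z)\<^sup>2)) * (indicator ?A x * ennreal (norm (f (z + x)) * exp (- (\<alpha> / 2) * (norm (z + x))\<^sup>2))) \<partial>lborel)"
    proof (rule nn_integral_cong)
      fix x
      show "ennreal (norm (W x *\<^sub>R g x)) = ennreal (exp (\<alpha> / 2 * (norm z)\<^sup>2)) * (indicator ?A x * ennreal (norm (f (z + x)) * exp (- (\<alpha> / 2) * (norm (z + x))\<^sup>2)))"
        using norm_twisted_shift[of \<alpha> z f x]
        by (auto simp: W_def g_def indicator_def mult.commute ennreal_mult'[symmetric] simp del: times_divide_eq_left)
    qed
    also have "\<dots> = ennreal (exp (\<alpha> / 2 * (norm z)\<^sup>2)) * (\<integral>\<^sup>+x. indicator ?A x * ennreal (norm (f (z + x)) * exp (- (\<alpha> / 2) * (norm (z + x))\<^sup>2)) \<partial>lborel)"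
      (is "_ = _ * ?I")
      by (rule nn_integral_cmult) measurable
    finally have "ennreal (exp (- (\<alpha> / 2) * (norm z)\<^sup>2) / J) * ennreal (J * norm (g 0)) \<le> 
      ennreal (exp (- (\<alpha> / 2) * (norm z)\<^sup>2) / J) * (ennreal (exp (\<alpha> / 2 * (norm z)\<^sup>2)) * ?I)"
      by (rule mult_left_mono) simp
    moreover have "ennreal (exp (- (\<alpha> / 2) * (norm z)\<^sup>2) / J) * ennreal (J * norm (g 0)) = ennreal (norm (f z) * exp (- (\<alpha> / 2) * (norm z)\<^sup>2))"
      using J by (simp add: ennreal_mult'[symmetric] g_def twisted_shift_def mult.commute)
    moreover have "ennreal (exp (- (\<alpha> / 2) * (norm z)\<^sup>2) / J) * (ennreal (exp (\<alpha> / 2 * (norm z)\<^sup>2)) * ?I) = ennreal (1 / J) * ?I"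
      unfolding mult.assoc[symmetric] using J
      by (simp add: ennreal_mult'[symmetric] exp_minus)
    ultimately show "ennreal (norm (f z) * exp (- (\<alpha> / 2) * (norm z)\<^sup>2)) \<le> ennreal (1 / J) * ?I"
      by simp
  qed
qed

text \<open>
The norms of the spaces use the weight \<open>|z|\<^sup>m\<close>, while the transforms contain \<open>(1 + |\<psi>(z)|)\<^sup>m\<close>. Both weighted
moduli are needed; for entire functions the larger one is controlled by means of the smaller one.
\<close>

definition wmod :: "nat \<Rightarrow> real \<Rightarrow> (complex ^ 'n \<Rightarrow> complex) \<Rightarrow> complex ^ 'n \<Rightarrow> real" where
  "wmod m \<alpha> f z = norm z ^ m * (norm (f z) * exp (- (\<alpha> / 2) * (norm z)\<^sup>2))"

definition Wmod :: "nat \<Rightarrow> real \<Rightarrow> (complex ^ 'n \<Rightarrow> complex) \<Rightarrow> complex ^ 'n \<Rightarrow> real" where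
  "Wmod m \<alpha> f z = (1 + norm z) ^ m * (norm (f z) * exp (- (\<alpha> / 2) * (norm z)\<^sup>2))"

abbreviation (input) energy :: "nat \<Rightarrow> real \<Rightarrow> real \<Rightarrow> (complex ^ 'n::finite \<Rightarrow> complex) \<Rightarrow> ennreal" where
  "energy m \<alpha> r f \<equiv> \<integral>\<^sup>+z. ennreal (wmod m \<alpha> f z powr r) \<partial>lborel"

abbreviation (input) local_mean :: "nat \<Rightarrow> real \<Rightarrow> (complex ^ 'n::finite \<Rightarrow> complex) \<Rightarrow> complex ^ 'n \<Rightarrow> ennreal" where
  "local_mean m \<alpha> f z \<equiv> \<integral>\<^sup>+y. indicator (cball z 4) y * ennreal (wmod m \<alpha> f y) \<partial>lborel"

abbreviation (input) exp_avg :: "(complex ^ 'n::finite \<Rightarrow> real) \<Rightarrow> complex ^ 'n \<Rightarrow> ennreal" where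
  "exp_avg h z \<equiv> \<integral>\<^sup>+y. ennreal (exp (- norm (z - y)) * h y) \<partial>lborel"

lemma wmod_nonneg [simp]: "0 \<le> wmod m \<alpha> f z" "0 \<le> Wmod m \<alpha> f z"
  by (simp_all add: wmod_def Wmod_def)

lemma wmod_le_Wmod: "wmod m \<alpha> f z \<le> Wmod m \<alpha> f z"
  unfolding wmod_def Wmod_def by (intro mult_right_mono power_mono) auto

lemma wmod_measurable:
  fixes f :: "complex ^ 'n::finite \<Rightarrow> complex"
  assumes [measurable]: "f \<in> borel_measurable borel"
  shows "wmod m \<alpha> f \<in> borel_measurable borel" "Wmod m \<alpha> f \<in> borel_measurable borel"
  unfolding wmod_def Wmod_def by measurable

text \<open>
The weight \<open>|y|\<^sup>m\<close> vanishes at the origin. For \<open>|z| \<le> 2\<close> the mean is therefore taken over an annulus around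
\<open>z\<close> that stays away from \<open>0\<close>, and otherwise over the unit ball around \<open>z\<close>; in both cases \<open>1 + |z| \<le> 3 |y|\<close> on
the region of integration.
\<close>

lemma pointwise_le_local_mean:
  "\<exists>C>0. \<forall>(f :: complex ^ 'n::finite \<Rightarrow> complex) z. entire_fun f \<longrightarrow>
    ennreal (Wmod m \<alpha> f z) \<le> ennreal C * local_mean m \<alpha> f z"
proof -
  obtain c1 c2 where c1: "c1 > 0" 
    "\<And>(f :: complex ^ 'n \<Rightarrow> complex) z. entire_fun f \<Longrightarrow>
    ennreal (norm (f z) * exp (- (\<alpha> / 2) * (norm z)\<^sup>2)) \<le> 
    ennreal c1 * (\<integral>\<^sup>+x. indicator (annulus 0 1) x * ennreal (norm (f (z + x)) * exp (- (\<alpha> / 2) * (norm (z + x))\<^sup>2)) \<partial>lborel)"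
    and c2: "c2 > 0" 
    "\<And>(f :: complex ^ 'n \<Rightarrow> complex) z. entire_fun f \<Longrightarrow>
    ennreal (norm (f z) * exp (- (\<alpha> / 2) * (norm z)\<^sup>2)) \<le> 
    ennreal c2 * (\<integral>\<^sup>+x. indicator (annulus 3 4) x * ennreal (norm (f (z + x)) * exp (- (\<alpha> / 2) * (norm (z + x))\<^sup>2)) \<partial>lborel)"
    using annulus_mean[of 0 1 \<alpha>] annulus_mean[of 3 4 \<alpha>] by fastforce
  have main: "ennreal (Wmod m \<alpha> f z) \<le> ennreal (3 ^ m * (c1 + c2)) * local_mean m \<alpha> f z"
    if f: "entire_fun f" for f :: "complex ^ 'n \<Rightarrow> complex" and z
  proof -
    have [measurable]: "f \<in> borel_measurable borel" by (rule entire_fun_measurable[OF f])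
    note [measurable] = wmod_measurable[OF this]
    have [measurable]: "cball z 4 \<in> sets borel" by simp
    define c where "c = (if norm z \<le> 2 then c2 else c1)"
    define A :: "(complex ^ 'n) set" where "A = (if norm z \<le> 2 then annulus 3 4 else annulus 0 1)"
    have A4: "norm x \<le> 4" if "x \<in> A" for x
      using that by (auto simp: A_def annulus_def split: if_splits)
    have far: "1 + norm z \<le> 3 * norm (z + x)" if "x \<in> A" for x
    proof -
      have "norm z \<le> norm (z + x) + norm x" "norm x \<le> norm (z + x) + norm z"
        using norm_triangle_ineq4[of "z + x" x] norm_triangle_ineq4[of "z + x" z] by auto
      then show ?thesis
        using that by (auto simp: A_def annulus_def split: if_splits)
    qed
    have "ennreal (Wmod m \<alpha> f z) = ennreal ((1 + norm z) ^ m) * ennreal (norm (f z) * exp (- (\<alpha> / 2) * (norm z)\<^sup>2))"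
      by (simp add: Wmod_def ennreal_mult')
    also have "\<dots> \<le> ennreal ((1 + norm z) ^ m) * (ennreal c * (\<integral>\<^sup>+x. indicator A x * ennreal (norm (f (z + x)) * exp (- (\<alpha> / 2) * (norm (z + x))\<^sup>2)) \<partial>lborel))"
      unfolding c_def A_def using c1(2)[OF f, of z] c2(2)[OF f, of z] by (intro mult_left_mono) auto
    also have "\<dots> = ennreal c * (\<integral>\<^sup>+x. ennreal ((1 + norm z) ^ m) * (indicator A x * ennreal (norm (f (z + x)) * exp (- (\<alpha> / 2) * (norm (z + x))\<^sup>2))) \<partial>lborel)"
      by (subst nn_integral_cmult) (auto simp: mult.left_commute A_def)
    also have "\<dots> \<le> ennreal c * (\<integral>\<^sup>+x. ennreal (3 ^ m) * (indicator (cball z 4) (z + x) * ennreal (wmod m \<alpha> f (z + x))) \<partial>lborel)"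
    proof (intro mult_left_mono nn_integral_mono)
      fix x
      show "ennreal ((1 + norm z) ^ m) * (indicator A x * ennreal (norm (f (z + x)) * exp (- (\<alpha> / 2) * (norm (z + x))\<^sup>2)))
         \<le> ennreal (3 ^ m) * (indicator (cball z 4) (z + x) * ennreal (wmod m \<alpha> f (z + x)))"
      proof (cases "x \<in> A")
        case True
        have "(1 + norm z) ^ m \<le> (3 * norm (z + x)) ^ m"
          by (intro power_mono far True) simp
        then have "(1 + norm z) ^ m * (norm (f (z + x)) * exp (- (\<alpha> / 2) * (norm (z + x))\<^sup>2)) \<le> 3 ^ m * wmod m \<alpha> f (z + x)"
          unfolding wmod_def power_mult_distrib mult.assoc[symmetric] by (intro mult_right_mono) auto
        moreover have "z + x \<in> cball z 4" using A4[OF True] by (simp add: dist_norm)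
        ultimately show ?thesis using True
          by (simp add: ennreal_mult'[symmetric] ennreal_leI)
      qed simp
    qed simp
    also have "(\<integral>\<^sup>+x. ennreal (3 ^ m) * (indicator (cball z 4) (z + x) * ennreal (wmod m \<alpha> f (z + x))) \<partial>lborel)
      = (\<integral>\<^sup>+y. ennreal (3 ^ m) * (indicator (cball z 4) y * ennreal (wmod m \<alpha> f y)) \<partial>lborel)"
      by (rule nn_integral_translate) measurable
    also have "\<dots> = ennreal (3 ^ m) * local_mean m \<alpha> f z"
      by (rule nn_integral_cmult) measurable
    also have "ennreal c * (ennreal (3 ^ m) * local_mean m \<alpha> f z)
      = ennreal (3 ^ m * c) * local_mean m \<alpha> f z"
      using c1(1) c2(1) by (simp add: mult.assoc[symmetric] ennreal_mult'[symmetric] mult.commute c_def)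
    also have "\<dots> \<le> ennreal (3 ^ m * (c1 + c2)) * local_mean m \<alpha> f z"
      using c1(1) c2(1) by (intro mult_right_mono ennreal_leI mult_left_mono) (auto simp: c_def)
    finally show ?thesis .
  qed
  show ?thesis
    by (rule exI[of _ "3 ^ m * (c1 + c2)"]) (use main c1(1) c2(1) in auto)
qed

section \<open>The exponential kernel\<close>

lemma exp_quadratic_bound:
  fixes a c :: real
  assumes "a > 0"
  shows "\<exists>H>0. \<forall>t\<ge>0. (1 + t) ^ m * exp (c * t - a * t\<^sup>2) \<le> H * exp (- t)"
proof (intro exI[of _ "exp ((real m + c + 1)\<^sup>2 / (4 * a))"] conjI allI impI)
  fix t :: real assume t: "0 \<le> t"
  have "(1 + t) ^ m \<le> exp t ^ m"
    using t exp_ge_add_one_self[of t] by (intro power_mono) auto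
  also have "\<dots> = exp (real m * t)" by (simp add: exp_of_nat_mult)
  finally have "(1 + t) ^ m * exp (c * t - a * t\<^sup>2) \<le> exp (real m * t) * exp (c * t - a * t\<^sup>2)"
    by (intro mult_right_mono) auto
  also have "\<dots> = exp ((real m + c + 1) * t - a * t\<^sup>2) * exp (- t)"
    by (simp add: exp_add[symmetric] algebra_simps)
  also have "\<dots> \<le> exp ((real m + c + 1)\<^sup>2 / (4 * a)) * exp (- t)"
  proof (intro mult_right_mono)
    have "0 \<le> a * (t - (real m + c + 1) / (2 * a))\<^sup>2" using assms by simp
    also have "\<dots> = (real m + c + 1)\<^sup>2 / (4 * a) - ((real m + c + 1) * t - a * t\<^sup>2)"
      using assms by (simp add: power2_eq_square field_simps)
    finally show "exp ((real m + c + 1) * t - a * t\<^sup>2) \<le> exp ((real m + c + 1)\<^sup>2 / (4 * a))" by simp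
  qed simp
  finally show "(1 + t) ^ m * exp (c * t - a * t\<^sup>2) \<le> exp ((real m + c + 1)\<^sup>2 / (4 * a)) * exp (- t)" .
qed simp

definition exp_mass :: "'n::finite itself \<Rightarrow> real" where
  "exp_mass _ = enn2real (\<integral>\<^sup>+x. ennreal (exp (- norm (x :: complex ^ 'n))) \<partial>lborel)"

lemma exp_mass_translate:
  "(\<integral>\<^sup>+y. ennreal (exp (- norm (z - y))) \<partial>lborel) = ennreal (exp_mass TYPE('n))"
  for z :: "complex ^ 'n::finite"
proof -
  have "(\<integral>\<^sup>+y. ennreal (exp (- norm (z - y))) \<partial>lborel) = (\<integral>\<^sup>+y. ennreal (exp (- norm (- z + y))) \<partial>lborel)"
    by (simp add: norm_minus_commute)
  also have "\<dots> = (\<integral>\<^sup>+x. ennreal (exp (- norm (x :: complex ^ 'n))) \<partial>lborel)"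
    by (rule nn_integral_translate[of "\<lambda>x. ennreal (exp (- norm x))"]) measurable
  also have "\<dots> = ennreal (exp_mass TYPE('n))"
    using nn_integral_exp_neg_norm_finite[where 'a = "complex ^ 'n"]
    by (simp add: exp_mass_def)
  finally show ?thesis .
qed

lemma exp_mass_pos: "exp_mass TYPE('n::finite) > 0"
proof (rule ccontr)
  assume "\<not> exp_mass TYPE('n) > 0"
  then have "(\<integral>\<^sup>+y. ennreal (exp (- norm (0 - y :: complex ^ 'n))) \<partial>lborel) = 0"
    unfolding exp_mass_translate by (simp add: ennreal_neg)
  then have "AE y in lborel. y \<notin> ball (0 :: complex ^ 'n) 1"
    by (subst (asm) nn_integral_0_iff_AE) auto
  then have "emeasure lborel (ball (0 :: complex ^ 'n) 1) = 0"
    by (subst (asm) AE_iff_measurable[OF _ refl]) (auto simp: ball_def)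
  then show False using lborel_ball_finite_pos(1)[of 1 "0 :: complex ^ 'n"] by simp
qed

lemma exp_tail_small:
  assumes "e > 0"
  shows "\<exists>R>0. (\<integral>\<^sup>+y. indicator (- cball 0 R) y * ennreal (exp (- norm (y :: 'a::euclidean_space))) \<partial>lborel) \<le> ennreal e"
proof -
  let ?f = "\<lambda>n y. indicator (- cball 0 (real n)) y * ennreal (exp (- norm (y :: 'a)))"
  have [measurable]: "- cball (0::'a) r \<in> sets borel" for r by simp
  have "(\<lambda>n. \<integral>\<^sup>+y. ?f n y \<partial>lborel) \<longlonglongrightarrow> (\<integral>\<^sup>+y. 0 \<partial>(lborel :: 'a measure))"
  proof (rule nn_integral_dominated_convergence[where w = "\<lambda>y. ennreal (exp (- norm y))"])
    show "AE y in lborel. (\<lambda>n. ?f n y) \<longlonglongrightarrow> 0"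
    proof (rule AE_I2)
      fix y :: 'a
      obtain N where N: "norm y \<le> real N" using real_arch_simple by blast
      have "\<forall>\<^sub>F n in sequentially. ?f n y = 0"
        using eventually_ge_at_top[of N] by eventually_elim (use N in \<open>auto simp: indicator_def\<close>)
      then show "(\<lambda>n. ?f n y) \<longlonglongrightarrow> 0" by (rule tendsto_eventually)
    qed
  qed (use nn_integral_exp_neg_norm_finite in \<open>auto simp: indicator_def\<close>)
  then have "\<forall>\<^sub>F n in sequentially. (\<integral>\<^sup>+y. ?f n y \<partial>lborel) < ennreal e"
    using assms by (intro order_tendstoD) auto
  then have "\<forall>\<^sub>F n in sequentially. (\<integral>\<^sup>+y. ?f n y \<partial>lborel) < ennreal e \<and> n > 0"
    using eventually_gt_at_top[of 0] by eventually_elim auto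
  then obtain n where "(\<integral>\<^sup>+y. ?f n y \<partial>lborel) < ennreal e" "n > 0"
    by (auto dest: eventually_happens)
  then show ?thesis by (intro exI[of _ "real n"]) auto
qed

lemma pointwise_le_exp_mean:
  "\<exists>C>0. \<forall>(f :: complex ^ 'n::finite \<Rightarrow> complex) z. entire_fun f \<longrightarrow>
    ennreal (Wmod m \<alpha> f z) \<le> ennreal C * exp_avg (wmod m \<alpha> f) z"
proof -
  obtain C where C: "C > 0" "\<And>(f :: complex ^ 'n \<Rightarrow> complex) z. entire_fun f \<Longrightarrow>
    ennreal (Wmod m \<alpha> f z) \<le> ennreal C * local_mean m \<alpha> f z"
    using pointwise_le_local_mean[of m \<alpha>] by blast
  show ?thesis
  proof (intro exI[of _ "C * exp 4"] conjI allI impI)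
    fix f :: "complex ^ 'n \<Rightarrow> complex" and z assume f: "entire_fun f"
    note [measurable] = wmod_measurable[OF entire_fun_measurable[OF f]]
    have "local_mean m \<alpha> f z \<le>
       (\<integral>\<^sup>+y. ennreal (exp 4) * ennreal (exp (- norm (z - y)) * wmod m \<alpha> f y) \<partial>lborel)"
    proof (rule nn_integral_mono)
      fix y
      show "indicator (cball z 4) y * ennreal (wmod m \<alpha> f y) \<le> ennreal (exp 4) * ennreal (exp (- norm (z - y)) * wmod m \<alpha> f y)"
      proof (cases "y \<in> cball z 4")
        case True
        have "1 * wmod m \<alpha> f y \<le> (exp 4 * exp (- norm (z - y))) * wmod m \<alpha> f y"
          using True unfolding exp_add[symmetric] by (intro mult_right_mono) (auto simp: dist_norm)
        then show ?thesis using True by (simp add: ennreal_mult'[symmetric] ennreal_leI mult.assoc)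
      qed simp
    qed
    also have "\<dots> = ennreal (exp 4) * exp_avg (wmod m \<alpha> f) z"
      by (rule nn_integral_cmult) measurable
    finally have "ennreal C * local_mean m \<alpha> f z \<le>
      ennreal C * (ennreal (exp 4) * exp_avg (wmod m \<alpha> f) z)"
      by (rule mult_left_mono) simp
    then show "ennreal (Wmod m \<alpha> f z) \<le> ennreal (C * exp 4) * exp_avg (wmod m \<alpha> f) z"
      using C(2)[OF f, of z] C(1) by (simp add: ennreal_mult' mult.assoc)
  qed (use C in simp)
qed

text \<open>
Power version of a bound by a mean against \<open>e\<^bsup>-|z-y|\<^esup>\<close>. The number \<open>x\<close> will be \<open>\<Phi>\<^sub>g(z)\<close> for \<open>g = f\<close> or for the
error \<open>g\<close> of an approximation of \<open>f\<close>.
\<close>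

lemma powr_le_exp_mean:
  fixes f :: "complex ^ 'n::finite \<Rightarrow> complex"
  assumes f: "entire_fun f" and "1 \<le> r" "0 \<le> x" "0 < C"
    and le: "ennreal x \<le> ennreal C * exp_avg (wmod m \<alpha> f) z"
  shows "ennreal (x powr r) \<le> ennreal (C powr r * exp_mass TYPE('n) powr (r - 1)) *
      (exp_avg (\<lambda>y. wmod m \<alpha> f y powr r) z)"
proof -
  note [measurable] = wmod_measurable[OF entire_fun_measurable[OF f]]
  show ?thesis
    by (rule powr_le_weighted_integral) (use assms exp_mass_pos in \<open>auto simp: exp_mass_translate\<close>)
qed

lemma bound_of_exp_mean:
  fixes f :: "complex ^ 'n::finite \<Rightarrow> complex"
  assumes f: "entire_fun f" and r: "1 \<le> r" and "0 \<le> x" "0 < C"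
    and le: "ennreal x \<le> ennreal C * exp_avg (wmod m \<alpha> f) z"
    and I: "energy m \<alpha> r f \<le> ennreal M" and M: "0 \<le> M"
  shows "x \<le> (C powr r * exp_mass TYPE('n) powr (r - 1) * M) powr (1 / r)"
proof -
  let ?D = "C powr r * exp_mass TYPE('n) powr (r - 1)"
  have "ennreal (x powr r) \<le> ennreal ?D * exp_avg (\<lambda>y. wmod m \<alpha> f y powr r) z"
    by (rule powr_le_exp_mean[OF f]) (use assms in auto)
  also have "\<dots> \<le> ennreal ?D * energy m \<alpha> r f"
    by (intro mult_left_mono nn_integral_mono ennreal_leI mult_left_le_one_le) auto
  also have "\<dots> \<le> ennreal ?D * ennreal M"
    by (intro mult_left_mono I) simp
  finally have "x powr r \<le> ?D * M" using M by (simp add: ennreal_mult'[symmetric])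
  then have "(x powr r) powr (1 / r) \<le> (?D * M) powr (1 / r)"
    using r by (intro powr_mono2) auto
  then show ?thesis using r assms(3) by (simp add: powr_powr)
qed

lemma integrable_exp_neg_norm: "integrable lborel (\<lambda>x :: 'a::euclidean_space. exp (- norm x))"
  using nn_integral_exp_neg_norm_finite by (intro integrableI_bounded) auto

section \<open>The reproducing formula\<close>

definition gauss_mass :: "real \<Rightarrow> 'n::finite itself \<Rightarrow> real" where
  "gauss_mass \<alpha> _ = (LINT x|lborel. exp (- \<alpha> * (norm (x :: complex ^ 'n))\<^sup>2))"

lemma gauss_integrable:
  assumes "\<alpha> > 0"
  shows "integrable lborel (\<lambda>x :: complex ^ 'n::finite. exp (- \<alpha> * (norm x)\<^sup>2))"
proof -
  obtain H where H: "\<And>t. t \<ge> 0 \<Longrightarrow> (1 + t) ^ 0 * exp (0 * t - \<alpha> * t\<^sup>2) \<le> H * exp (- t)"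
    using exp_quadratic_bound[of \<alpha> 0 0] assms by blast
  have *: "integrable lborel (\<lambda>x :: complex ^ 'n. H * exp (- norm x))"
    by (intro integrable_mult_right integrable_exp_neg_norm)
  show ?thesis
  proof (rule Bochner_Integration.integrable_bound[OF *])
    have "exp (- (\<alpha> * (norm x)\<^sup>2)) \<le> \<bar>H * exp (- norm x)\<bar>" for x :: "complex ^ 'n"
      by (rule order_trans[OF _ abs_ge_self]) (use H[of "norm x"] in simp)
    then show "AE x in lborel. norm (exp (- \<alpha> * (norm x)\<^sup>2)) \<le> norm (H * exp (- norm (x :: complex ^ 'n)))"
      by simp
  qed measurable
qed

lemma gauss_mass_pos:
  assumes "\<alpha> > 0"
  shows "gauss_mass \<alpha> TYPE('n::finite) > 0"
proof -
  have "gauss_mass \<alpha> TYPE('n) \<ge> 0" unfolding gauss_mass_def by simp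
  moreover have "gauss_mass \<alpha> TYPE('n) \<noteq> 0"
  proof
    assume "gauss_mass \<alpha> TYPE('n) = 0"
    then have "AE x in (lborel :: (complex ^ 'n) measure). False"
      using integral_nonneg_eq_0_iff_AE[OF gauss_integrable[OF assms, where 'n = 'n]] by (auto simp: gauss_mass_def)
    then have "emeasure lborel (UNIV :: (complex ^ 'n) set) = 0"
      by (subst (asm) AE_iff_measurable[OF _ refl]) auto
    then show False by simp
  qed
  ultimately show ?thesis by simp
qed

text \<open>
The integrand of the reproducing formula at \<open>z\<close>, with Gaussian weight included.
\<close>

definition repro :: "real \<Rightarrow> (complex ^ 'n \<Rightarrow> complex) \<Rightarrow> complex ^ 'n \<Rightarrow> complex ^ 'n \<Rightarrow> complex" where
  "repro \<alpha> f z w = f w * exp (of_real \<alpha> * cinner z w - of_real (\<alpha> * (norm w)\<^sup>2))"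

lemma norm_repro: "norm (repro \<alpha> f z w) = norm (f w) * exp (\<alpha> * (z \<bullet> w) - \<alpha> * (norm w)\<^sup>2)"
  by (simp add: repro_def norm_mult Re_cinner)

lemma repro_bound:
  fixes z w :: "complex ^ 'n::finite"
  assumes "\<alpha> > 0" "norm (f w) \<le> A * exp (\<alpha> / 2 * (norm w)\<^sup>2)" "norm z \<le> R0" "A \<ge> 0"
    and H: "\<And>t. t \<ge> 0 \<Longrightarrow> exp (\<alpha> * R0 * t - \<alpha> / 2 * t\<^sup>2) \<le> H * exp (- t)"
  shows "norm (repro \<alpha> f z w) \<le> A * H * exp (- norm w)"
proof -
  have "z \<bullet> w \<le> R0 * norm w"
    using norm_cauchy_schwarz[of z w] mult_right_mono[OF assms(3), of "norm w"] by simp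
  then have "\<alpha> * (z \<bullet> w) \<le> \<alpha> * (R0 * norm w)" using assms(1) by simp
  then have "norm (repro \<alpha> f z w) \<le> (A * exp (\<alpha> / 2 * (norm w)\<^sup>2)) * exp (\<alpha> * (R0 * norm w) - \<alpha> * (norm w)\<^sup>2)"
    unfolding norm_repro using assms by (intro mult_mono) auto
  also have "\<dots> = A * exp (\<alpha> * R0 * norm w - \<alpha> / 2 * (norm w)\<^sup>2)"
    by (simp add: exp_add[symmetric] mult.assoc)
  also have "\<dots> \<le> A * (H * exp (- norm w))"
    using H[of "norm w"] assms by (intro mult_left_mono) auto
  finally show ?thesis by (simp add: mult.assoc)
qed

lemma repro_measurable:
  fixes f :: "complex ^ 'n::finite \<Rightarrow> complex"
  assumes "entire_fun f"
  shows "repro \<alpha> f z \<in> borel_measurable borel"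
  unfolding repro_def[abs_def]
  by (intro borel_measurable_continuous_onI continuous_intros entire_fun_continuous assms)

text \<open>
After the substitution \<open>w = z + x\<close> the integrand becomes \<open>e\<^bsup>-\<alpha>|x|\<^sup>2\<^esup>\<close> times the twisted translate of \<open>f\<close>, and
the radial mean value property applies.
\<close>

lemma reproducing_formula:
  fixes f :: "complex ^ 'n::finite \<Rightarrow> complex"
  assumes \<alpha>: "\<alpha> > 0" and f: "entire_fun f" and A: "\<And>w. norm (f w) \<le> A * exp (\<alpha> / 2 * (norm w)\<^sup>2)"
  shows "integrable lborel (repro \<alpha> f z)"
    and "(LINT w|lborel. repro \<alpha> f z w) = of_real (gauss_mass \<alpha> TYPE('n)) * f z"
proof -
  have A0: "A \<ge> 0"
    using order_trans[OF norm_ge_zero A[of 0]] by simp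
  obtain H where H: "H > 0" "\<And>t. t \<ge> 0 \<Longrightarrow> (1 + t) ^ 0 * exp (\<alpha> * norm z * t - \<alpha> / 2 * t\<^sup>2) \<le> H * exp (- t)"
    using exp_quadratic_bound[of "\<alpha> / 2" 0 "\<alpha> * norm z"] \<alpha> by auto
  note [measurable] = repro_measurable[OF f]
  have *: "integrable lborel (\<lambda>x :: complex ^ 'n. A * H * exp (- norm x))"
    by (intro integrable_mult_right integrable_exp_neg_norm)
  show int: "integrable lborel (repro \<alpha> f z)"
  proof (rule Bochner_Integration.integrable_bound[OF *])
    have "norm (repro \<alpha> f z w) \<le> norm (A * H * exp (- norm w))" for w
      using repro_bound[of \<alpha> f w A z "norm z" H, OF \<alpha> A order_refl A0] H A0 by simp
    then show "AE w in lborel. norm (repro \<alpha> f z w) \<le> norm (A * H * exp (- norm w))"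
      by simp
  qed measurable
  have shift: "repro \<alpha> f z (z + x) = exp (- \<alpha> * (norm x)\<^sup>2) *\<^sub>R twisted_shift \<alpha> z f x" for x
  proof -
    have c2: "complex_of_real ((norm (z + x))\<^sup>2) = cinner z z + cinner z x + cinner x z + cinner x x"
      by (simp add: cinner_self[symmetric] cinner_add algebra_simps del: of_real_power)
    have "of_real \<alpha> * cinner z (z + x) - of_real (\<alpha> * (norm (z + x))\<^sup>2) = 
       - of_real \<alpha> * cinner x z + of_real (- \<alpha> * (norm x)\<^sup>2)"
      unfolding of_real_mult c2 by (simp add: cinner_add cinner_self algebra_simps)
    then have "repro \<alpha> f z (z + x) = f (z + x) * (exp (- of_real \<alpha> * cinner x z) * exp (of_real (- \<alpha> * (norm x)\<^sup>2)))"
      unfolding repro_def exp_add[symmetric] by (simp only:)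
    then show ?thesis
      by (simp add: twisted_shift_def scaleR_conv_of_real exp_of_real[symmetric] mult_ac del: of_real_mult of_real_minus)
  qed
  have "distr lborel borel ((+) z) = (lborel :: (complex ^ 'n) measure)" by (rule lborel_distr_plus)
  then have tr: "integrable lborel (\<lambda>x. repro \<alpha> f z (z + x))"
     "(LINT x|lborel. repro \<alpha> f z (z + x)) = (LINT w|lborel. repro \<alpha> f z w)"
    using int integrable_distr_eq[of "(+) z" lborel borel "repro \<alpha> f z"] integral_distr[of "(+) z" lborel borel "repro \<alpha> f z"]
    by simp_all
  show "(LINT w|lborel. repro \<alpha> f z w) = of_real (gauss_mass \<alpha> TYPE('n)) * f z"
    using radial_mean_value[OF entire_twisted_shift[OF f, of \<alpha> z] gauss_integrable[OF \<alpha>]] tr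
    unfolding shift
    by (simp add: norm_vector_scalar_mult gauss_mass_def scaleR_conv_of_real twisted_shift_def)
qed

section \<open>Approximation by operators of finite rank\<close>

lemma finite_partition_cball:
  fixes R \<delta> :: real
  assumes "\<delta> > 0"
  obtains N :: nat and w :: "nat \<Rightarrow> 'a::euclidean_space" and E
  where "\<And>i. E i \<in> sets borel" "\<And>i. E i \<subseteq> cball (w i) \<delta>" "\<And>i. E i \<subseteq> cball 0 R" 
    "\<And>i. i < N \<Longrightarrow> w i \<in> cball 0 R" "disjoint_family E" "(\<Union>i<N. E i) = cball 0 R"
proof -
  obtain F where F: "finite F" "F \<subseteq> cball (0::'a) R" "cball 0 R \<subseteq> (\<Union>x\<in>F. ball x \<delta>)"
    using seq_compact_imp_totally_bounded[of "cball (0::'a) R"] assms compact_cball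
    by (metis compact_imp_seq_compact)
  obtain xs where xs: "set xs = F" using finite_list[OF F(1)] by blast
  define A where "A i = (if i < length xs then ball (xs ! i) \<delta> \<inter> cball 0 R else {})" for i
  have A: "range A \<subseteq> sets borel" by (auto simp: A_def)
  show ?thesis
  proof (rule that[of "disjointed A" "\<lambda>i. xs ! i" "length xs"])
    fix i
    show "disjointed A i \<in> sets borel"
      using sets.range_disjointed_sets[OF A] by auto
    have "A i \<subseteq> cball (xs ! i) \<delta>" "A i \<subseteq> cball 0 R" by (auto simp: A_def)
    then show "disjointed A i \<subseteq> cball (xs ! i) \<delta>" "disjointed A i \<subseteq> cball 0 R"
      using disjointed_subset[of A i] by auto
  next
    fix i assume "i < length xs"
    then show "xs ! i \<in> cball 0 R" using xs F(2) nth_mem by blast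
  next
    show "disjoint_family (disjointed A)" by (rule disjoint_family_disjointed)
    have "(\<Union>i<length xs. disjointed A i) = (\<Union>i<length xs. A i)"
      using finite_UN_disjointed_eq[of A "length xs"] by (simp add: atLeast0LessThan)
    also have "\<dots> = cball 0 R"
    proof (intro equalityI subsetI)
      fix x assume "x \<in> cball (0::'a) R"
      then obtain i where "i < length xs" "x \<in> ball (xs ! i) \<delta>"
        using F(3) xs by (force simp: in_set_conv_nth)
      then show "x \<in> (\<Union>i<length xs. A i)" using \<open>x \<in> cball 0 R\<close> by (auto simp: A_def)
    qed (auto simp: A_def)
    finally show "(\<Union>i<length xs. disjointed A i) = cball 0 R" .
  qed
qed

text \<open>
Cauchy's estimate along the complex line through \<open>w\<close> and \<open>w'\<close>, on discs of radius \<open>1 / |w' - w|\<close> in the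
parameter, which correspond to discs of radius \<open>1\<close> in the space.
\<close>

lemma entire_fun_Lipschitz:
  fixes f :: "complex ^ 'n::finite \<Rightarrow> complex"
  assumes f: "entire_fun f" and M: "\<And>w. norm w \<le> R + 1 \<Longrightarrow> norm (f w) \<le> M"
    and w: "norm w \<le> R" "norm w' \<le> R"
  shows "norm (f w' - f w) \<le> M * norm (w' - w)"
proof (cases "w = w'")
  case False
  define d where "d = norm (w' - w)"
  have d: "d > 0" using False by (simp add: d_def)
  define \<phi> where "\<phi> t = f (w + t *s (w' - w))" for t
  have hol: "\<phi> holomorphic_on S" for S
    unfolding \<phi>_def by (rule entire_fun_along_line[OF f])
  have seg: "norm (w + t *s (w' - w)) \<le> R" if t: "t \<in> closed_segment 0 1" for t
  proof -
    obtain u where u: "0 \<le> u" "u \<le> 1" "t = of_real u"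
      using t by (auto simp: closed_segment_def scaleR_conv_of_real)
    have "w + t *s (w' - w) = (1 - u) *\<^sub>R w + u *\<^sub>R w'"
      unfolding u vec_eq_iff vector_add_component vector_smult_component vector_minus_component vector_scaleR_component
      unfolding scaleR_conv_of_real
      by (simp add: algebra_simps)
    moreover have "norm ((1 - u) *\<^sub>R w + u *\<^sub>R w') \<le> (1 - u) * R + u * R"
      using u w by (intro norm_triangle_le add_mono) (auto intro!: mult_left_mono)
    moreover have "(1 - u) * R + u * R = R" by (simp add: algebra_simps)
    ultimately show ?thesis by simp
  qed
  have der: "norm (deriv \<phi> t) \<le> M * d" if t: "t \<in> closed_segment 0 1" for t
  proof -
    have "norm ((deriv ^^ 1) \<phi> t) \<le> fact 1 * M / (1 / d) ^ 1"
    proof (rule Cauchy_inequality)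
      fix x assume x: "norm (t - x) = 1 / d"
      have "w + x *s (w' - w) = (w + t *s (w' - w)) + (x - t) *s (w' - w)"
        by (simp add: vec_eq_iff algebra_simps)
      moreover have "norm ((x - t) *s (w' - w)) = 1"
        using x d unfolding norm_vector_scalar_mult d_def[symmetric] norm_minus_commute[of x t] by simp
      ultimately have "norm (w + x *s (w' - w)) \<le> R + 1"
        using seg[OF t] by (metis add_mono norm_triangle_le order_refl)
      then show "norm (\<phi> x) \<le> M" unfolding \<phi>_def by (rule M)
    qed (use d hol holomorphic_on_imp_continuous_on in auto)
    then show ?thesis using d by simp
  qed
  have "norm (\<phi> 1 - \<phi> 0) \<le> M * d * norm (1 - 0 :: complex)"
  proof (rule field_differentiable_bound[of "closed_segment 0 1" \<phi> "deriv \<phi>"])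
    fix t :: complex
    show "(\<phi> has_field_derivative deriv \<phi> t) (at t within closed_segment 0 1)"
      using holomorphic_derivI[OF hol[of UNIV], of t] by (simp add: has_field_derivative_at_within)
  qed (use der in auto)
  then show ?thesis by (simp add: \<phi>_def d_def)
qed simp

text \<open>
Linear combinations of reproducing kernels. They are closed under partial derivatives, so their membership
in the Fock--Sobolev spaces can be read off directly from the definition; they are the only functions
for which this membership has to be proved.
\<close>

definition kernel_sum :: "real \<Rightarrow> nat \<Rightarrow> (nat \<Rightarrow> complex ^ 'n) \<Rightarrow> (nat \<Rightarrow> complex) \<Rightarrow> complex ^ 'n \<Rightarrow> complex" where
  "kernel_sum \<alpha> N w b z = (\<Sum>i<N. b i * exp (of_real \<alpha> * cinner z (w i)))"

lemma entire_kernel_sum: "entire_fun (kernel_sum \<alpha> N w b :: complex ^ 'n::finite \<Rightarrow> complex)"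
proof (induction N)
  case 0
  then show ?case by (simp add: kernel_sum_def[abs_def] entire_fun_const)
next
  case (Suc N)
  show ?case
    using entire_fun_lincomb[OF Suc entire_fun_exp_cinner[of "of_real \<alpha>" "w N"], of 1 "b N"]
    by (simp add: kernel_sum_def[abs_def])
qed

lemma Wmod_triangle: "Wmod m \<alpha> (\<lambda>z. f z - g z) z \<le> Wmod m \<alpha> f z + Wmod m \<alpha> g z"
proof -
  have "(1 + norm z) ^ m * (norm (f z - g z) * exp (- (\<alpha> / 2) * (norm z)\<^sup>2)) \<le>
    (1 + norm z) ^ m * ((norm (f z) + norm (g z)) * exp (- (\<alpha> / 2) * (norm z)\<^sup>2))"
    by (intro mult_left_mono mult_right_mono norm_triangle_ineq4) auto
  then show ?thesis by (simp add: Wmod_def algebra_simps)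
qed

lemma one_plus_norm_le: "1 + norm z \<le> (1 + norm w) * (1 + norm (z - w))"
proof -
  have "norm z \<le> norm w + norm (z - w)" by (rule norm_triangle_sub)
  moreover have "0 \<le> norm w * norm (z - w)" by simp
  moreover have "(1 + norm w) * (1 + norm (z - w)) = 1 + norm w + norm (z - w) + norm w * norm (z - w)"
    by (simp add: algebra_simps)
  ultimately show ?thesis by linarith
qed

lemma norm_minus_squared: "(norm (z - w :: 'a::real_inner))\<^sup>2 = (norm z)\<^sup>2 - 2 * (z \<bullet> w) + (norm w)\<^sup>2"
  by (simp add: power2_norm_eq_inner inner_diff inner_commute)

lemma Wmod_repro_le:
  fixes z w :: "complex ^ 'n::finite"
  assumes H: "\<And>t. t \<ge> 0 \<Longrightarrow> (1 + t) ^ m * exp (- (\<alpha> / 2) * t\<^sup>2) \<le> H * exp (- t)"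
  shows "(1 + norm z) ^ m * norm (repro \<alpha> f z w) * exp (- (\<alpha> / 2) * (norm z)\<^sup>2) \<le> H * exp (- norm (z - w)) * Wmod m \<alpha> f w"
proof -
  have e: "exp (\<alpha> * (z \<bullet> w) - \<alpha> * (norm w)\<^sup>2) * exp (- (\<alpha> / 2) * (norm z)\<^sup>2) = exp (- (\<alpha> / 2) * (norm (z - w))\<^sup>2) * exp (- (\<alpha> / 2) * (norm w)\<^sup>2)"
    unfolding exp_add[symmetric] norm_minus_squared by (simp add: algebra_simps)
  have "(1 + norm z) ^ m * norm (repro \<alpha> f z w) * exp (- (\<alpha> / 2) * (norm z)\<^sup>2) 
      = (1 + norm z) ^ m * (exp (- (\<alpha> / 2) * (norm (z - w))\<^sup>2) * (norm (f w) * exp (- (\<alpha> / 2) * (norm w)\<^sup>2)))"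
    unfolding norm_repro mult.assoc e by (simp add: mult_ac)
  also have "\<dots> \<le> ((1 + norm w) * (1 + norm (z - w))) ^ m * (exp (- (\<alpha> / 2) * (norm (z - w))\<^sup>2) * (norm (f w) * exp (- (\<alpha> / 2) * (norm w)\<^sup>2)))"
    by (intro mult_right_mono power_mono one_plus_norm_le) auto
  also have "\<dots> = ((1 + norm (z - w)) ^ m * exp (- (\<alpha> / 2) * (norm (z - w))\<^sup>2)) * Wmod m \<alpha> f w"
    by (simp add: power_mult_distrib Wmod_def mult_ac)
  also have "\<dots> \<le> (H * exp (- norm (z - w))) * Wmod m \<alpha> f w"
    by (intro mult_right_mono H) auto
  finally show ?thesis .
qed

text \<open>
The Riemann sum satisfies the same kind of bound as \<open>f\<close> itself, with a constant independent of the cells: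
each value \<open>\<Phi>\<^sub>f(w i)\<close> is bounded by a mean over a ball around \<open>w i\<close>, and the total mass of the disjoint
cells whose balls contain a given point \<open>y\<close> is at most the volume of a ball around \<open>y\<close>.
\<close>

lemma quadrature_exp_mean:
  fixes w :: "nat \<Rightarrow> complex ^ 'n::finite" and f :: "complex ^ 'n \<Rightarrow> complex"
  assumes f: "entire_fun f" and H: "H > 0" "\<And>t. t \<ge> 0 \<Longrightarrow> (1 + t) ^ m * exp (- (\<alpha> / 2) * t\<^sup>2) \<le> H * exp (- t)"
    and C: "C > 0" "\<And>z. ennreal (Wmod m \<alpha> f z) \<le> ennreal C * local_mean m \<alpha> f z"
    and E: "\<And>i. E i \<in> sets borel" "\<And>i. E i \<subseteq> cball (w i) 1" "disjoint_family E"
    and c: "c \<ge> 0"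
  shows "ennreal (Wmod m \<alpha> (\<lambda>z. \<Sum>i<N. (c * measure lborel (E i)) *\<^sub>R repro \<alpha> f z (w i)) z) \<le>
    ennreal (c * H * C * exp 4 * measure lborel (cball (0 :: complex ^ 'n) 5)) * 
     (exp_avg (wmod m \<alpha> f) z)"
proof -
  note [measurable] = wmod_measurable[OF entire_fun_measurable[OF f]]
  have [measurable]: "cball (x :: complex ^ 'n) s \<in> sets borel" for x s by simp
  have fin: "emeasure lborel (E i) < \<infinity>" for i
    using E(2)[of i] by (intro emeasure_bounded_finite bounded_subset[OF bounded_cball])
  define I where "I i = (\<integral>\<^sup>+y. indicator (cball (w i) 4) y * ennreal (exp (- norm (z - y)) * wmod m \<alpha> f y) \<partial>lborel)" for i
  have "Wmod m \<alpha> (\<lambda>z. \<Sum>i<N. (c * measure lborel (E i)) *\<^sub>R repro \<alpha> f z (w i)) z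
    \<le> (1 + norm z) ^ m * ((\<Sum>i<N. norm ((c * measure lborel (E i)) *\<^sub>R repro \<alpha> f z (w i))) * exp (- (\<alpha> / 2) * (norm z)\<^sup>2))"
    unfolding Wmod_def by (intro mult_left_mono mult_right_mono norm_sum) auto
  also have "\<dots> = (\<Sum>i<N. (c * measure lborel (E i)) * ((1 + norm z) ^ m * norm (repro \<alpha> f z (w i)) * exp (- (\<alpha> / 2) * (norm z)\<^sup>2)))"
    using c by (simp add: sum_distrib_left sum_distrib_right mult_ac)
  also have "\<dots> \<le> (\<Sum>i<N. (c * measure lborel (E i)) * (H * exp (- norm (z - w i)) * Wmod m \<alpha> f (w i)))"
    by (intro sum_mono mult_left_mono Wmod_repro_le H) (use c in auto)
  finally have "ennreal (Wmod m \<alpha> (\<lambda>z. \<Sum>i<N. (c * measure lborel (E i)) *\<^sub>R repro \<alpha> f z (w i)) z) \<le>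
      ennreal (\<Sum>i<N. (c * measure lborel (E i)) * (H * exp (- norm (z - w i)) * Wmod m \<alpha> f (w i)))"
    by (rule ennreal_leI)
  also have "\<dots> = (\<Sum>i<N. ennreal ((c * measure lborel (E i)) * (H * exp (- norm (z - w i)) * Wmod m \<alpha> f (w i))))"
    using c H by (intro sum_ennreal[symmetric]) auto
  also have "\<dots> \<le> (\<Sum>i<N. ennreal (c * H * C * exp 4) * (emeasure lborel (E i) * I i))"
  proof (rule sum_mono)
    fix i
    have "ennreal (exp (- norm (z - w i))) * local_mean m \<alpha> f (w i)
      = (\<integral>\<^sup>+y. ennreal (exp (- norm (z - w i))) * (indicator (cball (w i) 4) y * ennreal (wmod m \<alpha> f y)) \<partial>lborel)"
      by (rule nn_integral_cmult[symmetric]) measurable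
    also have "\<dots> \<le> (\<integral>\<^sup>+y. ennreal (exp 4) * (indicator (cball (w i) 4) y * ennreal (exp (- norm (z - y)) * wmod m \<alpha> f y)) \<partial>lborel)"
    proof (rule nn_integral_mono)
      fix y
      show "ennreal (exp (- norm (z - w i))) * (indicator (cball (w i) 4) y * ennreal (wmod m \<alpha> f y))
         \<le> ennreal (exp 4) * (indicator (cball (w i) 4) y * ennreal (exp (- norm (z - y)) * wmod m \<alpha> f y))"
      proof (cases "y \<in> cball (w i) 4")
        case True
        then have "norm (z - y) \<le> norm (z - w i) + 4"
          using norm_triangle_ineq[of "z - w i" "w i - y"] by (simp add: dist_norm)
        then have "exp (- norm (z - w i)) * wmod m \<alpha> f y \<le> (exp 4 * exp (- norm (z - y))) * wmod m \<alpha> f y"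
          unfolding exp_add[symmetric] by (intro mult_right_mono) auto
        then show ?thesis using True by (simp add: ennreal_mult'[symmetric] ennreal_leI mult.assoc)
      qed simp
    qed
    also have "\<dots> = ennreal (exp 4) * I i"
      unfolding I_def by (rule nn_integral_cmult) measurable
    finally have *: "ennreal (exp (- norm (z - w i))) * local_mean m \<alpha> f (w i) \<le> ennreal (exp 4) * I i" .
    have "ennreal ((c * measure lborel (E i)) * (H * exp (- norm (z - w i)) * Wmod m \<alpha> f (w i))) = 
       ennreal (c * measure lborel (E i) * H) * (ennreal (exp (- norm (z - w i))) * ennreal (Wmod m \<alpha> f (w i)))"
      using c H by (simp add: ennreal_mult'[symmetric] mult_ac)
    also have "\<dots> \<le> ennreal (c * measure lborel (E i) * H) * (ennreal (exp (- norm (z - w i))) * (ennreal C * local_mean m \<alpha> f (w i)))"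
      by (intro mult_left_mono C) auto
    also have "\<dots> = ennreal (c * measure lborel (E i) * H * C) * (ennreal (exp (- norm (z - w i))) * local_mean m \<alpha> f (w i))"
      using c H C by (simp add: ennreal_mult' mult_ac)
    also have "\<dots> \<le> ennreal (c * measure lborel (E i) * H * C) * (ennreal (exp 4) * I i)"
      by (intro mult_left_mono *) simp
    also have "\<dots> = ennreal (c * H * C * exp 4) * (emeasure lborel (E i) * I i)"
      using c H C fin[of i] by (simp add: emeasure_eq_ennreal_measure less_top[symmetric] ennreal_mult' mult_ac)
    finally show "ennreal ((c * measure lborel (E i)) * (H * exp (- norm (z - w i)) * Wmod m \<alpha> f (w i))) \<le> ennreal (c * H * C * exp 4) * (emeasure lborel (E i) * I i)" .
  qed
  also have "\<dots> = ennreal (c * H * C * exp 4) * (\<integral>\<^sup>+y. (\<Sum>i<N. emeasure lborel (E i) * indicator (cball (w i) 4) y) * ennreal (exp (- norm (z - y)) * wmod m \<alpha> f y) \<partial>lborel)"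
    unfolding I_def sum_distrib_left[symmetric] sum_distrib_right
    by (subst nn_integral_sum) (auto simp: nn_integral_cmult mult.assoc)
  also have "\<dots> \<le> ennreal (c * H * C * exp 4) * (\<integral>\<^sup>+y. ennreal (measure lborel (cball (0 :: complex ^ 'n) 5)) * ennreal (exp (- norm (z - y)) * wmod m \<alpha> f y) \<partial>lborel)"
  proof (intro mult_left_mono nn_integral_mono mult_right_mono)
    fix y
    let ?J = "{i. i < N \<and> y \<in> cball (w i) 4}"
    have "(\<Sum>i<N. emeasure lborel (E i) * indicator (cball (w i) 4) y) = (\<Sum>i\<in>?J. emeasure lborel (E i))"
      by (rule sum.mono_neutral_cong_right) (auto simp: indicator_def)
    also have "\<dots> = emeasure lborel (\<Union>i\<in>?J. E i)"
      using E by (intro sum_emeasure) (auto simp: disjoint_family_on_def)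
    also have "\<dots> \<le> emeasure lborel (cball y 5)"
    proof (intro emeasure_mono)
      show "(\<Union>i\<in>?J. E i) \<subseteq> cball y 5"
      proof
        fix x assume "x \<in> (\<Union>i\<in>?J. E i)"
        then obtain i where "dist (w i) y \<le> 4" "x \<in> E i" by auto
        moreover have "dist (w i) x \<le> 1" using E(2)[of i] \<open>x \<in> E i\<close> by auto
        ultimately have "dist (w i) y \<le> 4" "dist (w i) x \<le> 1" by auto
        then show "x \<in> cball y 5" using dist_triangle[of y x "w i"] by (simp add: dist_commute)
      qed
    qed simp
    also have "\<dots> = ennreal (measure lborel (cball (0 :: complex ^ 'n) 5))"
      by (simp add: emeasure_cball content_cball)
    finally show "(\<Sum>i<N. emeasure lborel (E i) * indicator (cball (w i) 4) y) \<le> ennreal (measure lborel (cball (0 :: complex ^ 'n) 5))" .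
  qed auto
  also have "\<dots> = ennreal (c * H * C * exp 4 * measure lborel (cball (0 :: complex ^ 'n) 5)) * exp_avg (wmod m \<alpha> f) z"
    using c H C by (subst nn_integral_cmult) (auto simp: mult.assoc[symmetric] ennreal_mult'[symmetric])
  finally show ?thesis .
qed

text \<open>
The integrand of the reproducing formula has a uniformly small tail, and on a ball it is equicontinuous,
uniformly in \<open>f\<close> of the given growth and in \<open>|z| \<le> R0\<close>. Hence one partition serves for all these \<open>f\<close> and \<open>z\<close>.
\<close>

lemma quadrature_converges:
  fixes A \<alpha> \<epsilon> R0 :: real
  assumes \<alpha>: "\<alpha> > 0" and A: "A > 0" and \<epsilon>: "\<epsilon> > 0" and R0: "R0 \<ge> 0"
  shows "\<exists>N (w :: nat \<Rightarrow> complex ^ 'n::finite) E. (\<forall>i. E i \<in> sets borel \<and> E i \<subseteq> cball (w i) 1) \<and> disjoint_family E \<and>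
     (\<forall>f z. entire_fun f \<longrightarrow> (\<forall>w. norm (f w) \<le> A * exp (\<alpha> / 2 * (norm w)\<^sup>2)) \<longrightarrow> norm z \<le> R0 \<longrightarrow>
        norm (of_real (gauss_mass \<alpha> TYPE('n)) * f z - (\<Sum>i<N. measure lborel (E i) *\<^sub>R repro \<alpha> f z (w i))) \<le> \<epsilon>)"
proof -
  obtain H where H: "H > 0" "\<And>t. t \<ge> 0 \<Longrightarrow> exp (\<alpha> * R0 * t - \<alpha> / 2 * t\<^sup>2) \<le> H * exp (- t)"
    using exp_quadratic_bound[of "\<alpha> / 2" 0 "\<alpha> * R0"] \<alpha> by auto
  obtain R where R: "R > 0" 
    "(\<integral>\<^sup>+y. indicator (- cball 0 R) y * ennreal (exp (- norm (y :: complex ^ 'n))) \<partial>lborel) \<le> ennreal (\<epsilon> / (2 * (A * H)))"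
    using exp_tail_small[of "\<epsilon> / (2 * (A * H))"] \<epsilon> A H by auto
  define M where "M = A * exp (\<alpha> / 2 * (R + 1)\<^sup>2)"
  define B where "B = exp (\<alpha> * (R0 * R))"
  define V where "V = measure lborel (cball (0 :: complex ^ 'n) R)"
  have M: "M > 0" and B: "B > 0" using A by (auto simp: M_def B_def)
  have V: "V > 0" using R(1) unfolding V_def by (simp add: content_cball)
  \<comment> \<open>half of \<open>\<epsilon>\<close> is spent on the tail and half on the oscillation \<open>\<eta>\<close> over cells of total volume \<open>V\<close>\<close>
  define \<eta> where "\<eta> = \<epsilon> / (2 * V)"
  have \<eta>: "\<eta> > 0" using V \<epsilon> by (simp add: \<eta>_def)
  define K where "K p = exp (of_real \<alpha> * cinner (fst p) (snd p) - of_real (\<alpha> * (norm (snd p))\<^sup>2))" for p :: "(complex ^ 'n) \<times> (complex ^ 'n)"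
  have "uniformly_continuous_on (cball 0 R0 \<times> cball 0 R) K"
    unfolding K_def[abs_def] by (intro compact_uniformly_continuous continuous_intros compact_Times compact_cball)
  moreover have "\<eta> / (2 * M) > 0" using \<eta> M by simp
  ultimately obtain \<delta>1 where \<delta>1: "\<delta>1 > 0" "\<And>p p'. p \<in> cball 0 R0 \<times> cball 0 R \<Longrightarrow> p' \<in> cball 0 R0 \<times> cball 0 R \<Longrightarrow> dist p' p < \<delta>1 \<Longrightarrow> dist (K p') (K p) < \<eta> / (2 * M)"
    by (rule uniformly_continuous_onE) (rule that)
  define \<delta> where "\<delta> = min 1 (min (\<eta> / (2 * M * B)) (\<delta>1 / 2))"
  have \<delta>: "\<delta> > 0" "\<delta> \<le> 1" "\<delta> \<le> \<eta> / (2 * M * B)" "\<delta> \<le> \<delta>1 / 2"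
    using \<eta> M B \<delta>1(1) unfolding \<delta>_def by simp_all
  obtain N :: nat and w :: "nat \<Rightarrow> complex ^ 'n" and E where E: "\<And>i. E i \<in> sets borel" "\<And>i. E i \<subseteq> cball (w i) \<delta>" "\<And>i. E i \<subseteq> cball (0 :: complex ^ 'n) R"
    "\<And>i. i < N \<Longrightarrow> w i \<in> cball 0 R" "disjoint_family E" "(\<Union>i<N. E i) = cball 0 R"
    by (rule finite_partition_cball[OF \<delta>(1), of R]) (rule that)
  have close: "norm (repro \<alpha> f z x - repro \<alpha> f z y) \<le> \<eta>"
    if f: "entire_fun f" "\<And>w. norm (f w) \<le> A * exp (\<alpha> / 2 * (norm w)\<^sup>2)" and z: "norm z \<le> R0" 
      and xy: "norm x \<le> R" "norm y \<le> R" "norm (x - y) \<le> \<delta>" for f :: "complex ^ 'n \<Rightarrow> complex" and z x y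
  proof -
    have fM: "norm (f w) \<le> M" if "norm w \<le> R + 1" for w
    proof -
      have "\<alpha> / 2 * (norm w)\<^sup>2 \<le> \<alpha> / 2 * (R + 1)\<^sup>2"
        using that \<alpha> by (intro mult_left_mono power_mono) auto
      then show ?thesis
        unfolding M_def using A by (intro order_trans[OF f(2)]) (auto intro!: mult_left_mono)
    qed
    have "repro \<alpha> f z x - repro \<alpha> f z y = (f x - f y) * K (z, x) + f y * (K (z, x) - K (z, y))"
      by (simp add: repro_def K_def algebra_simps)
    also have "norm \<dots> \<le> norm (f x - f y) * norm (K (z, x)) + norm (f y) * norm (K (z, x) - K (z, y))"
      by (metis norm_mult norm_triangle_ineq)
    also have "\<dots> \<le> (M * \<delta>) * B + M * (\<eta> / (2 * M))"
    proof (intro add_mono mult_mono)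
      have "norm (f x - f y) \<le> M * norm (x - y)"
        using entire_fun_Lipschitz[OF f(1) fM] xy by blast
      also have "\<dots> \<le> M * \<delta>" using xy M by simp
      finally show "norm (f x - f y) \<le> M * \<delta>" .
      have "z \<bullet> x \<le> R0 * R"
        using norm_cauchy_schwarz[of z x] mult_mono[OF z xy(1)] R0 by simp
      then have "\<alpha> * (z \<bullet> x) - \<alpha> * (norm x)\<^sup>2 \<le> \<alpha> * (R0 * R)"
        using \<alpha> by (smt (verit) mult_left_mono mult_nonneg_nonneg zero_le_power2)
      then show "norm (K (z, x)) \<le> B" by (simp add: K_def B_def Re_cinner)
      show "norm (f y) \<le> M" using fM xy by simp
      have "dist (K (z, x)) (K (z, y)) < \<eta> / (2 * M)"
        using z xy \<delta> \<delta>1(1) by (intro \<delta>1(2)) (auto simp: dist_Pair_Pair dist_norm)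
      then show "norm (K (z, x) - K (z, y)) \<le> \<eta> / (2 * M)" by (simp add: dist_norm)
    qed (use M B \<delta> in auto)
    also have "\<dots> \<le> \<eta> / 2 + \<eta> / 2"
      using \<delta>(3) M B by (intro add_mono) (auto simp: field_simps)
    finally show ?thesis by simp
  qed
  show ?thesis
  proof (intro exI[of _ N] exI[of _ w] exI[of _ E] conjI allI impI)
    fix i
    show "E i \<in> sets borel" by (rule E)
    show "E i \<subseteq> cball (w i) 1" using E(2)[of i] \<delta>(2) by (meson order_trans subset_cball)
  next
    show "disjoint_family E" by (rule E)
  next
    fix f :: "complex ^ 'n \<Rightarrow> complex" and z :: "complex ^ 'n"
    assume f: "entire_fun f" and fA: "\<forall>w. norm (f w) \<le> A * exp (\<alpha> / 2 * (norm w)\<^sup>2)" and z: "norm z \<le> R0"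
    define G where "G = repro \<alpha> f z"
    define S where "S x = (\<Sum>i<N. indicator (E i) x *\<^sub>R G (w i))" for x
    have [measurable]: "G \<in> borel_measurable borel" unfolding G_def by (rule repro_measurable[OF f])
    note [measurable] = E(1)
    have [measurable]: "- cball (0 :: complex ^ 'n) R \<in> sets borel" "cball (0 :: complex ^ 'n) R \<in> sets borel" by auto
    have fin: "emeasure lborel (E i) < \<infinity>" for i
      using E(3)[of i] by (intro emeasure_bounded_finite bounded_subset[OF bounded_cball])
    have Gi: "integrable lborel G" "(LINT x|lborel. G x) = of_real (gauss_mass \<alpha> TYPE('n)) * f z"
      unfolding G_def using reproducing_formula[OF \<alpha> f fA[rule_format]] by auto
    have Ei: "integrable lborel (\<lambda>x. indicator (E i) x *\<^sub>R G (w i))" "(LINT x|lborel. indicator (E i) x *\<^sub>R G (w i)) = measure lborel (E i) *\<^sub>R G (w i)" for i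
      using fin[of i] by simp_all
    have Si: "integrable lborel S" "(LINT x|lborel. S x) = (\<Sum>i<N. measure lborel (E i) *\<^sub>R G (w i))"
      unfolding S_def[abs_def] Bochner_Integration.integral_sum[OF Ei(1)] Ei(2)
      by (rule Bochner_Integration.integrable_sum[OF Ei(1)]) (rule refl)
    have "ennreal (norm (LINT x|lborel. G x - S x)) \<le> (\<integral>\<^sup>+x. ennreal (norm (G x - S x)) \<partial>lborel)"
      by (rule integral_norm_bound_ennreal) (use Gi Si in auto)
    also have "\<dots> \<le> (\<integral>\<^sup>+x. ennreal (A * H) * (indicator (- cball 0 R) x * ennreal (exp (- norm (x :: complex ^ 'n)))) + ennreal \<eta> * indicator (cball 0 R) x \<partial>lborel)"
    proof (rule nn_integral_mono)
      fix x
      show "ennreal (norm (G x - S x)) \<le> ennreal (A * H) * (indicator (- cball 0 R) x * ennreal (exp (- norm x))) + ennreal \<eta> * indicator (cball 0 R) x"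
      proof (cases "x \<in> cball 0 R")
        case True
        then have "x \<in> (\<Union>i<N. E i)" unfolding E(6) .
        then obtain i where i: "i < N" "x \<in> E i" by blast
        have ind: "indicator (E j) x = (if j = i then 1 else 0 :: real)" for j
          using E(5) i(2) unfolding disjoint_family_on_def by (cases "j = i") (auto simp: indicator_def)
        have "S x = G (w i)" unfolding S_def ind using i by (simp add: if_distrib if_distribR cong: if_cong)
        moreover have "norm (G x - G (w i)) \<le> \<eta>"
          unfolding G_def using True E(2)[of i] E(4)[OF i(1)] i z fA
          by (intro close[OF f]) (auto simp: dist_norm norm_minus_commute)
        ultimately show ?thesis using True by (simp add: ennreal_leI)
      next
        case False
        then have "x \<notin> E i" for i using E(3)[of i] by blast
        then have "S x = 0" unfolding S_def by simp
        moreover have "norm (G x) \<le> A * H * exp (- norm x)"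
          unfolding G_def by (rule repro_bound[OF \<alpha> _ z _ H(2)]) (use fA A in auto)
        ultimately show ?thesis using False A H by (simp add: ennreal_mult'[symmetric] ennreal_leI)
      qed
    qed
    also have "\<dots> = ennreal (A * H) * (\<integral>\<^sup>+x. indicator (- cball 0 R) x * ennreal (exp (- norm (x :: complex ^ 'n))) \<partial>lborel) + ennreal \<eta> * emeasure lborel (cball (0 :: complex ^ 'n) R)"
      by (subst nn_integral_add) (auto simp: nn_integral_cmult)
    also have "\<dots> \<le> ennreal (A * H) * ennreal (\<epsilon> / (2 * (A * H))) + ennreal \<eta> * ennreal V"
      using R(1) by (intro add_mono mult_left_mono R(2)) (auto simp: V_def emeasure_cball content_cball)
    also have "\<dots> = ennreal (A * H * (\<epsilon> / (2 * (A * H))) + \<eta> * V)"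
      using A H \<epsilon> \<eta> V by (simp add: ennreal_mult'[symmetric] ennreal_plus[symmetric] del: ennreal_plus)
    also have "A * H * (\<epsilon> / (2 * (A * H))) + \<eta> * V = \<epsilon>"
      using A H V by (simp add: \<eta>_def)
    finally have "norm (LINT x|lborel. G x - S x) \<le> \<epsilon>" using \<epsilon> by simp
    then show "norm (of_real (gauss_mass \<alpha> TYPE('n)) * f z - (\<Sum>i<N. measure lborel (E i) *\<^sub>R repro \<alpha> f z (w i))) \<le> \<epsilon>"
      using Gi Si by (simp add: G_def)
  qed
qed

abbreviation (input) remainder ::
  "real \<Rightarrow> nat \<Rightarrow> (nat \<Rightarrow> complex ^ 'n) \<Rightarrow> (nat \<Rightarrow> complex) \<Rightarrow> (complex ^ 'n \<Rightarrow> complex) \<Rightarrow> complex ^ 'n \<Rightarrow> complex" where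
  "remainder \<alpha> N w b f \<equiv> \<lambda>z. f z - kernel_sum \<alpha> N w (\<lambda>i. b i * f (w i)) z"

text \<open>
The two properties play different roles: the first makes the error negligible where \<open>|\<psi>| \<le> R0\<close>, and the
second is a bound elsewhere whose constant does not depend on \<open>R0\<close> and \<open>\<epsilon>\<close>.
\<close>

lemma finite_rank_approximation:
  fixes \<alpha> r M :: real
  assumes \<alpha>: "\<alpha> > 0" and r: "1 \<le> r" and M: "M > 0"
  shows "\<exists>C>0. \<forall>R0 \<epsilon>. \<epsilon> > 0 \<longrightarrow> (\<exists>N (w :: nat \<Rightarrow> complex ^ 'n::finite) b. \<forall>f. entire_fun f \<longrightarrow>
      (energy m \<alpha> r f) \<le> ennreal M \<longrightarrow>
      (\<forall>z. norm z \<le> R0 \<longrightarrow> Wmod m \<alpha> (remainder \<alpha> N w b f) z \<le> \<epsilon>) \<and>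
      (\<forall>z. ennreal (Wmod m \<alpha> (remainder \<alpha> N w b f) z) \<le>
        ennreal C * exp_avg (wmod m \<alpha> f) z))"
proof -
  obtain C1 where C1: "C1 > 0" "\<And>(f :: complex ^ 'n \<Rightarrow> complex) z. entire_fun f \<Longrightarrow>
    ennreal (Wmod m \<alpha> f z) \<le> ennreal C1 * local_mean m \<alpha> f z"
    using pointwise_le_local_mean[of m \<alpha>] by blast
  obtain C2 where C2: "C2 > 0" "\<And>(f :: complex ^ 'n \<Rightarrow> complex) z. entire_fun f \<Longrightarrow>
    ennreal (Wmod m \<alpha> f z) \<le> ennreal C2 * exp_avg (wmod m \<alpha> f) z"
    using pointwise_le_exp_mean[of m \<alpha>] by blast
  obtain H where H: "H > 0" "\<And>t. t \<ge> 0 \<Longrightarrow> (1 + t) ^ m * exp (- (\<alpha> / 2) * t\<^sup>2) \<le> H * exp (- t)"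
    using exp_quadratic_bound[of "\<alpha> / 2" m 0] \<alpha> by auto
  define A where "A = (C2 powr r * exp_mass TYPE('n) powr (r - 1) * M) powr (1 / r)"
  define c0 where "c0 = gauss_mass \<alpha> TYPE('n)"
  have c0: "c0 > 0" unfolding c0_def by (rule gauss_mass_pos[OF \<alpha>])
  have A: "A > 0" using C2(1) exp_mass_pos[where 'n = 'n] M by (simp add: A_def)
  define D where "D = 1 / c0 * H * C1 * exp 4 * measure lborel (cball (0 :: complex ^ 'n) 5)"
  have D: "D \<ge> 0" unfolding D_def using c0 H C1 by simp
  show ?thesis
  proof (intro exI[of _ "C2 + D"] conjI allI impI)
    show "C2 + D > 0" using C2(1) D by simp
    fix R0 \<epsilon> :: real assume \<epsilon>: "\<epsilon> > 0"
    define R where "R = max R0 0"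
    have R: "R \<ge> 0" by (simp add: R_def)
    have "\<epsilon> * c0 / (1 + R) ^ m > 0" using \<epsilon> c0 by (simp add: R_def)
    from quadrature_converges[OF \<alpha> A this R, where 'n = 'n, folded c0_def]
    obtain N :: nat and w :: "nat \<Rightarrow> complex ^ 'n" and E where E: "\<And>i. E i \<in> sets borel" "\<And>i. E i \<subseteq> cball (w i) 1" "disjoint_family E"
      and conv: "\<And>(f :: complex ^ 'n \<Rightarrow> complex) z. entire_fun f \<Longrightarrow> (\<And>w. norm (f w) \<le> A * exp (\<alpha> / 2 * (norm w)\<^sup>2)) \<Longrightarrow> norm z \<le> R \<Longrightarrow>
        norm (of_real c0 * f z - (\<Sum>i<N. measure lborel (E i) *\<^sub>R repro \<alpha> f z (w i))) \<le> \<epsilon> * c0 / (1 + R) ^ m"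
      by blast
    define b :: "nat \<Rightarrow> complex" where "b i = of_real (1 / c0 * measure lborel (E i) * exp (- \<alpha> * (norm (w i))\<^sup>2))" for i
    \<comment> \<open>the Riemann sum is a combination of kernels whose coefficients depend on \<open>f\<close> through its values at the nodes\<close>
    have split: "exp (of_real \<alpha> * c - of_real s) = exp (of_real \<alpha> * c) * of_real (exp (- s))" for c :: complex and s
      by (simp add: exp_diff exp_minus exp_of_real divide_inverse)
    have P: "kernel_sum \<alpha> N w (\<lambda>i. b i * f (w i)) z = (\<Sum>i<N. (1 / c0 * measure lborel (E i)) *\<^sub>R repro \<alpha> f z (w i))" for f z
      unfolding kernel_sum_def b_def repro_def split
      unfolding scaleR_conv_of_real of_real_mult
      by (intro sum.cong refl) (simp only: mult_ac mult_minus_left)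
    show "\<exists>N (w :: nat \<Rightarrow> complex ^ 'n) b. \<forall>f. entire_fun f \<longrightarrow>
      (energy m \<alpha> r f) \<le> ennreal M \<longrightarrow>
      (\<forall>z. norm z \<le> R0 \<longrightarrow> Wmod m \<alpha> (remainder \<alpha> N w b f) z \<le> \<epsilon>) \<and>
      (\<forall>z. ennreal (Wmod m \<alpha> (remainder \<alpha> N w b f) z) \<le>
        ennreal (C2 + D) * exp_avg (wmod m \<alpha> f) z)"
    proof (intro exI[of _ N] exI[of _ w] exI[of _ b] allI impI conjI)
      fix f :: "complex ^ 'n \<Rightarrow> complex" and z :: "complex ^ 'n" assume f: "entire_fun f" and I: "energy m \<alpha> r f \<le> ennreal M" and z: "norm z \<le> R0"
      have growth: "norm (f x) \<le> A * exp (\<alpha> / 2 * (norm x)\<^sup>2)" for x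
      proof -
        have "1 * (norm (f x) * exp (- (\<alpha> / 2) * (norm x)\<^sup>2)) \<le> Wmod m \<alpha> f x"
          unfolding Wmod_def by (intro mult_right_mono one_le_power) auto
        also have "\<dots> \<le> A"
          unfolding A_def by (rule bound_of_exp_mean[OF f r _ C2(1) C2(2)[OF f, of x] I]) (use M in simp_all)
        finally show ?thesis by (simp add: exp_minus field_simps)
      qed
      define g where "g = f z - kernel_sum \<alpha> N w (\<lambda>i. b i * f (w i)) z"
      have "of_real c0 * g = of_real c0 * f z - (\<Sum>i<N. measure lborel (E i) *\<^sub>R repro \<alpha> f z (w i))"
        using c0 by (simp add: g_def P right_diff_distrib sum_distrib_left scaleR_conv_of_real)
      then have "norm (of_real c0 * g) \<le> \<epsilon> * c0 / (1 + R) ^ m"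
        using conv[OF f growth, of z] z by (simp only: R_def)
      then have "c0 * norm g \<le> \<epsilon> * c0 / (1 + R) ^ m"
        using c0 by (simp add: norm_mult)
      then have "c0 * norm g \<le> c0 * (\<epsilon> / (1 + R) ^ m)" by (simp add: mult.commute)
      then have "norm g \<le> \<epsilon> / (1 + R) ^ m" using c0 by (rule mult_left_le_imp_le)
      have "Wmod m \<alpha> (remainder \<alpha> N w b f) z \<le> (1 + R) ^ m * (\<epsilon> / (1 + R) ^ m * 1)"
        unfolding Wmod_def g_def[symmetric] using z \<alpha> \<epsilon> \<open>norm g \<le> _\<close>
        by (intro mult_mono power_mono) (auto simp: R_def)
      also have "\<dots> = \<epsilon>" by (simp add: R_def add_nonneg_eq_0_iff)
      finally show "Wmod m \<alpha> (remainder \<alpha> N w b f) z \<le> \<epsilon>" .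
    next
      fix f :: "complex ^ 'n \<Rightarrow> complex" and z :: "complex ^ 'n" assume f: "entire_fun f" and I: "energy m \<alpha> r f \<le> ennreal M"
      let ?I = "exp_avg (wmod m \<alpha> f) z"
      have "ennreal (Wmod m \<alpha> (remainder \<alpha> N w b f) z) \<le> ennreal (Wmod m \<alpha> f z) + 
         ennreal (Wmod m \<alpha> (kernel_sum \<alpha> N w (\<lambda>i. b i * f (w i))) z)"
        using Wmod_triangle[of m \<alpha> f "kernel_sum \<alpha> N w (\<lambda>i. b i * f (w i))" z]
        by (simp add: ennreal_plus[symmetric] ennreal_leI del: ennreal_plus)
      also have "\<dots> \<le> ennreal C2 * ?I + ennreal D * ?I"
      proof (rule add_mono)
        show "ennreal (Wmod m \<alpha> f z) \<le> ennreal C2 * ?I" by (rule C2(2)[OF f])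
        show "ennreal (Wmod m \<alpha> (kernel_sum \<alpha> N w (\<lambda>i. b i * f (w i))) z) \<le> ennreal D * ?I"
          unfolding P[abs_def] D_def using c0
          by (intro quadrature_exp_mean[OF f H C1(1) C1(2)[OF f] E]) auto
      qed
      also have "\<dots> = ennreal (C2 + D) * ?I"
        using C2(1) D by (simp add: distrib_right)
      finally show "ennreal (Wmod m \<alpha> (remainder \<alpha> N w b f) z) \<le> ennreal (C2 + D) * ?I" .
    qed
  qed
qed

section \<open>The Fock--Sobolev norms\<close>

lemma epowr_le_iff:
  assumes "r > 0" "t \<ge> 0"
  shows "epowr x (1 / r) \<le> ennreal t \<longleftrightarrow> x \<le> ennreal (t powr r)"
proof (cases x)
  case (real y)
  have "y powr (1 / r) \<le> t \<longleftrightarrow> y \<le> t powr r"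
  proof
    assume "y powr (1 / r) \<le> t"
    then have "(y powr (1 / r)) powr r \<le> t powr r" using assms by (intro powr_mono2) auto
    then show "y \<le> t powr r" using assms real by (simp add: powr_powr)
  next
    assume "y \<le> t powr r"
    then have "y powr (1 / r) \<le> (t powr r) powr (1 / r)" using assms real by (intro powr_mono2) auto
    then show "y powr (1 / r) \<le> t" using assms by (simp add: powr_powr)
  qed
  then show ?thesis using real assms by (simp add: epowr_def)
qed (simp add: epowr_def top_unique)

lemma epowr_scale:
  assumes "r > 0" "s \<ge> 0"
  shows "epowr (ennreal (s powr r) * x) (1 / r) = ennreal s * epowr x (1 / r)"
proof (cases x)
  case (real y)
  then show ?thesis
    using assms by (simp add: epowr_def ennreal_mult'[symmetric] ennreal_mult_eq_top_iff powr_mult powr_powr)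
next
  case top
  then show ?thesis using assms by (cases "s = 0") (auto simp: epowr_def ennreal_mult_top)
qed

lemma epowr_eq_top_iff: "epowr x a = \<infinity> \<longleftrightarrow> x = \<infinity>"
  by (simp add: epowr_def)

lemma fs_const_pos: "\<alpha> > 0 \<Longrightarrow> r > 0 \<Longrightarrow> n > 0 \<Longrightarrow> fs_const m \<alpha> r n > 0"
  unfolding fs_const_def by (intro mult_pos_pos divide_pos_pos Gamma_real_pos add_nonneg_pos) auto

lemma fs_norm_finite:
  assumes "r > 0"
  shows "fs_norm m \<alpha> (ennreal r) (f :: complex ^ 'n::finite \<Rightarrow> complex) =
    epowr (ennreal (fs_const m \<alpha> r CARD('n)) * energy m \<alpha> r f) (1 / r)"
proof -
  have "wmod m \<alpha> f z powr r = (norm z ^ m) powr r * norm (f z) powr r * exp (- (\<alpha> * r / 2) * (norm z)\<^sup>2)" for z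
    unfolding wmod_def by (simp add: powr_mult exp_powr_real mult_ac)
  then show ?thesis using assms by (simp add: fs_norm_def)
qed

lemma fs_norm_infinite:
  "fs_norm m \<alpha> \<infinity> f = (SUP z. ennreal (wmod m \<alpha> f z))"
  by (simp add: fs_norm_def wmod_def mult.assoc)

lemma fs_norm_le_iff:
  assumes "r > 0" "t \<ge> 0"
  shows "fs_norm m \<alpha> (ennreal r) (f :: complex ^ 'n::finite \<Rightarrow> complex) \<le> ennreal t \<longleftrightarrow>
    ennreal (fs_const m \<alpha> r CARD('n)) * energy m \<alpha> r f \<le> ennreal (t powr r)"
  unfolding fs_norm_finite[OF assms(1)] by (rule epowr_le_iff[OF assms])

lemma wmod_scale: "wmod m \<alpha> (\<lambda>z. a * f z) z = norm a * wmod m \<alpha> f z"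
  by (simp add: wmod_def norm_mult)

lemma wmod_triangle: "wmod m \<alpha> (\<lambda>z. f z + g z) z \<le> wmod m \<alpha> f z + wmod m \<alpha> g z"
proof -
  have "norm z ^ m * (norm (f z + g z) * exp (- (\<alpha> / 2) * (norm z)\<^sup>2)) \<le>
    norm z ^ m * ((norm (f z) + norm (g z)) * exp (- (\<alpha> / 2) * (norm z)\<^sup>2))"
    by (intro mult_left_mono mult_right_mono norm_triangle_ineq) auto
  then show ?thesis by (simp add: wmod_def algebra_simps)
qed

text \<open>
Convexity on the closed half-line, obtained by adding the tangent inequalities at the convex combination.
\<close>

lemma convex_powr:
  fixes u v l r :: real
  assumes "1 \<le> r" "0 \<le> u" "0 \<le> v" "0 \<le> l" "l \<le> 1"
  shows "(l * u + (1 - l) * v) powr r \<le> l * u powr r + (1 - l) * v powr r"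
proof (cases "l * u + (1 - l) * v = 0")
  case True
  then show ?thesis using assms by simp
next
  case False
  define t where "t = l * u + (1 - l) * v"
  have t: "t > 0"
    using False assms by (simp add: t_def less_le)
  have tangent: "r * s * t powr r \<le> (r - 1) * t * t powr r + t * s powr r" if "s \<ge> 0" for s
  proof -
    have "s \<le> t * (1 - 1 / r) + t powr (1 - r) / r * s powr r"
      by (rule le_powr_average[OF assms(1) t that])
    then have "(r * t powr r) * s \<le> (r * t powr r) * (t * (1 - 1 / r) + t powr (1 - r) / r * s powr r)"
      using assms by (intro mult_left_mono) auto
    also have "\<dots> = (r - 1) * t * t powr r + t * s powr r"
      using t assms by (simp add: powr_diff field_simps)
    finally show ?thesis by (simp add: mult_ac)
  qed
  have "r * t * t powr r = l * (r * u * t powr r) + (1 - l) * (r * v * t powr r)"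
    by (simp add: t_def algebra_simps)
  also have "\<dots> \<le> l * ((r - 1) * t * t powr r + t * u powr r) + (1 - l) * ((r - 1) * t * t powr r + t * v powr r)"
    using assms by (intro add_mono mult_left_mono tangent) auto
  finally have "t * t powr r \<le> t * (l * u powr r + (1 - l) * v powr r)"
    by (simp add: algebra_simps)
  then show ?thesis using t by (simp add: t_def)
qed

lemma fs_norm_scale:
  assumes "p = \<infinity> \<or> (\<exists>r\<ge>1. p = ennreal r)" and f: "(f :: complex ^ 'n::finite \<Rightarrow> complex) \<in> borel_measurable borel"
  shows "fs_norm m \<alpha> p (\<lambda>z. a * f z) = ennreal (norm a) * fs_norm m \<alpha> p f"
  using assms(1)
proof
  assume p: "p = \<infinity>"
  show ?thesis
    unfolding p fs_norm_infinite wmod_scale by (simp add: ennreal_mult' SUP_mult_left_ennreal)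
next
  assume "\<exists>r\<ge>1. p = ennreal r"
  then obtain r where r: "r \<ge> 1" "p = ennreal r" by blast
  note [measurable] = wmod_measurable[OF f]
  have "energy m \<alpha> r (\<lambda>z. a * f z) = (\<integral>\<^sup>+z. ennreal (norm a powr r) * ennreal (wmod m \<alpha> f z powr r) \<partial>lborel)"
    by (simp add: wmod_scale powr_mult ennreal_mult')
  also have "\<dots> = ennreal (norm a powr r) * energy m \<alpha> r f"
    by (rule nn_integral_cmult) measurable
  finally show ?thesis
    using r by (simp add: fs_norm_finite mult.left_commute[of _ "ennreal (norm a powr r)"] epowr_scale)
qed

text \<open>
Minkowski's inequality. With \<open>a\<close> and \<open>b\<close> slightly larger than the two norms, convexity is applied to
\<open>f / a\<close> and \<open>g / b\<close> with the weights \<open>a / (a + b)\<close> and \<open>b / (a + b)\<close>.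
\<close>

lemma fs_norm_triangle:
  assumes "p = \<infinity> \<or> (\<exists>r\<ge>1. p = ennreal r)" and \<alpha>: "\<alpha> > 0"
    and f: "(f :: complex ^ 'n::finite \<Rightarrow> complex) \<in> borel_measurable borel" and g: "g \<in> borel_measurable borel"
  shows "fs_norm m \<alpha> p (\<lambda>z. f z + g z) \<le> fs_norm m \<alpha> p f + fs_norm m \<alpha> p g"
  using assms(1)
proof
  assume p: "p = \<infinity>"
  show ?thesis
    unfolding p fs_norm_infinite
  proof (rule SUP_least)
    fix z
    have "ennreal (wmod m \<alpha> (\<lambda>z. f z + g z) z) \<le> ennreal (wmod m \<alpha> f z) + ennreal (wmod m \<alpha> g z)"
      using wmod_triangle[of m \<alpha> f g z] by (simp add: ennreal_plus[symmetric] ennreal_leI del: ennreal_plus)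
    also have "\<dots> \<le> (SUP z. ennreal (wmod m \<alpha> f z)) + (SUP z. ennreal (wmod m \<alpha> g z))"
      by (intro add_mono SUP_upper) auto
    finally show "ennreal (wmod m \<alpha> (\<lambda>z. f z + g z) z) \<le> (SUP z. ennreal (wmod m \<alpha> f z)) + (SUP z. ennreal (wmod m \<alpha> g z))" .
  qed
next
  assume "\<exists>r\<ge>1. p = ennreal r"
  then obtain r where r: "r \<ge> 1" "p = ennreal r" by blast
  note [measurable] = wmod_measurable[OF f] wmod_measurable[OF g]
  define c where "c = fs_const m \<alpha> r CARD('n)"
  have c: "c > 0" unfolding c_def by (rule fs_const_pos) (use \<alpha> r in auto)
  show ?thesis
  proof (rule ennreal_le_epsilon)
    fix e :: real assume fin: "fs_norm m \<alpha> p f + fs_norm m \<alpha> p g < top" and e: "e > 0"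
    obtain x where x: "fs_norm m \<alpha> p f = ennreal x" "x \<ge> 0" using fin by (cases "fs_norm m \<alpha> p f") auto
    obtain y where y: "fs_norm m \<alpha> p g = ennreal y" "y \<ge> 0" using fin by (cases "fs_norm m \<alpha> p g") auto
    define a where "a = x + e / 2"
    define b where "b = y + e / 2"
    have ab: "a > 0" "b > 0" using x y e by (auto simp: a_def b_def)
    have If: "ennreal c * energy m \<alpha> r f \<le> ennreal (a powr r)"
      using fs_norm_le_iff[of r a m \<alpha> f] r x ab e by (simp add: c_def a_def)
    have Ig: "ennreal c * energy m \<alpha> r g \<le> ennreal (b powr r)"
      using fs_norm_le_iff[of r b m \<alpha> g] r y ab e by (simp add: c_def b_def)
    define l where "l = a / (a + b)"
    have l: "0 \<le> l" "l \<le> 1" "1 - l = b / (a + b)" using ab by (auto simp: l_def field_simps)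
    define A where "A = (a + b) powr r * (l / a powr r)"
    define B where "B = (a + b) powr r * ((1 - l) / b powr r)"
    have AB0: "A \<ge> 0" "B \<ge> 0" using ab l by (auto simp: A_def B_def)
    have pt: "wmod m \<alpha> (\<lambda>z. f z + g z) z powr r \<le> A * wmod m \<alpha> f z powr r + B * wmod m \<alpha> g z powr r" for z
    proof -
      let ?u = "wmod m \<alpha> f z" and ?v = "wmod m \<alpha> g z"
      have "wmod m \<alpha> (\<lambda>z. f z + g z) z powr r \<le> (?u + ?v) powr r"
        using r by (intro powr_mono2 wmod_triangle) auto
      also have "?u + ?v = (a + b) * (l * (?u / a) + (1 - l) * (?v / b))"
      proof -
        have "l * (?u / a) = ?u / (a + b)" "(1 - l) * (?v / b) = ?v / (a + b)"
          unfolding l(3) using ab by (simp_all add: l_def)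
        then show ?thesis using ab by (simp add: add_divide_distrib[symmetric])
      qed
      also have "\<dots> powr r = (a + b) powr r * (l * (?u / a) + (1 - l) * (?v / b)) powr r"
        by (rule powr_mult)
      also have "\<dots> \<le> (a + b) powr r * (l * (?u / a) powr r + (1 - l) * (?v / b) powr r)"
        using ab l r by (intro mult_left_mono convex_powr) auto
      also have "\<dots> = A * ?u powr r + B * ?v powr r"
        using ab by (simp add: A_def B_def powr_divide algebra_simps)
      finally show ?thesis .
    qed
    have "ennreal c * energy m \<alpha> r (\<lambda>z. f z + g z) \<le>
       ennreal c * (\<integral>\<^sup>+z. ennreal A * ennreal (wmod m \<alpha> f z powr r) + ennreal B * ennreal (wmod m \<alpha> g z powr r) \<partial>lborel)"
      using pt AB0 by (intro mult_left_mono nn_integral_mono) (simp_all add: ennreal_mult'[symmetric] ennreal_plus[symmetric] ennreal_leI del: ennreal_plus)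
    also have "\<dots> = ennreal A * (ennreal c * energy m \<alpha> r f) + ennreal B * (ennreal c * energy m \<alpha> r g)"
      by (subst nn_integral_add) (auto simp: nn_integral_cmult distrib_left mult_ac)
    also have "\<dots> \<le> ennreal A * ennreal (a powr r) + ennreal B * ennreal (b powr r)"
      by (intro add_mono mult_left_mono If Ig) auto
    also have "\<dots> = ennreal (A * a powr r + B * b powr r)"
      using AB0 by (simp add: ennreal_mult'[symmetric] ennreal_plus[symmetric] del: ennreal_plus)
    also have "A * a powr r + B * b powr r = (a + b) powr r"
    proof -
      have "A * a powr r = (a + b) powr r * l" "B * b powr r = (a + b) powr r * (1 - l)"
        using ab by (simp_all add: A_def B_def)
      then show ?thesis by (simp add: algebra_simps)
    qed
    finally have "fs_norm m \<alpha> p (\<lambda>z. f z + g z) \<le> ennreal (a + b)"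
      using fs_norm_le_iff[of r "a + b" m \<alpha> "\<lambda>z. f z + g z"] r ab by (simp add: c_def)
    also have "ennreal (a + b) = fs_norm m \<alpha> p f + fs_norm m \<alpha> p g + ennreal e"
      unfolding x y using x y e by (simp add: ennreal_plus[symmetric] a_def b_def del: ennreal_plus)
    finally show "fs_norm m \<alpha> p (\<lambda>z. f z + g z) \<le> fs_norm m \<alpha> p f + fs_norm m \<alpha> p g + ennreal e" .
  qed
qed

lemma fs_norm_sum:
  assumes "p = \<infinity> \<or> (\<exists>r\<ge>1. p = ennreal r)" and \<alpha>: "\<alpha> > 0"
    and f: "\<And>i. i < N \<Longrightarrow> (f i :: complex ^ 'n::finite \<Rightarrow> complex) \<in> borel_measurable borel"
  shows "fs_norm m \<alpha> p (\<lambda>z. \<Sum>i<N::nat. f i z) \<le> (\<Sum>i<N. fs_norm m \<alpha> p (f i))"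
  using f
proof (induction N)
  case 0
  show ?case using fs_norm_scale[OF assms(1), of "\<lambda>_. 0 :: complex" m \<alpha> 0] by simp
next
  case (Suc N)
  have "fs_norm m \<alpha> p (\<lambda>z. (\<Sum>i<N. f i z) + f N z) \<le> fs_norm m \<alpha> p (\<lambda>z. \<Sum>i<N. f i z) + fs_norm m \<alpha> p (f N)"
    using Suc.prems by (intro fs_norm_triangle assms(1) \<alpha> borel_measurable_sum) auto
  also have "\<dots> \<le> (\<Sum>i<N. fs_norm m \<alpha> p (f i)) + fs_norm m \<alpha> p (f N)"
    using Suc by (intro add_right_mono) auto
  finally show ?case by simp
qed

section \<open>Kernel functions as elements of the spaces\<close>

lemma cinner_axis: "cinner (axis j t) w = t * cnj (w $ j)"
proof -
  have "cinner (axis j t) w = (\<Sum>i\<in>UNIV. if i = j then t * cnj (w $ j) else 0)"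
    unfolding cinner_def axis_def by (intro sum.cong) auto
  then show ?thesis by simp
qed

lemma partial_deriv_kernel_sum:
  fixes w :: "nat \<Rightarrow> complex ^ 'n::finite"
  shows "partial_deriv j (kernel_sum \<alpha> N w b) = kernel_sum \<alpha> N w (\<lambda>i. b i * (of_real \<alpha> * cnj (w i $ j)))"
proof
  fix z
  have "((\<lambda>t. \<Sum>i<N. b i * exp (of_real \<alpha> * (cinner z (w i) + t * cnj (w i $ j)))) has_field_derivative 
     (\<Sum>i<N. b i * (of_real \<alpha> * cnj (w i $ j)) * exp (of_real \<alpha> * cinner z (w i)))) (at 0)"
    by (rule DERIV_sum) (auto intro!: derivative_eq_intros)
  then show "partial_deriv j (kernel_sum \<alpha> N w b) z = kernel_sum \<alpha> N w (\<lambda>i. b i * (of_real \<alpha> * cnj (w i $ j))) z"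
    unfolding partial_deriv_def kernel_sum_def cinner_add cinner_axis by (rule DERIV_imp_deriv)
qed

lemma multi_deriv_kernel_sum:
  fixes w :: "nat \<Rightarrow> complex ^ 'n::finite"
  shows "\<exists>b'. multi_deriv \<beta> (kernel_sum \<alpha> N w b) = kernel_sum \<alpha> N w b'"
proof -
  have pow: "\<exists>b'. (partial_deriv j ^^ k) (kernel_sum \<alpha> N w b) = kernel_sum \<alpha> N w b'" for j k b
    by (induction k) (auto simp: partial_deriv_kernel_sum)
  have "\<exists>b'. foldr (\<lambda>j. partial_deriv j ^^ \<beta> j) js (kernel_sum \<alpha> N w b) = kernel_sum \<alpha> N w b'" for js
  proof (induction js)
    case (Cons j js)
    then obtain b1 where "foldr (\<lambda>j. partial_deriv j ^^ \<beta> j) js (kernel_sum \<alpha> N w b) = kernel_sum \<alpha> N w b1" by blast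
    then show ?case using pow[of "\<beta> j" j b1] by simp
  qed auto
  then show ?thesis unfolding multi_deriv_def .
qed

lemma kernel_sum_decay:
  fixes w :: "nat \<Rightarrow> complex ^ 'n::finite"
  assumes \<alpha>: "\<alpha> > 0"
  shows "\<exists>D\<ge>0. \<forall>z. Wmod m \<alpha> (kernel_sum \<alpha> N w b) z \<le> D * exp (- norm z)"
proof -
  define s where "s = (\<Sum>i<N. norm (w i))"
  define B where "B = (\<Sum>i<N. norm (b i))"
  obtain H where H: "H > 0" "\<And>t. t \<ge> 0 \<Longrightarrow> (1 + t) ^ m * exp (\<alpha> * s * t - \<alpha> / 2 * t\<^sup>2) \<le> H * exp (- t)"
    using exp_quadratic_bound[of "\<alpha> / 2" m "\<alpha> * s"] \<alpha> by auto
  have B: "B \<ge> 0" unfolding B_def by (simp add: sum_nonneg)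
  have bound: "norm (kernel_sum \<alpha> N w b z) \<le> B * exp (\<alpha> * s * norm z)" for z
  proof -
    have "norm (kernel_sum \<alpha> N w b z) \<le> (\<Sum>i<N. norm (b i) * exp (\<alpha> * (z \<bullet> w i)))"
      unfolding kernel_sum_def by (rule sum_norm_le) (simp add: norm_mult Re_cinner)
    also have "\<dots> \<le> (\<Sum>i<N. norm (b i) * exp (\<alpha> * s * norm z))"
    proof (intro sum_mono mult_left_mono)
      fix i assume i: "i \<in> {..<N}"
      have "norm (w i) \<le> s" unfolding s_def using i by (intro member_le_sum) auto
      then have "z \<bullet> w i \<le> s * norm z"
        using norm_cauchy_schwarz[of z "w i"] mult_right_mono[of "norm (w i)" s "norm z"] by (simp add: mult.commute)
      then show "exp (\<alpha> * (z \<bullet> w i)) \<le> exp (\<alpha> * s * norm z)" using \<alpha> by (simp add: mult.assoc)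
    qed simp
    also have "\<dots> = B * exp (\<alpha> * s * norm z)" by (simp add: B_def sum_distrib_right)
    finally show ?thesis .
  qed
  have "Wmod m \<alpha> (kernel_sum \<alpha> N w b) z \<le> (B * H) * exp (- norm z)" for z
  proof -
    have "Wmod m \<alpha> (kernel_sum \<alpha> N w b) z \<le> (1 + norm z) ^ m * (B * exp (\<alpha> * s * norm z) * exp (- (\<alpha> / 2) * (norm z)\<^sup>2))"
      unfolding Wmod_def by (intro mult_left_mono mult_right_mono bound) auto
    also have "\<dots> = B * ((1 + norm z) ^ m * exp (\<alpha> * s * norm z - \<alpha> / 2 * (norm z)\<^sup>2))"
    proof -
      have e: "exp (\<alpha> * s * norm z - \<alpha> / 2 * (norm z)\<^sup>2) = exp (\<alpha> * s * norm z) * exp (- (\<alpha> / 2) * (norm z)\<^sup>2)"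
        by (simp add: exp_add[symmetric])
      show ?thesis unfolding e by (simp only: mult_ac)
    qed
    also have "\<dots> \<le> B * (H * exp (- norm z))"
      by (intro mult_left_mono H B) auto
    finally show ?thesis by (simp add: mult.assoc)
  qed
  then show ?thesis using B H by (intro exI[of _ "B * H"]) auto
qed

lemma nn_integral_decay_finite:
  fixes h :: "complex ^ 'n::finite \<Rightarrow> real"
  assumes r: "r \<ge> 1" and h: "\<And>z. 0 \<le> h z" "\<And>z. h z \<le> D * exp (- norm (z - a))" "D \<ge> 0"
  shows "(\<integral>\<^sup>+z. ennreal (h z powr r) \<partial>lborel) \<le> ennreal (D powr r * exp_mass TYPE('n))"
proof -
  have "(\<integral>\<^sup>+z. ennreal (h z powr r) \<partial>lborel) \<le> (\<integral>\<^sup>+z. ennreal (D powr r) * ennreal (exp (- norm (a - z))) \<partial>lborel)"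
  proof (rule nn_integral_mono)
    fix z
    have "h z powr r \<le> (D * exp (- norm (a - z))) powr r"
      using h(1)[of z] h(2)[of z] r by (intro powr_mono2) (auto simp: norm_minus_commute)
    also have "\<dots> = D powr r * exp (- norm (a - z)) powr r"
      using h(3) by (simp add: powr_mult)
    also have "\<dots> \<le> D powr r * exp (- norm (a - z)) powr 1"
      using r by (intro mult_left_mono powr_mono') auto
    finally show "ennreal (h z powr r) \<le> ennreal (D powr r) * ennreal (exp (- norm (a - z)))"
      by (simp add: ennreal_mult'[symmetric] ennreal_leI)
  qed
  also have "\<dots> = ennreal (D powr r * exp_mass TYPE('n))"
    by (subst nn_integral_cmult) (auto simp: exp_mass_translate ennreal_mult')
  finally show ?thesis .
qed

lemma kernel_sum_in_fock_sobolev: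
  fixes w :: "nat \<Rightarrow> complex ^ 'n::finite"
  assumes \<alpha>: "\<alpha> > 0" and r: "r \<ge> 1"
  shows "kernel_sum \<alpha> N w b \<in> fock_sobolev m \<alpha> (ennreal r)"
proof -
  have fin: "fock_norm \<alpha> (ennreal r) (kernel_sum \<alpha> N w b') < \<infinity>" for b'
  proof -
    let ?F = "kernel_sum \<alpha> N w b'"
    obtain D where D: "D \<ge> 0" "\<And>z. Wmod 0 \<alpha> ?F z \<le> D * exp (- norm (z - 0))"
      using kernel_sum_decay[OF \<alpha>, of 0 N w b'] by auto
    have eq: "Wmod 0 \<alpha> ?F z powr r = norm (?F z) powr r * exp (- (\<alpha> * r / 2) * (norm z)\<^sup>2)" for z
      unfolding Wmod_def by (simp add: powr_mult exp_powr_real mult_ac)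
    have "(\<integral>\<^sup>+z. ennreal (norm (?F z) powr r * exp (- (\<alpha> * r / 2) * (norm z)\<^sup>2)) \<partial>lborel) \<le> ennreal (D powr r * exp_mass TYPE('n))"
      unfolding eq[symmetric] by (rule nn_integral_decay_finite[OF r _ D(2,1)]) simp
    then have "(\<integral>\<^sup>+z. ennreal (norm (?F z) powr r * exp (- (\<alpha> * r / 2) * (norm z)\<^sup>2)) \<partial>lborel) < \<infinity>"
      by (rule le_less_trans) simp
    then show ?thesis
      using r by (simp add: fock_norm_def less_top[symmetric] epowr_eq_top_iff[unfolded infinity_ennreal_def] ennreal_mult_eq_top_iff)
  qed
  have "(\<Sum>\<beta> | (\<Sum>j\<in>UNIV. \<beta> j) \<le> m. fock_norm \<alpha> (ennreal r) (multi_deriv \<beta> (kernel_sum \<alpha> N w b))) < \<infinity>"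
  proof (cases "finite {\<beta> :: 'n \<Rightarrow> nat. (\<Sum>j\<in>UNIV. \<beta> j) \<le> m}")
    case True
    have "fock_norm \<alpha> (ennreal r) (multi_deriv \<beta> (kernel_sum \<alpha> N w b)) < \<infinity>" for \<beta>
      using multi_deriv_kernel_sum[of \<beta> \<alpha> N w b] fin by auto
    then show ?thesis using True by simp
  qed simp
  then show ?thesis unfolding fock_sobolev_def by (simp add: entire_kernel_sum)
qed

text \<open>
The normalised kernel \<open>k\<^sub>w\<close>, divided by \<open>(1 + |w|)\<^sup>m\<close> to keep its norm bounded in \<open>w\<close>.
\<close>

definition test_fun :: "nat \<Rightarrow> real \<Rightarrow> complex ^ 'n \<Rightarrow> complex ^ 'n \<Rightarrow> complex" where
  "test_fun m \<alpha> w z = fock_kernel \<alpha> w z / of_real ((1 + norm w) ^ m)"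

lemma norm_test_fun:
  fixes z w :: "complex ^ 'n::finite"
  shows "norm (test_fun m \<alpha> w z) * exp (- (\<alpha> / 2) * (norm z)\<^sup>2) = exp (- (\<alpha> / 2) * (norm (z - w))\<^sup>2) / (1 + norm w) ^ m"
proof -
  have "norm (test_fun m \<alpha> w z) = exp (\<alpha> * (z \<bullet> w) - \<alpha> / 2 * (norm w)\<^sup>2) / (1 + norm w) ^ m"
    by (simp add: test_fun_def fock_kernel_def norm_divide norm_power Re_cinner flip: of_real_add)
  moreover have "exp (\<alpha> * (z \<bullet> w) - \<alpha> / 2 * (norm w)\<^sup>2) * exp (- (\<alpha> / 2) * (norm z)\<^sup>2) = exp (- (\<alpha> / 2) * (norm (z - w))\<^sup>2)"
    unfolding exp_add[symmetric] norm_minus_squared by (simp add: algebra_simps)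
  ultimately show ?thesis by (metis times_divide_eq_left)
qed

lemma wmod_test_fun_le:
  fixes z w :: "complex ^ 'n::finite"
  assumes H: "\<And>t. t \<ge> 0 \<Longrightarrow> (1 + t) ^ m * exp (- (\<alpha> / 2) * t\<^sup>2) \<le> H * exp (- t)"
  shows "wmod m \<alpha> (test_fun m \<alpha> w) z \<le> H * exp (- norm (z - w))"
proof -
  have "wmod m \<alpha> (test_fun m \<alpha> w) z \<le> ((1 + norm w) * (1 + norm (z - w))) ^ m * (exp (- (\<alpha> / 2) * (norm (z - w))\<^sup>2) / (1 + norm w) ^ m)"
    unfolding wmod_def norm_test_fun
    by (intro mult_right_mono power_mono) (use one_plus_norm_le[of z w] in auto)
  also have "\<dots> = (1 + norm (z - w)) ^ m * exp (- (\<alpha> / 2) * (norm (z - w))\<^sup>2)"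
    using norm_ge_zero[of w] by (simp add: power_mult_distrib add_nonneg_eq_0_iff)
  also have "\<dots> \<le> H * exp (- norm (z - w))" by (rule H) simp
  finally show ?thesis .
qed

lemma test_fun_sum:
  "(\<lambda>z. \<Sum>k<N. c * test_fun m \<alpha> (w k) z) = kernel_sum \<alpha> N w (\<lambda>k. c * (of_real (exp (- (\<alpha> / 2 * (norm (w k))\<^sup>2))) / of_real ((1 + norm (w k)) ^ m)))"
proof -
  have split: "exp (of_real \<alpha> * c - of_real s) = exp (of_real \<alpha> * c) * of_real (exp (- s))" for c :: complex and s
    by (simp add: exp_diff exp_minus exp_of_real divide_inverse)
  show ?thesis
    unfolding kernel_sum_def test_fun_def fock_kernel_def split by (simp add: mult_ac)
qed

lemma test_fun_in_fock_sobolev: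
  fixes w :: "complex ^ 'n::finite"
  assumes "\<alpha> > 0" "r \<ge> 1"
  shows "test_fun m \<alpha> w \<in> fock_sobolev m \<alpha> (ennreal r)"
  using kernel_sum_in_fock_sobolev[OF assms, of 1 "\<lambda>_. w"] test_fun_sum[where c = 1 and N = 1 and m = m and \<alpha> = \<alpha> and w = "\<lambda>_. w"] by simp

lemma sum_exp_distinct_le:
  fixes x :: "'b \<Rightarrow> real"
  assumes "finite S" "\<And>k. k \<in> S \<Longrightarrow> 0 \<le> x k" "\<And>j k. j \<in> S \<Longrightarrow> k \<in> S \<Longrightarrow> j \<noteq> k \<Longrightarrow> 1 \<le> \<bar>x j - x k\<bar>"
  shows "(\<Sum>k\<in>S. exp (- x k)) \<le> 1 / (1 - exp (- 1))"
proof -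
  define n where "n k = nat \<lfloor>x k\<rfloor>" for k
  have inj: "inj_on n S"
  proof (rule inj_onI)
    fix j k assume jk: "j \<in> S" "k \<in> S" "n j = n k"
    then have "\<lfloor>x j\<rfloor> = \<lfloor>x k\<rfloor>" using assms(2) by (simp add: n_def eq_nat_nat_iff)
    then have "\<bar>x j - x k\<bar> < 1" by linarith
    then show "j = k" using assms(3)[OF jk(1,2)] by force
  qed
  have "(\<Sum>k\<in>S. exp (- x k)) \<le> (\<Sum>k\<in>S. exp (- 1) ^ n k)"
  proof (rule sum_mono)
    fix k assume "k \<in> S"
    then have "real (n k) \<le> x k" using assms(2) by (simp add: n_def)
    then show "exp (- x k) \<le> exp (- 1) ^ n k" by (simp add: exp_of_nat_mult[symmetric])
  qed
  also have "\<dots> = (\<Sum>i\<in>n ` S. exp (- 1) ^ i)" by (simp add: sum.reindex[OF inj])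
  also have "\<dots> \<le> (\<Sum>i. exp (- 1 :: real) ^ i)"
    using assms(1) by (intro sum_le_suminf summable_geometric) auto
  also have "\<dots> = 1 / (1 - exp (- 1))" by (rule suminf_geometric) simp
  finally show ?thesis .
qed

text \<open>
If the norms of the \<open>w k\<close> are separated by at least \<open>1\<close>, then \<open>|z - w k| \<ge> ||z| - |w k||\<close> and both the points
inside and the points outside the sphere through \<open>z\<close> contribute at most a geometric series.
\<close>

lemma sum_exp_separated:
  fixes w :: "nat \<Rightarrow> 'a::real_normed_vector"
  assumes sep: "\<And>j k. j < k \<Longrightarrow> norm (w j) + 1 \<le> norm (w k)"
  shows "(\<Sum>k<N. exp (- norm (z - w k))) \<le> 2 / (1 - exp (- 1))"
proof -
  let ?P = "{k. k < N \<and> norm (w k) \<le> norm z}" and ?Q = "{k. k < N \<and> norm z < norm (w k)}"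
  have gap: "1 \<le> \<bar>norm (w j) - norm (w k)\<bar>" if "j \<noteq> k" for j k
    using sep[of j k] sep[of k j] that by (cases "j < k") auto
  have "(\<Sum>k<N. exp (- norm (z - w k))) \<le> (\<Sum>k<N. exp (- \<bar>norm z - norm (w k)\<bar>))"
    by (intro sum_mono) (simp add: norm_triangle_ineq3)
  also have "\<dots> = (\<Sum>k\<in>?P \<union> ?Q. exp (- \<bar>norm z - norm (w k)\<bar>))"
    by (rule sum.cong) auto
  also have "\<dots> = (\<Sum>k\<in>?P. exp (- (norm z - norm (w k)))) + (\<Sum>k\<in>?Q. exp (- (norm (w k) - norm z)))"
    by (subst sum.union_disjoint) (auto intro!: arg_cong2[where f = "(+)"] sum.cong)
  also have "\<dots> \<le> 1 / (1 - exp (- 1)) + 1 / (1 - exp (- 1))"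
  proof (intro add_mono sum_exp_distinct_le)
    fix j k :: nat assume "j \<noteq> k"
    from gap[OF this] show "1 \<le> \<bar>norm z - norm (w j) - (norm z - norm (w k))\<bar>" "1 \<le> \<bar>norm (w j) - norm z - (norm (w k) - norm z)\<bar>"
      by linarith+
  qed auto
  finally show ?thesis by simp
qed

text \<open>
Almost disjointness makes the \<open>r\<close>-th powers of the norms add up: the sum \<open>S\<close> of the exponential profiles is
bounded, so \<open>\<integral> S\<^sup>r\<close> is at most a constant times \<open>\<integral> S\<close>, which is \<open>N\<close> times the mass of one profile.
\<close>

lemma fs_norm_test_fun_sum:
  fixes r :: real
  assumes \<alpha>: "\<alpha> > 0" and r: "r \<ge> 1"
  shows "\<exists>D>0. \<forall>N (w :: nat \<Rightarrow> complex ^ 'n::finite) c. (\<forall>z. (\<Sum>k<N. exp (- norm (z - w k))) \<le> 2 / (1 - exp (- 1))) \<longrightarrow>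
     fs_norm m \<alpha> (ennreal r) (\<lambda>z. \<Sum>k<N. c * test_fun m \<alpha> (w k) z) \<le> ennreal (norm c * D * real N powr (1 / r))"
proof -
  obtain H where H: "H > 0" "\<And>t. t \<ge> 0 \<Longrightarrow> (1 + t) ^ m * exp (- (\<alpha> / 2) * t\<^sup>2) \<le> H * exp (- t)"
    using exp_quadratic_bound[of "\<alpha> / 2" m 0] \<alpha> by auto
  define G :: real where "G = 2 / (1 - exp (- 1))"
  have G: "G > 0" by (simp add: G_def)
  define F where "F = fs_const m \<alpha> r CARD('n)"
  have F: "F > 0" unfolding F_def by (rule fs_const_pos) (use \<alpha> r in auto)
  define D where "D = (F * H powr r * G powr (r - 1) * exp_mass TYPE('n)) powr (1 / r)"
  have D: "D > 0" using F H G exp_mass_pos[where 'n = 'n] by (simp add: D_def)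
  show ?thesis
  proof (intro exI[of _ D] conjI allI impI D)
    fix N and w :: "nat \<Rightarrow> complex ^ 'n" and c :: complex
    assume s: "\<forall>z. (\<Sum>k<N. exp (- norm (z - w k))) \<le> 2 / (1 - exp (- 1))"
    define S where "S z = (\<Sum>k<N. exp (- norm (w k - z)))" for z
    have S: "0 \<le> S z" "S z \<le> G" for z using s by (auto simp: S_def G_def norm_minus_commute intro!: sum_nonneg)
    let ?f = "\<lambda>z. \<Sum>k<N. c * test_fun m \<alpha> (w k) z"
    have pt: "wmod m \<alpha> ?f z \<le> norm c * H * S z" for z
    proof -
      have "wmod m \<alpha> ?f z \<le> norm z ^ m * ((\<Sum>k<N. norm (c * test_fun m \<alpha> (w k) z)) * exp (- (\<alpha> / 2) * (norm z)\<^sup>2))"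
        unfolding wmod_def by (intro mult_left_mono mult_right_mono norm_sum) auto
      also have "\<dots> = (\<Sum>k<N. norm c * wmod m \<alpha> (test_fun m \<alpha> (w k)) z)"
        unfolding wmod_def by (simp add: sum_distrib_left sum_distrib_right norm_mult mult_ac)
      also have "\<dots> \<le> (\<Sum>k<N. norm c * (H * exp (- norm (z - w k))))"
        by (intro sum_mono mult_left_mono wmod_test_fun_le H) auto
      also have "\<dots> = norm c * H * S z" by (simp add: S_def sum_distrib_left mult.assoc norm_minus_commute)
      finally show ?thesis .
    qed
    have "wmod m \<alpha> ?f z powr r \<le> (norm c * H) powr r * G powr (r - 1) * S z" for z
    proof -
      have "wmod m \<alpha> ?f z powr r \<le> (norm c * H * S z) powr r"
        using r by (intro powr_mono2 pt) auto
      also have "\<dots> = (norm c * H) powr r * S z powr r"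
        using H S[of z] by (simp add: powr_mult)
      also have "S z powr r = S z powr (r - 1) * S z"
        using S[of z] r by (cases "S z = 0") (auto simp: powr_mult_base powr_diff)
      also have "(norm c * H) powr r * (S z powr (r - 1) * S z) \<le> (norm c * H) powr r * (G powr (r - 1) * S z)"
        using S[of z] r by (intro mult_left_mono mult_right_mono powr_mono2) auto
      finally show ?thesis by (simp add: mult.assoc)
    qed
    then have "energy m \<alpha> r ?f \<le> (\<integral>\<^sup>+z. ennreal ((norm c * H) powr r * G powr (r - 1)) * (\<Sum>k<N. ennreal (exp (- norm (w k - z)))) \<partial>lborel)"
      using H G by (intro nn_integral_mono) (simp add: ennreal_mult'[symmetric] ennreal_leI S_def)
    also have "\<dots> = ennreal ((norm c * H) powr r * G powr (r - 1)) * (\<Sum>k<N. \<integral>\<^sup>+z. ennreal (exp (- norm (w k - z))) \<partial>lborel)"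
      by (subst nn_integral_cmult, measurable, subst nn_integral_sum) auto
    also have "\<dots> = ennreal ((norm c * H) powr r * G powr (r - 1) * (real N * exp_mass TYPE('n)))"
      using exp_mass_pos[where 'n = 'n] by (simp add: exp_mass_translate ennreal_of_nat_eq_real_of_nat ennreal_mult'[symmetric])
    finally have "ennreal F * energy m \<alpha> r ?f \<le> ennreal F * ennreal ((norm c * H) powr r * G powr (r - 1) * (real N * exp_mass TYPE('n)))"
      by (rule mult_left_mono) simp
    also have "\<dots> = ennreal ((norm c * D * real N powr (1 / r)) powr r)"
    proof -
      have "(norm c * D * real N powr (1 / r)) powr r = norm c powr r * D powr r * real N"
        using D r by (simp add: powr_mult powr_powr)
      also have "D powr r = F * H powr r * G powr (r - 1) * exp_mass TYPE('n)"
        using r F H G exp_mass_pos[where 'n = 'n] by (simp add: D_def powr_powr)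
      finally have "(norm c * D * real N powr (1 / r)) powr r = F * ((norm c * H) powr r * G powr (r - 1) * (real N * exp_mass TYPE('n)))"
        by (simp add: powr_mult mult_ac)
      then show ?thesis using F by (simp only: ennreal_mult'[symmetric] less_imp_le)
    qed
    finally show "fs_norm m \<alpha> (ennreal r) ?f \<le> ennreal (norm c * D * real N powr (1 / r))"
      unfolding F_def using r D by (subst fs_norm_le_iff) auto
  qed
qed

section \<open>Compact operators and normalised kernels\<close>

abbreviation (input) "bounded_op_fs m \<alpha> p q \<equiv>
  bounded_op (fock_sobolev m \<alpha> p) (fs_norm m \<alpha> p) (fock_sobolev m \<alpha> q) (fs_norm m \<alpha> q)"

abbreviation (input) "compact_op_fs m \<alpha> p q \<equiv>
  compact_op (fock_sobolev m \<alpha> p) (fs_norm m \<alpha> p) (fock_sobolev m \<alpha> q) (fs_norm m \<alpha> q)"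

abbreviation (input) "op_norm_fs m \<alpha> p q \<equiv> op_norm (fock_sobolev m \<alpha> p) (fs_norm m \<alpha> p) (fs_norm m \<alpha> q)"

abbreviation (input) "essential_norm_fs m \<alpha> p q \<equiv>
  essential_norm (fock_sobolev m \<alpha> p) (fs_norm m \<alpha> p) (fock_sobolev m \<alpha> q) (fs_norm m \<alpha> q)"

lemma fock_sobolev_measurable:
  "f \<in> fock_sobolev m \<alpha> p \<Longrightarrow> (f :: complex ^ 'n::finite \<Rightarrow> complex) \<in> borel_measurable borel"
  by (intro entire_fun_measurable) (simp add: fock_sobolev_def)

lemma linear_op_comb:
  assumes "linear_op X Y T" "f \<in> X" "g \<in> X"
  shows "T (\<lambda>z. a * f z + b * g z) = (\<lambda>z. a * T f z + b * T g z)"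
  using assms(1)[unfolded linear_op_def, THEN conjunct2] assms(2,3) by (elim ballE allE) auto

lemma linear_op_scale:
  assumes "linear_op X Y T" "f \<in> X"
  shows "T (\<lambda>z. a * f z) = (\<lambda>z. a * T f z)"
  using linear_op_comb[OF assms assms(2), of a 0] by simp

lemma linear_op_test_fun_sum:
  fixes w :: "nat \<Rightarrow> complex ^ 'n::finite"
  assumes \<alpha>: "\<alpha> > 0" and r: "r \<ge> 1" and K: "linear_op (fock_sobolev m \<alpha> (ennreal r)) Y K"
  shows "K (\<lambda>z. \<Sum>k<N. c * test_fun m \<alpha> (w k) z) = (\<lambda>z. \<Sum>k<N. c * K (test_fun m \<alpha> (w k)) z)"
proof (induction N)
  case 0
  show ?case using linear_op_scale[OF K test_fun_in_fock_sobolev[OF \<alpha> r], of 0] by simp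
next
  case (Suc N)
  have "(\<lambda>z. \<Sum>k<N. c * test_fun m \<alpha> (w k) z) \<in> fock_sobolev m \<alpha> (ennreal r)"
    unfolding test_fun_sum by (rule kernel_sum_in_fock_sobolev[OF \<alpha> r])
  then have "K (\<lambda>z. 1 * (\<Sum>k<N. c * test_fun m \<alpha> (w k) z) + c * test_fun m \<alpha> (w N) z) = 
     (\<lambda>z. 1 * K (\<lambda>z. \<Sum>k<N. c * test_fun m \<alpha> (w k) z) z + c * K (test_fun m \<alpha> (w N)) z)"
    by (rule linear_op_comb[OF K _ test_fun_in_fock_sobolev[OF \<alpha> r]])
  then show ?case using Suc by simp
qed

text \<open>
This is where \<open>r > 1\<close> enters. The images under \<open>K\<close> of the normalised kernels tend to \<open>0\<close>, so that far out \<open>T\<close>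
acts on them like \<open>T - K\<close>. The assumption on \<open>op_norm\<close> also shows that \<open>K\<close> is bounded.
\<close>

lemma compact_perturbation_test_fun:
  fixes r :: real
  assumes \<alpha>: "\<alpha> > 0" and r: "r > 1" and q: "q = \<infinity> \<or> (\<exists>s\<ge>1. q = ennreal s)"
  shows "\<exists>D>0. \<forall>(T :: (complex ^ 'n::finite \<Rightarrow> complex) \<Rightarrow> (complex ^ 'n \<Rightarrow> complex)) K A. bounded_op_fs m \<alpha> (ennreal r) q T \<longrightarrow>
    compact_op_fs m \<alpha> (ennreal r) q K \<longrightarrow>
    A > 0 \<longrightarrow> op_norm_fs m \<alpha> (ennreal r) q (\<lambda>f z. T f z - K f z) \<le> ennreal A \<longrightarrow>
    (\<exists>R. \<forall>w :: complex ^ 'n. norm w \<ge> R \<longrightarrow> fs_norm m \<alpha> q (T (test_fun m \<alpha> w)) \<le> ennreal (D * A))"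
proof -
  let ?X = "fock_sobolev m \<alpha> (ennreal r) :: (complex ^ 'n \<Rightarrow> complex) set"
  let ?N = "fs_norm m \<alpha> (ennreal r) :: (complex ^ 'n \<Rightarrow> complex) \<Rightarrow> ennreal"
  let ?Y = "fock_sobolev m \<alpha> q :: (complex ^ 'n \<Rightarrow> complex) set"
  let ?M = "fs_norm m \<alpha> q :: (complex ^ 'n \<Rightarrow> complex) \<Rightarrow> ennreal"
  let ?t = "test_fun m \<alpha> :: complex ^ 'n \<Rightarrow> complex ^ 'n \<Rightarrow> complex"
  have r1: "r \<ge> 1" using r by simp
  note scale = fs_norm_scale[OF q, of _ m \<alpha>] and triangle = fs_norm_triangle[OF q \<alpha>, of _ _ m]
  obtain D where D: "D > 0" "\<And>N (w :: nat \<Rightarrow> complex ^ 'n) c. (\<And>z. (\<Sum>k<N. exp (- norm (z - w k))) \<le> 2 / (1 - exp (- 1))) \<Longrightarrow>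
     ?N (\<lambda>z. \<Sum>k<N. c * ?t (w k) z) \<le> ennreal (norm c * D * real N powr (1 / r))"
    using fs_norm_test_fun_sum[OF \<alpha> r1, of m, where 'n = 'n] by blast
  have ND: "?N (\<lambda>z. c * ?t w z) \<le> ennreal (norm c * D)" for c w
  proof -
    have "exp (- norm (z - w)) \<le> 2 / (1 - exp (- 1))" for z
    proof -
      have "exp (- norm (z - w)) \<le> 1" by simp
      also have "1 \<le> 2 / (1 - exp (- 1) :: real)" by (simp add: field_simps)
      finally show ?thesis .
    qed
    then show ?thesis using D(2)[where N = 1 and w = "\<lambda>_. w" and c = c] by simp
  qed
  show ?thesis
  proof (rule exI[of _ "D + 1"], intro conjI allI impI)
    show "D + 1 > 0" using D by simp
    fix T K A
    assume T: "bounded_op ?X ?N ?Y ?M T" and K: "compact_op ?X ?N ?Y ?M K" and A: "A > 0"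
      and op: "op_norm ?X ?N ?M (\<lambda>f z. T f z - K f z) \<le> ennreal A"
    have linT: "linear_op ?X ?Y T" and linK: "linear_op ?X ?Y K"
      using T K by (auto simp: bounded_op_def compact_op_def)
    have meas [measurable]: "T f \<in> borel_measurable borel" "K f \<in> borel_measurable borel" if "f \<in> ?X" for f
      using that linT linK by (auto simp: linear_op_def intro!: fock_sobolev_measurable)
    have tX: "?t w \<in> ?X" for w by (rule test_fun_in_fock_sobolev[OF \<alpha> r1])
    have ctX: "(\<lambda>z. c * ?t w z) \<in> ?X" for c w
    proof -
      have "(\<lambda>z. \<Sum>k<1::nat. c * ?t ((\<lambda>_. w) k) z) \<in> ?X"
        unfolding test_fun_sum by (rule kernel_sum_in_fock_sobolev[OF \<alpha> r1])
      then show ?thesis by simp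
    qed
    obtain C0 where C0: "\<And>f. f \<in> ?X \<Longrightarrow> ?M (T f) \<le> ennreal C0 * ?N f"
      using T by (auto simp: bounded_op_def)
    define CT where "CT = max C0 0"
    have CT: "?M (T f) \<le> ennreal CT" if "f \<in> ?X" "?N f \<le> 1" for f
    proof -
      have "?M (T f) \<le> ennreal C0 * ?N f" by (rule C0[OF that(1)])
      also have "\<dots> \<le> ennreal CT * 1" using that(2) by (intro mult_mono ennreal_leI) (auto simp: CT_def)
      finally show ?thesis by simp
    qed
    have diff: "?M (\<lambda>z. T f z - K f z) \<le> ennreal A" if "f \<in> ?X" "?N f \<le> 1" for f
      using op that unfolding op_norm_def by (auto simp: SUP_le_iff)
    have Kbd: "?M (K f) \<le> ennreal (CT + A)" if f: "f \<in> ?X" "?N f \<le> 1" for f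
    proof -
      note [measurable] = meas[OF f(1)]
      have "?M (\<lambda>z. T f z + (- 1) * (T f z - K f z)) \<le> ?M (T f) + ?M (\<lambda>z. (- 1) * (T f z - K f z))"
        by (rule triangle) measurable
      also have "?M (\<lambda>z. (- 1) * (T f z - K f z)) = ?M (\<lambda>z. T f z - K f z)"
        by (subst scale) auto
      also have "?M (T f) + ?M (\<lambda>z. T f z - K f z) \<le> ennreal CT + ennreal A"
        by (intro add_mono CT diff f)
      finally show ?thesis using A by (simp add: CT_def)
    qed
    have small: "\<exists>R. \<forall>w. norm w \<ge> R \<longrightarrow> ?M (K (?t w)) \<le> ennreal \<epsilon>" if \<epsilon>: "\<epsilon> > 0" for \<epsilon>
    proof (rule ccontr)
      assume "\<not> ?thesis"
      then have ex: "\<exists>w. norm w \<ge> R \<and> ennreal \<epsilon> < ?M (K (?t w))" for R by (auto simp: not_le)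
      \<comment> \<open>the growth of the norms is inherited by subsequences, so sparseness survives the passage to a limit\<close>
      have "\<exists>w. \<forall>n. ennreal \<epsilon> < ?M (K (?t (w n))) \<and> norm (w n) + 1 \<le> norm (w (Suc n))"
        by (rule dependent_nat_choice) (use ex in blast)+
      then obtain w where w: "\<And>n. ennreal \<epsilon> < ?M (K (?t (w n)))" "\<And>n. norm (w n) + 1 \<le> norm (w (Suc n))" by blast
      have sep: "norm (w j) + 1 \<le> norm (w k)" if "j < k" for j k
        using that
      proof (induction k)
        case (Suc k)
        then show ?case using w(2)[of k] by (cases "j = k") auto
      qed simp
      define f where "f k = (\<lambda>z. of_real (1 / D) * ?t (w k) z)" for k
      have fX: "f k \<in> ?X" "?N (f k) \<le> 1" for k
      proof -
        show "f k \<in> ?X" unfolding f_def by (rule ctX)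
        show "?N (f k) \<le> 1" using ND[of "of_real (1 / D)" "w k"] D by (simp add: f_def norm_divide)
      qed
      have "\<exists>g\<in>?Y. \<exists>s :: nat \<Rightarrow> nat. strict_mono s \<and> (\<lambda>k. ?M (\<lambda>z. K (f (s k)) z - g z)) \<longlonglongrightarrow> 0"
        using K[unfolded compact_op_def, THEN conjunct2, rule_format, of f] fX by blast
      then obtain g s where g: "g \<in> ?Y" "strict_mono (s :: nat \<Rightarrow> nat)" "(\<lambda>k. ?M (\<lambda>z. K (f (s k)) z - g z)) \<longlonglongrightarrow> 0"
        by blast
      have [measurable]: "g \<in> borel_measurable borel" by (rule fock_sobolev_measurable[OF g(1)])
      define \<eta> where "\<eta> = \<epsilon> / (4 * D)"
      have \<eta>: "\<eta> > 0" using \<epsilon> D by (simp add: \<eta>_def)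
      have "\<forall>\<^sub>F k in sequentially. ?M (\<lambda>z. K (f (s k)) z - g z) < ennreal \<eta>"
        using g(3) \<eta> by (intro order_tendstoD) auto
      then obtain k0 where k0: "\<And>k. k \<ge> k0 \<Longrightarrow> ?M (\<lambda>z. K (f (s k)) z - g z) < ennreal \<eta>"
        by (auto simp: eventually_sequentially)
      define v where "v k = w (s (k0 + k))" for k
      define h where "h k = K (f (s (k0 + k)))" for k
      have [measurable]: "h k \<in> borel_measurable borel" for k unfolding h_def by (rule meas(2)[OF fX(1)])
      have hg: "?M (\<lambda>z. h k z - g z) \<le> ennreal \<eta>" for k
        using k0[of "k0 + k"] by (simp add: h_def)
      have h_eq: "h k = (\<lambda>z. of_real (1 / D) * K (?t (v k)) z)" for k
        unfolding h_def f_def v_def by (rule linear_op_scale[OF linK tX])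
      have vsep: "norm (v j) + 1 \<le> norm (v k)" if "j < k" for j k
        unfolding v_def using that by (intro sep strict_monoD[OF g(2)]) simp
      have "ennreal (4 * \<eta>) \<le> ?M (h 0)"
      proof -
        have "ennreal (4 * \<eta>) = ennreal (1 / D) * ennreal \<epsilon>"
          using D \<epsilon> by (simp add: \<eta>_def ennreal_mult'[symmetric])
        also have "\<dots> \<le> ennreal (1 / D) * ?M (K (?t (v 0)))"
          using w(1)[of "s k0"] by (intro mult_left_mono) (auto simp: v_def)
        also have "\<dots> = ?M (h 0)"
          unfolding h_eq using D by (subst scale[OF meas(2)[OF tX]]) (simp add: norm_divide)
        finally show ?thesis .
      qed
      also have "?M (h 0) = ?M (\<lambda>z. (h 0 z - g z) + g z)" by simp
      also have "\<dots> \<le> ?M (\<lambda>z. h 0 z - g z) + ?M g"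
        by (rule triangle) measurable
      also have "\<dots> \<le> ennreal \<eta> + ?M g" by (intro add_right_mono hg)
      finally have "ennreal \<eta> + ennreal (3 * \<eta>) \<le> ennreal \<eta> + ?M g"
        using \<eta> by (simp add: ennreal_plus[symmetric] del: ennreal_plus)
      then have g3: "ennreal (3 * \<eta>) \<le> ?M g" by (subst (asm) ennreal_add_left_cancel_le) auto
      \<comment> \<open>the factor \<open>c\<close> brings a sum of \<open>n\<close> kernels into the unit ball; its image is close to \<open>n\<^bsup>1-1/r\<^esup> g\<close>\<close>
      have main: "2 * \<eta> * real n powr (1 - 1 / r) \<le> CT + A" if n: "n \<ge> 1" for n
      proof -
        define c where "c = 1 / (D * real n powr (1 / r))"
        have c: "c > 0" using D n by (simp add: c_def)
        have cD: "c * D * real n = real n powr (1 - 1 / r)"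
          using D n by (simp add: c_def powr_diff)
        define G where "G = (\<lambda>z. \<Sum>k<n. of_real c * ?t (v k) z)"
        have GX: "G \<in> ?X" unfolding G_def test_fun_sum by (rule kernel_sum_in_fock_sobolev[OF \<alpha> r1])
        have "?N G \<le> ennreal (norm (of_real c :: complex) * D * real n powr (1 / r))"
          unfolding G_def by (rule D(2)) (rule sum_exp_separated[OF vsep])
        also have "norm (of_real c :: complex) * D * real n powr (1 / r) = 1"
          using c D n by (simp add: c_def norm_divide norm_mult)
        finally have NG: "?N G \<le> 1" by simp
        have KG: "K G = (\<lambda>z. \<Sum>k<n. of_real (c * D) * h k z)"
          unfolding G_def linear_op_test_fun_sum[OF \<alpha> r1 linK] h_eq using D by simp
        have [measurable]: "K G \<in> borel_measurable borel" by (rule meas(2)[OF GX])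
        have "ennreal (real n powr (1 - 1 / r)) * ?M g = ?M (\<lambda>z. of_real (real n powr (1 - 1 / r)) * g z)"
          by (subst scale) auto
        also have "(\<lambda>z. of_real (real n powr (1 - 1 / r)) * g z) = (\<lambda>z. K G z + (\<Sum>k<n. of_real (- (c * D)) * (h k z - g z)))"
        proof
          fix z
          have "K G z + (\<Sum>k<n. of_real (- (c * D)) * (h k z - g z)) = (\<Sum>k<n. of_real (c * D) * g z)"
            unfolding KG sum.distrib[symmetric] by (intro sum.cong) (simp_all add: algebra_simps)
          also have "\<dots> = of_real (c * D * real n) * g z" by simp
          finally show "of_real (real n powr (1 - 1 / r)) * g z = K G z + (\<Sum>k<n. of_real (- (c * D)) * (h k z - g z))"
            unfolding cD by simp
        qed
        also have "?M \<dots> \<le> ?M (K G) + ?M (\<lambda>z. \<Sum>k<n. of_real (- (c * D)) * (h k z - g z))"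
          by (rule triangle) measurable
        also have "\<dots> \<le> ennreal (CT + A) + (\<Sum>k<n. ?M (\<lambda>z. of_real (- (c * D)) * (h k z - g z)))"
          by (intro add_mono Kbd GX NG fs_norm_sum[OF q \<alpha>]) measurable
        also have "\<dots> \<le> ennreal (CT + A) + (\<Sum>k<n. ennreal (c * D * \<eta>))"
        proof (intro add_mono sum_mono order_refl)
          fix k
          have "?M (\<lambda>z. of_real (- (c * D)) * (h k z - g z)) = ennreal (c * D) * ?M (\<lambda>z. h k z - g z)"
            using c D by (subst scale) (auto simp: norm_mult)
          also have "\<dots> \<le> ennreal (c * D) * ennreal \<eta>" by (intro mult_left_mono hg) simp
          finally show "?M (\<lambda>z. of_real (- (c * D)) * (h k z - g z)) \<le> ennreal (c * D * \<eta>)"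
            using c D \<eta> by (simp add: ennreal_mult'[symmetric])
        qed
        also have "(\<Sum>k<n. ennreal (c * D * \<eta>)) = ennreal (real n * (c * D * \<eta>))"
          using c D \<eta> by (simp add: ennreal_of_nat_eq_real_of_nat ennreal_mult'[symmetric])
        also have "real n * (c * D * \<eta>) = real n powr (1 - 1 / r) * \<eta>"
          unfolding cD[symmetric] by simp
        finally have 1: "ennreal (real n powr (1 - 1 / r)) * ?M g \<le> ennreal (CT + A + real n powr (1 - 1 / r) * \<eta>)"
          using A \<eta> by (simp add: CT_def ennreal_plus[symmetric] del: ennreal_plus)
        have "ennreal (real n powr (1 - 1 / r) * (3 * \<eta>)) \<le> ennreal (real n powr (1 - 1 / r)) * ?M g"
          using mult_left_mono[OF g3, of "ennreal (real n powr (1 - 1 / r))"] \<eta> by (simp add: ennreal_mult')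
        also note 1
        finally have "real n powr (1 - 1 / r) * (3 * \<eta>) \<le> CT + A + real n powr (1 - 1 / r) * \<eta>"
          using A \<eta> by (subst (asm) ennreal_le_iff) (auto simp: CT_def)
        then show ?thesis by (simp add: algebra_simps)
      qed
      have "filterlim (\<lambda>n. 2 * \<eta> * real n powr (1 - 1 / r)) at_top sequentially"
      proof -
        have "1 - 1 / r > 0" using r by simp
        then have "filterlim (\<lambda>n. real n powr (1 - 1 / r)) at_top sequentially"
          by real_asymp
        then show ?thesis using \<eta> by (intro filterlim_tendsto_pos_mult_at_top[OF tendsto_const]) auto
      qed
      then have "\<forall>\<^sub>F n in sequentially. CT + A + 1 \<le> 2 * \<eta> * real n powr (1 - 1 / r)"
        by (simp add: filterlim_at_top)
      then have "\<forall>\<^sub>F n in sequentially. CT + A + 1 \<le> 2 * \<eta> * real n powr (1 - 1 / r) \<and> n \<ge> 1"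
        using eventually_ge_at_top[of 1] by eventually_elim auto
      then obtain n where "CT + A + 1 \<le> 2 * \<eta> * real n powr (1 - 1 / r)" "n \<ge> 1"
        by (auto dest: eventually_happens)
      then show False using main[of n] by simp
    qed
    obtain R where R: "\<And>w. norm w \<ge> R \<Longrightarrow> ?M (K (?t w)) \<le> ennreal A" using small[OF A] by blast
    have "?M (T (?t w)) \<le> ennreal ((D + 1) * A)" if "norm w \<ge> R" for w
    proof -
      note [measurable] = meas[OF tX]
      have "?M (T (?t w)) = ?M (\<lambda>z. of_real D * (T (\<lambda>z. of_real (1 / D) * ?t w z) z - K (\<lambda>z. of_real (1 / D) * ?t w z) z) + K (?t w) z)"
        unfolding linear_op_scale[OF linT tX] linear_op_scale[OF linK tX] using D by (simp add: algebra_simps)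
      also have "\<dots> \<le> ?M (\<lambda>z. of_real D * (T (\<lambda>z. of_real (1 / D) * ?t w z) z - K (\<lambda>z. of_real (1 / D) * ?t w z) z)) + ?M (K (?t w))"
        by (rule triangle) (use meas[OF ctX] in measurable)
      also have "?M (\<lambda>z. of_real D * (T (\<lambda>z. of_real (1 / D) * ?t w z) z - K (\<lambda>z. of_real (1 / D) * ?t w z) z)) 
         = ennreal D * ?M (\<lambda>z. T (\<lambda>z. of_real (1 / D) * ?t w z) z - K (\<lambda>z. of_real (1 / D) * ?t w z) z)"
      proof -
        have "(\<lambda>z. T (\<lambda>z. of_real (1 / D) * ?t w z) z - K (\<lambda>z. of_real (1 / D) * ?t w z) z) \<in> borel_measurable borel"
          by (intro borel_measurable_diff meas ctX)
        from scale[OF this] show ?thesis using D by simp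
      qed
      also have "\<dots> + ?M (K (?t w)) \<le> ennreal D * ennreal A + ennreal A"
      proof -
        have "?N (\<lambda>z. of_real (1 / D) * ?t w z) \<le> 1"
          using ND[of "of_real (1 / D)" w] D by (simp add: norm_divide)
        from diff[OF ctX this] R[OF that] show ?thesis
          by (intro add_mono mult_left_mono) simp_all
      qed
      also have "\<dots> = ennreal ((D + 1) * A)"
        using D A by (simp add: ennreal_mult'[symmetric] ennreal_plus[symmetric] algebra_simps del: ennreal_plus)
      finally show ?thesis .
    qed
    then show "\<exists>R. \<forall>w. norm w \<ge> R \<longrightarrow> ?M (T (?t w)) \<le> ennreal ((D + 1) * A)" by blast
  qed
qed

section \<open>The transforms and normalised kernels\<close>

text \<open>
The factor by which the weighted modulus changes under the operator (see \<open>wmod_weighted_comp\<close>). For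
\<open>q = \<infinity>\<close> the transform is this function.
\<close>

definition pull_weight :: "nat \<Rightarrow> real \<Rightarrow> (complex ^ 'n \<Rightarrow> complex) \<Rightarrow> (complex ^ 'n \<Rightarrow> complex ^ 'n) \<Rightarrow> complex ^ 'n \<Rightarrow> real" where
  "pull_weight m \<alpha> u \<psi> z = norm z ^ m * norm (u z) / (1 + norm (\<psi> z)) ^ m * exp (\<alpha> / 2 * ((norm (\<psi> z))\<^sup>2 - (norm z)\<^sup>2))"

lemma pull_weight_nonneg [simp]: "0 \<le> pull_weight m \<alpha> u \<psi> z"
  by (simp add: pull_weight_def)

lemma pull_weight_measurable:
  fixes u :: "complex ^ 'n::finite \<Rightarrow> complex"
  assumes [measurable]: "u \<in> borel_measurable borel" "\<psi> \<in> borel_measurable borel"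
  shows "pull_weight m \<alpha> u \<psi> \<in> borel_measurable borel"
  unfolding pull_weight_def[abs_def] by measurable

lemma berezin_inf_eq: "berezin_inf m \<alpha> u \<psi> z = ennreal (pull_weight m \<alpha> u \<psi> z)"
  by (simp add: berezin_inf_def pull_weight_def)

lemma one_plus_norm_pow_neq_0 [simp]: "(1 + norm x) ^ m \<noteq> 0"
  using norm_ge_zero[of x] by (simp add: add_nonneg_eq_0_iff)

lemma wmod_weighted_comp: "wmod m \<alpha> (weighted_comp u \<psi> g) z = pull_weight m \<alpha> u \<psi> z * Wmod m \<alpha> g (\<psi> z)"
proof -
  have "exp (\<alpha> / 2 * ((norm (\<psi> z))\<^sup>2 - (norm z)\<^sup>2)) * exp (- (\<alpha> / 2) * (norm (\<psi> z))\<^sup>2) = exp (- (\<alpha> / 2) * (norm z)\<^sup>2)"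
    unfolding exp_add[symmetric] by (simp add: algebra_simps)
  then have "exp (- (\<alpha> / 2) * (norm z)\<^sup>2) = exp (\<alpha> / 2 * ((norm (\<psi> z))\<^sup>2 - (norm z)\<^sup>2)) * exp (- (\<alpha> / 2) * (norm (\<psi> z))\<^sup>2)" ..
  moreover have "1 + norm (\<psi> z) \<noteq> 0"
    using norm_ge_zero[of "\<psi> z"] by (simp add: add_nonneg_eq_0_iff)
  ultimately show ?thesis
    by (simp only: wmod_def Wmod_def weighted_comp_def pull_weight_def norm_mult) simp
qed

lemma berezin_eq:
  fixes u :: "complex ^ 'n::finite \<Rightarrow> complex"
  shows "berezin m \<alpha> s u \<psi> w = (\<integral>\<^sup>+z. ennreal (pull_weight m \<alpha> u \<psi> z powr s * exp (- (\<alpha> * s / 2) * (norm (\<psi> z - w))\<^sup>2)) \<partial>lborel)"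
proof -
  have "norm (fock_kernel \<alpha> w (\<psi> z)) powr s / (1 + norm (\<psi> z)) powr (real m * s) * norm (u z) powr s * (norm z ^ m) powr s * exp (- (\<alpha> * s / 2) * (norm z)\<^sup>2) =
     pull_weight m \<alpha> u \<psi> z powr s * exp (- (\<alpha> * s / 2) * (norm (\<psi> z - w))\<^sup>2)" for z
  proof -
    have p: "(1 + norm (\<psi> z)) powr (real m * s) = ((1 + norm (\<psi> z)) ^ m) powr s"
    proof -
      have "(1 + norm (\<psi> z)) powr (real m * s) = ((1 + norm (\<psi> z)) powr real m) powr s"
        by (rule powr_powr[symmetric])
      then show ?thesis by (simp add: powr_realpow add_pos_nonneg)
    qed
    have e: "norm (fock_kernel \<alpha> w (\<psi> z)) powr s * exp (- (\<alpha> * s / 2) * (norm z)\<^sup>2) = 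
        exp (\<alpha> / 2 * ((norm (\<psi> z))\<^sup>2 - (norm z)\<^sup>2)) powr s * exp (- (\<alpha> * s / 2) * (norm (\<psi> z - w))\<^sup>2)"
    proof -
      have k: "norm (fock_kernel \<alpha> w (\<psi> z)) = exp (\<alpha> * (\<psi> z \<bullet> w) - \<alpha> / 2 * (norm w)\<^sup>2)"
        by (simp add: fock_kernel_def Re_cinner)
      have "(\<alpha> * x - \<alpha> / 2 * c) * s + - (\<alpha> * s / 2) * b = (\<alpha> / 2 * (a - b)) * s + - (\<alpha> * s / 2) * (a - 2 * x + c)" for a b c x :: real
        by (simp add: field_simps)
      then show ?thesis
        unfolding norm_minus_squared k exp_powr_real exp_add[symmetric] by (simp only:)
    qed
    have w: "pull_weight m \<alpha> u \<psi> z powr s = (norm z ^ m) powr s * norm (u z) powr s / ((1 + norm (\<psi> z)) ^ m) powr s * exp (\<alpha> / 2 * ((norm (\<psi> z))\<^sup>2 - (norm z)\<^sup>2)) powr s"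
      unfolding pull_weight_def by (simp only: powr_mult powr_divide)
    have "k / d * a * b * e1 = b * a / d * x * e2" if "k * e1 = x * e2" for k d a b e1 e2 x :: real
    proof -
      have "k / d * a * b * e1 = (b * a / d) * (k * e1)" by simp
      then show ?thesis unfolding that by simp
    qed
    from this[OF e] show ?thesis unfolding p w .
  qed
  then show ?thesis unfolding berezin_def by (simp only:)
qed

lemma Wmod_test_fun:
  fixes w z :: "complex ^ 'n::finite"
  shows "Wmod m \<alpha> (test_fun m \<alpha> w) z = ((1 + norm z) / (1 + norm w)) ^ m * exp (- (\<alpha> / 2) * (norm (z - w))\<^sup>2)"
  unfolding Wmod_def norm_test_fun by (simp add: power_divide)

text \<open>
Moving a point by less than \<open>1\<close> changes the kernel by at most a factor \<open>e\<close>.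
\<close>

lemma exp_norm_le_ball_mean:
  fixes z y :: "complex ^ 'n::finite"
  shows "ennreal (exp (- norm (z - y))) \<le> ennreal (exp 1 / measure lborel (ball (0 :: complex ^ 'n) 1)) *
    (\<integral>\<^sup>+x. indicator (ball z 1) x * ennreal (exp (- norm (y - x))) \<partial>lborel)"
proof -
  define v where "v = measure lborel (ball (0 :: complex ^ 'n) 1)"
  have v: "v > 0" unfolding v_def by (rule content_ball_pos) simp
  have [measurable]: "ball z 1 \<in> sets borel" by simp
  have "ennreal (exp (- norm (z - y))) * ennreal v = (\<integral>\<^sup>+x. indicator (ball z 1) x * ennreal (exp (- norm (z - y))) \<partial>lborel)"
    by (subst nn_integral_multc) (auto simp: v_def emeasure_ball content_ball mult.commute)
  also have "\<dots> \<le> (\<integral>\<^sup>+x. ennreal (exp 1) * (indicator (ball z 1) x * ennreal (exp (- norm (y - x)))) \<partial>lborel)"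
  proof (rule nn_integral_mono)
    fix x
    show "indicator (ball z 1) x * ennreal (exp (- norm (z - y))) \<le> ennreal (exp 1) * (indicator (ball z 1) x * ennreal (exp (- norm (y - x))))"
    proof (cases "x \<in> ball z 1")
      case True
      then have "norm (y - x) \<le> norm (z - y) + 1"
        using norm_triangle_ineq[of "y - z" "z - x"] by (simp add: dist_norm norm_minus_commute)
      then show ?thesis using True by (simp add: ennreal_mult'[symmetric] exp_add[symmetric])
    qed simp
  qed
  also have "\<dots> = ennreal (exp 1) * (\<integral>\<^sup>+x. indicator (ball z 1) x * ennreal (exp (- norm (y - x))) \<partial>lborel)" (is "_ = _ * ?I")
    by (rule nn_integral_cmult) measurable
  finally have "ennreal (1 / v) * (ennreal (exp (- norm (z - y))) * ennreal v) \<le> ennreal (1 / v) * (ennreal (exp 1) * ?I)"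
    by (rule mult_left_mono) simp
  moreover have "ennreal (1 / v) * (ennreal (exp (- norm (z - y))) * ennreal v) = ennreal (exp (- norm (z - y)))"
    using v by (simp add: ennreal_mult'[symmetric])
  moreover have "ennreal (1 / v) * (ennreal (exp 1) * ?I) = ennreal (exp 1 / v) * ?I"
    using v by (simp add: mult.assoc[symmetric] ennreal_mult'[symmetric])
  ultimately show ?thesis by (simp add: v_def)
qed

lemma bounded_op_test_fun_bound:
  fixes u :: "complex ^ 'n::finite \<Rightarrow> complex"
  assumes \<alpha>: "\<alpha> > 0" and r: "r \<ge> 1"
    and T: "bounded_op_fs m \<alpha> (ennreal r) q T"
  shows "\<exists>B\<ge>0. \<forall>w :: complex ^ 'n. fs_norm m \<alpha> q (T (test_fun m \<alpha> w)) \<le> ennreal B"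
proof -
  obtain C0 where C0: "\<And>f :: complex ^ 'n \<Rightarrow> complex. f \<in> fock_sobolev m \<alpha> (ennreal r) \<Longrightarrow> fs_norm m \<alpha> q (T f) \<le> ennreal C0 * fs_norm m \<alpha> (ennreal r) f"
    using T by (auto simp: bounded_op_def)
  obtain D where D: "D > 0" "\<And>N (w :: nat \<Rightarrow> complex ^ 'n) c. (\<And>z. (\<Sum>k<N. exp (- norm (z - w k))) \<le> 2 / (1 - exp (- 1))) \<Longrightarrow>
     fs_norm m \<alpha> (ennreal r) (\<lambda>z. \<Sum>k<N. c * test_fun m \<alpha> (w k) z) \<le> ennreal (norm c * D * real N powr (1 / r))"
    using fs_norm_test_fun_sum[OF \<alpha> r, of m, where 'n = 'n] by blast
  have ND: "fs_norm m \<alpha> (ennreal r) (test_fun m \<alpha> w) \<le> ennreal D" for w :: "complex ^ 'n"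
  proof -
    have "exp (- norm (z - w)) \<le> 2 / (1 - exp (- 1))" for z
    proof -
      have "exp (- norm (z - w)) \<le> 1" by simp
      also have "1 \<le> 2 / (1 - exp (- 1) :: real)" by (simp add: field_simps)
      finally show ?thesis .
    qed
    then show ?thesis using D(2)[where N = 1 and w = "\<lambda>_. w" and c = 1] by simp
  qed
  show ?thesis
  proof (intro exI[of _ "max C0 0 * D"] conjI allI)
    fix w :: "complex ^ 'n"
    have "fs_norm m \<alpha> q (T (test_fun m \<alpha> w)) \<le> ennreal C0 * fs_norm m \<alpha> (ennreal r) (test_fun m \<alpha> w)"
      by (rule C0[OF test_fun_in_fock_sobolev[OF \<alpha> r]])
    also have "\<dots> \<le> ennreal (max C0 0) * ennreal D"
      by (intro mult_mono ennreal_leI ND) auto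
    finally show "fs_norm m \<alpha> q (T (test_fun m \<alpha> w)) \<le> ennreal (max C0 0 * D)"
      using D by (simp add: ennreal_mult'[symmetric])
  qed (use D in simp)
qed

text \<open>
Evaluate the image of the normalised kernel centred at \<open>\<psi> z\<close> at the point \<open>z\<close>, where the Gaussian is \<open>1\<close>.
\<close>

lemma pull_weight_le_test_fun:
  fixes u :: "complex ^ 'n::finite \<Rightarrow> complex"
  shows "ennreal (pull_weight m \<alpha> u \<psi> z) \<le> fs_norm m \<alpha> \<infinity> (weighted_comp u \<psi> (test_fun m \<alpha> (\<psi> z)))"
proof -
  have "wmod m \<alpha> (weighted_comp u \<psi> (test_fun m \<alpha> (\<psi> z))) z = pull_weight m \<alpha> u \<psi> z"
    unfolding wmod_weighted_comp Wmod_test_fun by (simp add: add_nonneg_eq_0_iff)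
  then show ?thesis unfolding fs_norm_infinite by (metis SUP_upper UNIV_I)
qed

lemma limsup_along_le_test_fun:
  fixes u :: "complex ^ 'n::finite \<Rightarrow> complex"
  assumes "\<And>w. R \<le> norm w \<Longrightarrow> fs_norm m \<alpha> \<infinity> (weighted_comp u \<psi> (test_fun m \<alpha> w)) \<le> ennreal B"
  shows "limsup_along \<psi> (berezin_inf m \<alpha> u \<psi>) \<le> ennreal B"
  unfolding limsup_along_eq_Inf
proof (rule INF_lower2[of R])
  show "(SUP w\<in>{w. R \<le> norm (\<psi> w)}. berezin_inf m \<alpha> u \<psi> w) \<le> ennreal B"
  proof (rule SUP_least)
    fix z assume "z \<in> {z. R \<le> norm (\<psi> z)}"
    then have "R \<le> norm (\<psi> z)" by simp
    from order_trans[OF pull_weight_le_test_fun assms[OF this]]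
    show "berezin_inf m \<alpha> u \<psi> z \<le> ennreal B" by (simp only: berezin_inf_eq)
  qed
qed simp

text \<open>
The Gaussian centred at \<open>w\<close> is dominated by a mean over \<open>y\<close>, concentrated near \<open>w\<close>, of the profiles of the
normalised kernels, because such a profile is bounded below on the unit ball around its centre.
\<close>

lemma gauss_le_test_fun_mean:
  fixes s \<alpha> :: real
  assumes \<alpha>: "\<alpha> > 0" and s: "s \<ge> 1"
  shows "\<exists>C>0. \<forall>z w :: complex ^ 'n::finite. ennreal (exp (- (\<alpha> * s / 2) * (norm (z - w))\<^sup>2)) \<le>
     ennreal C * exp_avg (\<lambda>y. Wmod m \<alpha> (test_fun m \<alpha> y) z powr s) w"
proof -
  obtain H where H: "H > 0" "\<And>t. t \<ge> 0 \<Longrightarrow> exp (- (\<alpha> * s / 2) * t\<^sup>2) \<le> H * exp (- t)"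
    using exp_quadratic_bound[of "\<alpha> * s / 2" 0 0] \<alpha> s by auto
  define v where "v = exp 1 / measure lborel (ball (0 :: complex ^ 'n) 1)"
  have v: "v > 0" unfolding v_def using content_ball_pos[of 1 "0 :: complex ^ 'n"] by simp
  define d where "d = (2 ^ m * exp (\<alpha> / 2)) powr s"
  have d: "d > 0" by (simp add: d_def)
  show ?thesis
  proof (intro exI[of _ "H * v * d"] conjI allI)
    show "H * v * d > 0" using H v d by simp
    fix z w :: "complex ^ 'n"
    have lower: "1 \<le> d * Wmod m \<alpha> (test_fun m \<alpha> y) z powr s" if y: "y \<in> ball z 1" for y
    proof -
      have n: "norm (z - y) < 1" using y by (simp add: dist_norm)
      have "norm y \<le> norm z + norm (z - y)"
        using norm_triangle_sub[of y z] by (simp only: norm_minus_commute)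
      then have "norm y \<le> norm z + 1" using n by simp
      from add_mono[OF add_left_mono[OF this, of 1] norm_ge_zero[of z]]
      have "1 + norm y \<le> 2 * (1 + norm z)" by (simp add: add_ac)
      then have "1 / 2 \<le> (1 + norm z) / (1 + norm y)"
        using add_pos_nonneg[OF zero_less_one norm_ge_zero[of y]] by (simp add: pos_le_divide_eq)
      then have "(1 / 2) ^ m \<le> ((1 + norm z) / (1 + norm y)) ^ m" by (intro power_mono) auto
      moreover have "exp (- (\<alpha> / 2)) \<le> exp (- (\<alpha> / 2) * (norm (z - y))\<^sup>2)"
      proof -
        have "(norm (z - y))\<^sup>2 \<le> 1" using n by (simp add: power_le_one)
        then show ?thesis using \<alpha> by (simp add: mult_left_le)
      qed
      ultimately have "(1 / 2) ^ m * exp (- (\<alpha> / 2)) \<le> Wmod m \<alpha> (test_fun m \<alpha> y) z"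
        unfolding Wmod_test_fun by (intro mult_mono) auto
      then have "(2 ^ m * exp (\<alpha> / 2)) * ((1 / 2) ^ m * exp (- (\<alpha> / 2))) \<le> (2 ^ m * exp (\<alpha> / 2)) * Wmod m \<alpha> (test_fun m \<alpha> y) z"
        by (rule mult_left_mono) simp
      then have "1 \<le> (2 ^ m * exp (\<alpha> / 2)) * Wmod m \<alpha> (test_fun m \<alpha> y) z"
        by (simp add: exp_minus power_divide)
      then have "1 \<le> ((2 ^ m * exp (\<alpha> / 2)) * Wmod m \<alpha> (test_fun m \<alpha> y) z) powr s"
        using s by (intro ge_one_powr_ge_zero) auto
      also have "\<dots> = d * Wmod m \<alpha> (test_fun m \<alpha> y) z powr s" by (simp add: d_def powr_mult)
      finally show ?thesis .
    qed
    have "ennreal (exp (- (\<alpha> * s / 2) * (norm (z - w))\<^sup>2)) \<le> ennreal (H * exp (- norm (z - w)))"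
      by (intro ennreal_leI H) simp
    also have "\<dots> \<le> ennreal H * (ennreal v * (\<integral>\<^sup>+y. indicator (ball z 1) y * ennreal (exp (- norm (w - y))) \<partial>lborel))"
      using H by (simp add: ennreal_mult' v_def exp_norm_le_ball_mean mult_left_mono)
    also have "\<dots> \<le> ennreal H * (ennreal v * (\<integral>\<^sup>+y. ennreal d * ennreal (exp (- norm (w - y)) * Wmod m \<alpha> (test_fun m \<alpha> y) z powr s) \<partial>lborel))"
    proof (intro mult_left_mono nn_integral_mono)
      fix y
      show "indicator (ball z 1) y * ennreal (exp (- norm (w - y))) \<le> ennreal d * ennreal (exp (- norm (w - y)) * Wmod m \<alpha> (test_fun m \<alpha> y) z powr s)"
      proof (cases "y \<in> ball z 1")
        case True
        have "exp (- norm (w - y)) * 1 \<le> exp (- norm (w - y)) * (d * Wmod m \<alpha> (test_fun m \<alpha> y) z powr s)"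
          by (intro mult_left_mono lower True) simp
        then show ?thesis using True d by (simp add: ennreal_mult'[symmetric] ennreal_leI mult_ac)
      qed simp
    qed auto
    also have "\<dots> = ennreal (H * v * d) * exp_avg (\<lambda>y. Wmod m \<alpha> (test_fun m \<alpha> y) z powr s) w"
      unfolding Wmod_test_fun using H v d by (subst nn_integral_cmult) (auto simp: mult.assoc[symmetric] ennreal_mult'[symmetric])
    finally show "ennreal (exp (- (\<alpha> * s / 2) * (norm (z - w))\<^sup>2)) \<le>
     ennreal (H * v * d) * exp_avg (\<lambda>y. Wmod m \<alpha> (test_fun m \<alpha> y) z powr s) w" .
  qed
qed

text \<open>
Integrating the previous estimate gives \<open>B(w) \<le> C \<integral> e\<^bsup>-|w-y|\<^esup> N(y) dy\<close>, where \<open>N(y)\<close> is the \<open>s\<close>-th power of the norm of the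
image of the normalised kernel at \<open>y\<close>, up to a constant. For large \<open>|w|\<close> the mass of \<open>e\<^bsup>-|w-y|\<^esup>\<close> lies outside a given
ball, and the bounded values of \<open>N\<close> inside that ball do not matter.
\<close>

lemma berezin_le_test_fun:
  fixes s \<alpha> :: real
  assumes \<alpha>: "\<alpha> > 0" and s: "s \<ge> 1"
  shows "\<exists>C>0. \<forall>(u :: complex ^ 'n::finite \<Rightarrow> complex) \<psi> R B B0. entire_fun u \<longrightarrow> entire_map \<psi> \<longrightarrow> B > 0 \<longrightarrow>
    (\<forall>w. R \<le> norm w \<longrightarrow> fs_norm m \<alpha> (ennreal s) (weighted_comp u \<psi> (test_fun m \<alpha> w)) \<le> ennreal B) \<longrightarrow>
    (\<forall>w. fs_norm m \<alpha> (ennreal s) (weighted_comp u \<psi> (test_fun m \<alpha> w)) \<le> ennreal B0) \<longrightarrow>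
    epowr (Limsup at_infinity (berezin m \<alpha> s u \<psi>)) (1 / s) \<le> ennreal (C * B)"
proof -
  obtain C1 where C1: "C1 > 0" "\<And>z w :: complex ^ 'n. ennreal (exp (- (\<alpha> * s / 2) * (norm (z - w))\<^sup>2)) \<le>
     ennreal C1 * exp_avg (\<lambda>y. Wmod m \<alpha> (test_fun m \<alpha> y) z powr s) w"
    using gauss_le_test_fun_mean[OF \<alpha> s, of m, where 'n = 'n] by blast
  define c where "c = fs_const m \<alpha> s CARD('n)"
  have c: "c > 0" unfolding c_def by (rule fs_const_pos) (use \<alpha> s in auto)
  define k where "k = exp_mass TYPE('n)"
  have k: "k > 0" unfolding k_def by (rule exp_mass_pos)
  define C where "C = (2 * C1 * k / c) powr (1 / s)"
  have C: "C > 0" using C1 c k by (simp add: C_def)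
  show ?thesis
  proof (rule exI[of _ C], intro conjI allI impI C)
    fix u :: "complex ^ 'n \<Rightarrow> complex" and \<psi> and R B B0 :: real
    assume u: "entire_fun u" and \<psi>: "entire_map \<psi>" and B: "B > 0"
      and bR: "\<forall>w. R \<le> norm w \<longrightarrow> fs_norm m \<alpha> (ennreal s) (weighted_comp u \<psi> (test_fun m \<alpha> w)) \<le> ennreal B"
      and b0: "\<forall>w. fs_norm m \<alpha> (ennreal s) (weighted_comp u \<psi> (test_fun m \<alpha> w)) \<le> ennreal B0"
    note [measurable] = entire_fun_measurable[OF u] entire_map_measurable[OF \<psi>]
    note [measurable] = pull_weight_measurable[OF entire_fun_measurable[OF u] entire_map_measurable[OF \<psi>], of m \<alpha>]
    let ?W = "pull_weight m \<alpha> u \<psi>"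
    define N where "N y = energy m \<alpha> s (weighted_comp u \<psi> (test_fun m \<alpha> y))" for y
    have N_le: "N y \<le> ennreal (b powr s / c)" if "fs_norm m \<alpha> (ennreal s) (weighted_comp u \<psi> (test_fun m \<alpha> y)) \<le> ennreal b" "b \<ge> 0" for y b
    proof -
      have "ennreal c * N y \<le> ennreal (b powr s)"
        using that s unfolding N_def c_def by (subst (asm) fs_norm_le_iff) auto
      then have "ennreal (1 / c) * (ennreal c * N y) \<le> ennreal (1 / c) * ennreal (b powr s)"
        by (rule mult_left_mono) simp
      then show ?thesis using c by (simp add: mult.assoc[symmetric] ennreal_mult'[symmetric])
    qed
    define L where "L = B powr s / c"
    define L0 where "L0 = (max B0 0) powr s / c"
    have L: "L > 0" and L0: "L0 \<ge> 0" using B c by (auto simp: L_def L0_def)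
    have NL: "N y \<le> ennreal L" if "R \<le> norm y" for y
      unfolding L_def by (rule N_le) (use bR that B in auto)
    have NL0: "N y \<le> ennreal L0" for y
      unfolding L0_def by (rule N_le) (use b0 order_trans[OF _ ennreal_leI[of B0 "max B0 0"]] in auto)
    define V where "V = measure lborel (ball (0 :: complex ^ 'n) R)"
    have V: "V \<ge> 0" by (simp add: V_def)
    have bz: "berezin m \<alpha> s u \<psi> w \<le> ennreal (C1 * (L * k + L0 * (exp (R - norm w) * V)))" for w
    proof -
      have "berezin m \<alpha> s u \<psi> w = (\<integral>\<^sup>+z. ennreal (?W z powr s) * ennreal (exp (- (\<alpha> * s / 2) * (norm (\<psi> z - w))\<^sup>2)) \<partial>lborel)"
        by (simp add: berezin_eq ennreal_mult')
      also have "\<dots> \<le> (\<integral>\<^sup>+z. ennreal (?W z powr s) * (ennreal C1 * exp_avg (\<lambda>y. Wmod m \<alpha> (test_fun m \<alpha> y) (\<psi> z) powr s) w) \<partial>lborel)"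
        by (intro nn_integral_mono mult_left_mono C1(2)) simp
      also have "\<dots> = (\<integral>\<^sup>+z. ennreal C1 * (\<integral>\<^sup>+y. ennreal (exp (- norm (w - y))) * ennreal ((?W z * Wmod m \<alpha> (test_fun m \<alpha> y) (\<psi> z)) powr s) \<partial>lborel) \<partial>lborel)"
      proof (rule nn_integral_cong)
        fix z
        have "ennreal (?W z powr s) * exp_avg (\<lambda>y. Wmod m \<alpha> (test_fun m \<alpha> y) (\<psi> z) powr s) w
          = (\<integral>\<^sup>+y. ennreal (?W z powr s) * ennreal (exp (- norm (w - y)) * Wmod m \<alpha> (test_fun m \<alpha> y) (\<psi> z) powr s) \<partial>lborel)"
          unfolding Wmod_test_fun by (subst nn_integral_cmult) auto
        also have "\<dots> = (\<integral>\<^sup>+y. ennreal (exp (- norm (w - y))) * ennreal ((?W z * Wmod m \<alpha> (test_fun m \<alpha> y) (\<psi> z)) powr s) \<partial>lborel)"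
          by (intro nn_integral_cong) (simp add: ennreal_mult'[symmetric] powr_mult mult_ac)
        finally show "ennreal (?W z powr s) * (ennreal C1 * exp_avg (\<lambda>y. Wmod m \<alpha> (test_fun m \<alpha> y) (\<psi> z) powr s) w)
         = ennreal C1 * (\<integral>\<^sup>+y. ennreal (exp (- norm (w - y))) * ennreal ((?W z * Wmod m \<alpha> (test_fun m \<alpha> y) (\<psi> z)) powr s) \<partial>lborel)"
          by (simp add: mult.left_commute)
      qed
      also have "\<dots> = ennreal C1 * (\<integral>\<^sup>+z. \<integral>\<^sup>+y. ennreal (exp (- norm (w - y))) * ennreal ((?W z * Wmod m \<alpha> (test_fun m \<alpha> y) (\<psi> z)) powr s) \<partial>lborel \<partial>lborel)"
        unfolding Wmod_test_fun by (rule nn_integral_cmult) measurable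
      also have "(\<integral>\<^sup>+z. \<integral>\<^sup>+y. ennreal (exp (- norm (w - y))) * ennreal ((?W z * Wmod m \<alpha> (test_fun m \<alpha> y) (\<psi> z)) powr s) \<partial>lborel \<partial>lborel)
        = (\<integral>\<^sup>+y. \<integral>\<^sup>+z. ennreal (exp (- norm (w - y))) * ennreal ((?W z * Wmod m \<alpha> (test_fun m \<alpha> y) (\<psi> z)) powr s) \<partial>lborel \<partial>lborel)"
        unfolding Wmod_test_fun by (rule lborel_pair.Fubini') measurable
      also have "\<dots> = (\<integral>\<^sup>+y. ennreal (exp (- norm (w - y))) * N y \<partial>lborel)"
        unfolding N_def wmod_weighted_comp Wmod_test_fun by (subst nn_integral_cmult) auto
      also have "\<dots> \<le> (\<integral>\<^sup>+y. ennreal L * ennreal (exp (- norm (w - y))) + ennreal (L0 * exp (R - norm w)) * indicator (ball 0 R) y \<partial>lborel)"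
      proof (rule nn_integral_mono)
        fix y
        show "ennreal (exp (- norm (w - y))) * N y \<le> ennreal L * ennreal (exp (- norm (w - y))) + ennreal (L0 * exp (R - norm w)) * indicator (ball 0 R) y"
        proof (cases "y \<in> ball 0 R")
          case True
          then have "- norm (w - y) \<le> R - norm w" using norm_triangle_sub[of w y] by simp
          then have "ennreal (exp (- norm (w - y))) * N y \<le> ennreal (exp (R - norm w)) * ennreal L0"
            by (intro mult_mono ennreal_leI NL0) auto
          then show ?thesis using True L0 by (simp add: ennreal_mult'[symmetric] mult.commute add_increasing)
        next
          case False
          then have "ennreal (exp (- norm (w - y))) * N y \<le> ennreal (exp (- norm (w - y))) * ennreal L"
            by (intro mult_left_mono NL) auto
          then show ?thesis using False by (simp add: mult.commute)
        qed
      qed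
      also have "\<dots> = ennreal L * ennreal k + ennreal (L0 * exp (R - norm w)) * ennreal V"
      proof -
        have [measurable]: "ball (0 :: complex ^ 'n) R \<in> sets borel" by simp
        have "emeasure lborel (ball (0 :: complex ^ 'n) R) < \<infinity>" by (rule emeasure_bounded_finite) simp
        then have "emeasure lborel (ball (0 :: complex ^ 'n) R) = ennreal V"
          by (simp add: V_def emeasure_eq_ennreal_measure)
        then show ?thesis
          by (subst nn_integral_add) (auto simp: nn_integral_cmult nn_integral_cmult_indicator exp_mass_translate k_def)
      qed
      also have "\<dots> = ennreal (L * k + L0 * (exp (R - norm w) * V))"
        using L k L0 V by (simp add: ennreal_mult'[symmetric] ennreal_plus[symmetric] mult.assoc del: ennreal_plus)
      finally show ?thesis using C1(1) by (simp add: ennreal_mult' mult_left_mono)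
    qed
    have "\<forall>\<^sub>F w in at_infinity. berezin m \<alpha> s u \<psi> w \<le> ennreal (2 * C1 * k * L)"
      unfolding eventually_at_infinity
    \<comment> \<open>beyond this radius the contribution of the ball of radius \<open>R\<close> is at most \<open>L k\<close>\<close>
    proof (intro exI[of _ "R - ln (L * k / (L0 * V + 1))"] allI impI)
      fix w :: "complex ^ 'n" assume "R - ln (L * k / (L0 * V + 1)) \<le> norm w"
      then have "exp (R - norm w) \<le> exp (ln (L * k / (L0 * V + 1)))" by simp
      also have "\<dots> = L * k / (L0 * V + 1)" using L k L0 V by (intro exp_ln divide_pos_pos) (auto intro: add_nonneg_pos)
      finally have "L0 * V * exp (R - norm w) \<le> L0 * V * (L * k / (L0 * V + 1))"
        using L0 V by (intro mult_left_mono) auto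
      also have "\<dots> = L0 * V / (L0 * V + 1) * (L * k)" by simp
      also have "\<dots> \<le> 1 * (L * k)" using L k L0 V add_nonneg_pos[of "L0 * V" 1] by (intro mult_right_mono) (auto simp: divide_le_eq_1)
      also have "\<dots> = L * k" by simp
      finally have "C1 * (L * k + L0 * (exp (R - norm w) * V)) \<le> C1 * (2 * (k * L))"
        using C1(1) by (intro mult_left_mono) (auto simp: mult_ac)
      then show "berezin m \<alpha> s u \<psi> w \<le> ennreal (2 * C1 * k * L)"
        by (intro order_trans[OF bz] ennreal_leI) (simp add: mult_ac)
    qed
    then have "Limsup at_infinity (berezin m \<alpha> s u \<psi>) \<le> ennreal (2 * C1 * k * L)"
      by (rule Limsup_bounded)
    also have "2 * C1 * k * L = (C * B) powr s"
      using C1 k c B s by (simp add: C_def L_def powr_mult powr_powr)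
    finally show "epowr (Limsup at_infinity (berezin m \<alpha> s u \<psi>)) (1 / s) \<le> ennreal (C * B)"
      using s C B by (subst epowr_le_iff) auto
  qed
qed

section \<open>Finite rank approximations of the operator\<close>

text \<open>
Reduces an inequality for a possibly infinite \<open>L\<close> to real upper bounds \<open>y > 0\<close> of it, including the case \<open>L = 0\<close>.
\<close>

lemma ennreal_le_mult_limit:
  assumes C: "C > 0" and le: "\<And>y. y > 0 \<Longrightarrow> L < ennreal y \<Longrightarrow> U \<le> ennreal (C * y)"
  shows "U \<le> ennreal C * L"
proof (cases L)
  case (real x)
  show ?thesis
  proof (rule ennreal_le_epsilon)
    fix e :: real assume e: "e > 0"
    have "U \<le> ennreal (C * (x + e / C))"
      using real C e by (intro le) (auto simp: ennreal_less_iff add_nonneg_pos)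
    also have "C * (x + e / C) = C * x + e" using C by (simp add: distrib_left)
    also have "ennreal (C * x + e) = ennreal C * L + ennreal e"
      using real C e by (simp add: ennreal_mult'[symmetric])
    finally show "U \<le> ennreal C * L + ennreal e" .
  qed
next
  case top
  then show ?thesis using C by (simp add: ennreal_mult_top)
qed

lemma unit_ball_integral_le:
  fixes f :: "complex ^ 'n::finite \<Rightarrow> complex"
  assumes \<alpha>: "\<alpha> > 0" and r: "r \<ge> 1" and f: "fs_norm m \<alpha> (ennreal r) f \<le> 1"
  shows "energy m \<alpha> r f \<le> ennreal (1 / fs_const m \<alpha> r CARD('n))"
proof -
  define c where "c = fs_const m \<alpha> r CARD('n)"
  have c: "c > 0" unfolding c_def by (rule fs_const_pos) (use \<alpha> r in auto)
  have "ennreal c * energy m \<alpha> r f \<le> ennreal 1"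
    using fs_norm_le_iff[of r 1 m \<alpha> f] f r by (simp add: c_def)
  then have "ennreal (1 / c) * (ennreal c * energy m \<alpha> r f) \<le> ennreal (1 / c) * ennreal 1"
    by (rule mult_left_mono) simp
  then show ?thesis using c by (simp add: c_def[symmetric] mult.assoc[symmetric] ennreal_mult'[symmetric])
qed

lemma unit_ball_growth:
  fixes r M :: real
  assumes r: "r \<ge> 1" and M: "M > 0"
  shows "\<exists>A>0. \<forall>f :: complex ^ 'n::finite \<Rightarrow> complex. entire_fun f \<longrightarrow>
    (energy m \<alpha> r f) \<le> ennreal M \<longrightarrow> (\<forall>z. Wmod m \<alpha> f z \<le> A)"
proof -
  obtain C where C: "C > 0" "\<And>(f :: complex ^ 'n \<Rightarrow> complex) z. entire_fun f \<Longrightarrow>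
    ennreal (Wmod m \<alpha> f z) \<le> ennreal C * exp_avg (wmod m \<alpha> f) z"
    using pointwise_le_exp_mean[of m \<alpha>] by blast
  show ?thesis
  proof (rule exI[of _ "(C powr r * exp_mass TYPE('n) powr (r - 1) * M) powr (1 / r)"], intro conjI allI impI)
    show "(C powr r * exp_mass TYPE('n) powr (r - 1) * M) powr (1 / r) > 0"
      using C(1) M exp_mass_pos[where 'n = 'n] by simp
    fix f :: "complex ^ 'n \<Rightarrow> complex" and z
    assume f: "entire_fun f" and I: "energy m \<alpha> r f \<le> ennreal M"
    show "Wmod m \<alpha> f z \<le> (C powr r * exp_mass TYPE('n) powr (r - 1) * M) powr (1 / r)"
      by (rule bound_of_exp_mean[OF f r _ C(1) C(2)[OF f, of z] I]) (use M in simp_all)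
  qed
qed

lemma kernel_sum_lincomb:
  "(\<lambda>z. a * kernel_sum \<alpha> N w x z + c * kernel_sum \<alpha> N w y z) = kernel_sum \<alpha> N w (\<lambda>i. a * x i + c * y i)"
  by (simp add: kernel_sum_def fun_eq_iff sum_distrib_left sum.distrib[symmetric] algebra_simps)

lemma kernel_sum_norm_le:
  fixes w :: "nat \<Rightarrow> complex ^ 'n::finite"
  assumes \<alpha>: "\<alpha> > 0" and r: "r \<ge> 1"
  shows "\<exists>E. (\<forall>i. 0 \<le> E i) \<and> (\<forall>x. fs_norm m \<alpha> (ennreal r) (kernel_sum \<alpha> N w x) \<le> ennreal (\<Sum>i<N. norm (x i) * E i))"
proof -
  have good: "ennreal r = \<infinity> \<or> (\<exists>s\<ge>1. ennreal r = ennreal s)" using r by auto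
  define e where "e i z = exp (of_real \<alpha> * cinner z (w i))" for i z
  define E where "E i = enn2real (fs_norm m \<alpha> (ennreal r) (e i))" for i
  have [measurable]: "e i \<in> borel_measurable borel" for i
    unfolding e_def by (rule entire_fun_measurable[OF entire_fun_exp_cinner])
  have fin: "fs_norm m \<alpha> (ennreal r) (e i) = ennreal (E i)" for i
  proof -
    have ei: "e i = kernel_sum \<alpha> 1 (\<lambda>_. w i) (\<lambda>_. 1)" by (simp add: e_def[abs_def] kernel_sum_def[abs_def])
    obtain D where D: "D \<ge> 0" "\<And>z. Wmod m \<alpha> (e i) z \<le> D * exp (- norm z)"
      using kernel_sum_decay[OF \<alpha>, of m 1 "\<lambda>_. w i" "\<lambda>_. 1"] unfolding ei by blast
    have "energy m \<alpha> r (e i) \<le> ennreal (D powr r * exp_mass TYPE('n))"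
    proof (rule nn_integral_decay_finite[OF r, where a = 0])
      show "wmod m \<alpha> (e i) z \<le> D * exp (- norm (z - 0))" for z
        using order_trans[OF wmod_le_Wmod D(2)] by simp
    qed (use D in simp_all)
    then have "energy m \<alpha> r (e i) < \<infinity>"
      by (rule le_less_trans) simp
    then have "fs_norm m \<alpha> (ennreal r) (e i) \<noteq> \<infinity>"
      using r by (simp add: fs_norm_finite epowr_eq_top_iff[unfolded infinity_ennreal_def] ennreal_mult_eq_top_iff)
    then show ?thesis by (simp add: E_def less_top)
  qed
  have "fs_norm m \<alpha> (ennreal r) (kernel_sum \<alpha> N w x) \<le> ennreal (\<Sum>i<N. norm (x i) * E i)" for x
  proof -
    have "fs_norm m \<alpha> (ennreal r) (\<lambda>z. \<Sum>i<N. x i * e i z) \<le> (\<Sum>i<N. fs_norm m \<alpha> (ennreal r) (\<lambda>z. x i * e i z))"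
      by (rule fs_norm_sum[OF good \<alpha>]) measurable
    also have "\<dots> = (\<Sum>i<N. ennreal (norm (x i) * E i))"
      by (intro sum.cong refl) (simp add: fs_norm_scale[OF good] fin ennreal_mult')
    also have "\<dots> = ennreal (\<Sum>i<N. norm (x i) * E i)"
      by (rule sum_ennreal) (simp add: E_def)
    finally show ?thesis by (simp add: kernel_sum_def[abs_def] e_def)
  qed
  then show ?thesis by (intro exI[of _ E]) (simp add: E_def)
qed

lemma simultaneous_convergent_subsequence:
  fixes a :: "nat \<Rightarrow> nat \<Rightarrow> complex"
  assumes "\<And>i. bounded (range (\<lambda>k. a k i))"
  shows "\<exists>s l. strict_mono (s :: nat \<Rightarrow> nat) \<and> (\<forall>i<N. (\<lambda>k. a (s k) i) \<longlonglongrightarrow> l i)"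
proof (induction N)
  case 0
  show ?case by (intro exI[of _ id]) (simp add: strict_mono_def)
next
  case (Suc N)
  then obtain s l where s: "strict_mono (s :: nat \<Rightarrow> nat)" "\<And>i. i < N \<Longrightarrow> (\<lambda>k. a (s k) i) \<longlonglongrightarrow> l i" by blast
  have "bounded (range (\<lambda>k. a (s k) N))"
    by (rule bounded_subset[OF assms[of N]]) auto
  then obtain l' t where t: "strict_mono (t :: nat \<Rightarrow> nat)" "((\<lambda>k. a (s k) N) \<circ> t) \<longlonglongrightarrow> l'"
    using bounded_imp_convergent_subsequence by metis
  have "(\<lambda>k. a ((s \<circ> t) k) i) \<longlonglongrightarrow> (l(N := l')) i" if "i < Suc N" for i
  proof (cases "i = N")
    case True
    then show ?thesis using t(2) by (simp add: o_def)
  next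
    case False
    then have "i < N" using that by simp
    from LIMSEQ_subseq_LIMSEQ[OF s(2)[OF this] t(1)] show ?thesis using False by (simp add: o_def)
  qed
  then show ?case
    using strict_mono_o[OF s(1) t(1)] by blast
qed

text \<open>
Point evaluations are bounded on the unit ball, so by Bolzano--Weierstrass a subsequence converges at the
finitely many nodes. The images depend continuously on the values at the nodes.
\<close>

lemma compact_op_finite_rank:
  fixes w :: "nat \<Rightarrow> complex ^ 'n::finite"
  assumes \<alpha>: "\<alpha> > 0" and r: "r \<ge> 1"
    and T: "bounded_op (fock_sobolev m \<alpha> (ennreal r)) (fs_norm m \<alpha> (ennreal r)) Y M T"
  shows "compact_op (fock_sobolev m \<alpha> (ennreal r)) (fs_norm m \<alpha> (ennreal r)) Y M
     (\<lambda>f. T (kernel_sum \<alpha> N w (\<lambda>i. b i * f (w i))))"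
  unfolding compact_op_def
proof (intro conjI allI impI)
  let ?X = "fock_sobolev m \<alpha> (ennreal r) :: (complex ^ 'n \<Rightarrow> complex) set"
  have lin: "linear_op ?X Y T" using T by (simp add: bounded_op_def)
  have ksX: "kernel_sum \<alpha> N w x \<in> ?X" for x by (rule kernel_sum_in_fock_sobolev[OF \<alpha> r])
  have TY: "T (kernel_sum \<alpha> N w x) \<in> Y" for x by (rule subsetD[OF lin[unfolded linear_op_def, THEN conjunct1] imageI[OF ksX]])
  show "linear_op ?X Y (\<lambda>f. T (kernel_sum \<alpha> N w (\<lambda>i. b i * f (w i))))"
    unfolding linear_op_def
  proof (intro conjI ballI allI)
    show "(\<lambda>f. T (kernel_sum \<alpha> N w (\<lambda>i. b i * f (w i)))) ` ?X \<subseteq> Y" using TY by auto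
    fix f g :: "complex ^ 'n \<Rightarrow> complex" and x y
    have "kernel_sum \<alpha> N w (\<lambda>i. b i * (x * f (w i) + y * g (w i))) = 
      (\<lambda>z. x * kernel_sum \<alpha> N w (\<lambda>i. b i * f (w i)) z + y * kernel_sum \<alpha> N w (\<lambda>i. b i * g (w i)) z)"
      unfolding kernel_sum_lincomb by (simp add: algebra_simps)
    then show "T (kernel_sum \<alpha> N w (\<lambda>i. b i * (x * f (w i) + y * g (w i)))) = 
      (\<lambda>z. x * T (kernel_sum \<alpha> N w (\<lambda>i. b i * f (w i))) z + y * T (kernel_sum \<alpha> N w (\<lambda>i. b i * g (w i))) z)"
      using linear_op_comb[OF lin ksX ksX] by simp
  qed
  fix f :: "nat \<Rightarrow> complex ^ 'n \<Rightarrow> complex"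
  assume f: "\<forall>k. f k \<in> ?X \<and> fs_norm m \<alpha> (ennreal r) (f k) \<le> 1"
  have c: "1 / fs_const m \<alpha> r CARD('n) > 0" using fs_const_pos[of \<alpha> r "CARD('n)" m] \<alpha> r by simp
  obtain A where A: "A > 0" "\<forall>f :: complex ^ 'n \<Rightarrow> complex. entire_fun f \<longrightarrow>
    (energy m \<alpha> r f) \<le> ennreal (1 / fs_const m \<alpha> r CARD('n)) \<longrightarrow> (\<forall>z. Wmod m \<alpha> f z \<le> A)"
    using unit_ball_growth[OF r c, of m \<alpha>, where 'n = 'n] by (elim exE conjE) (rule that)
  have bd: "bounded (range (\<lambda>k. f k (w i)))" for i
  proof (rule boundedI)
    fix x assume "x \<in> range (\<lambda>k. f k (w i))"
    then obtain k where k: "x = f k (w i)" by auto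
    have "1 * (norm (f k (w i)) * exp (- (\<alpha> / 2) * (norm (w i))\<^sup>2)) \<le> Wmod m \<alpha> (f k) (w i)"
      unfolding Wmod_def by (intro mult_right_mono one_le_power) auto
    also have "\<dots> \<le> A"
    proof -
      have "entire_fun (f k)" "fs_norm m \<alpha> (ennreal r) (f k) \<le> 1"
        using f[THEN spec, of k] by (simp_all add: fock_sobolev_def)
      from A(2)[rule_format, OF this(1) unit_ball_integral_le[OF \<alpha> r this(2)]] show ?thesis .
    qed
    finally show "norm x \<le> A * exp (\<alpha> / 2 * (norm (w i))\<^sup>2)"
      unfolding k by (simp add: exp_minus field_simps)
  qed
  obtain s l where s: "strict_mono (s :: nat \<Rightarrow> nat)" "\<forall>i<N. (\<lambda>k. f (s k) (w i)) \<longlonglongrightarrow> l i"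
    using simultaneous_convergent_subsequence[of "\<lambda>k i. f k (w i)" N, OF bd] by (elim exE conjE) (rule that)
  obtain C0 where C0: "\<forall>f\<in>?X. M (T f) \<le> ennreal C0 * fs_norm m \<alpha> (ennreal r) f"
    using T[unfolded bounded_op_def, THEN conjunct2] by (elim exE) (rule that)
  obtain E where E: "\<forall>i. 0 \<le> E i" "\<forall>x. fs_norm m \<alpha> (ennreal r) (kernel_sum \<alpha> N w x) \<le> ennreal (\<Sum>i<N. norm (x i) * E i)"
    using kernel_sum_norm_le[OF \<alpha> r, of m N w] by (elim exE conjE) (rule that)
  let ?g = "T (kernel_sum \<alpha> N w (\<lambda>i. b i * l i))"
  define h where "h k = max C0 0 * (\<Sum>i<N. norm (b i * f (s k) (w i) - b i * l i) * E i)" for k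
  have le: "M (\<lambda>z. T (kernel_sum \<alpha> N w (\<lambda>i. b i * f (s k) (w i))) z - ?g z) \<le> ennreal (h k)" for k
  proof -
    have "kernel_sum \<alpha> N w (\<lambda>i. b i * f (s k) (w i) - b i * l i) = 
        (\<lambda>z. 1 * kernel_sum \<alpha> N w (\<lambda>i. b i * f (s k) (w i)) z + (- 1) * kernel_sum \<alpha> N w (\<lambda>i. b i * l i) z)"
      unfolding kernel_sum_lincomb by simp
    then have "T (kernel_sum \<alpha> N w (\<lambda>i. b i * f (s k) (w i) - b i * l i)) =
       (\<lambda>z. 1 * T (kernel_sum \<alpha> N w (\<lambda>i. b i * f (s k) (w i))) z + (- 1) * ?g z)"
      by (simp only: linear_op_comb[OF lin ksX ksX])
    then have eq: "(\<lambda>z. T (kernel_sum \<alpha> N w (\<lambda>i. b i * f (s k) (w i))) z - ?g z) = T (kernel_sum \<alpha> N w (\<lambda>i. b i * f (s k) (w i) - b i * l i))"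
      by simp
    have "M (T (kernel_sum \<alpha> N w (\<lambda>i. b i * f (s k) (w i) - b i * l i))) \<le> ennreal (max C0 0) * ennreal (\<Sum>i<N. norm (b i * f (s k) (w i) - b i * l i) * E i)"
      by (rule order_trans[OF bspec[OF C0 ksX]]) (intro mult_mono ennreal_leI E(2)[rule_format], auto)
    then show ?thesis unfolding eq h_def by (simp add: ennreal_mult')
  qed
  have "h \<longlonglongrightarrow> max C0 0 * (\<Sum>i<N. norm (b i * l i - b i * l i) * E i)"
    unfolding h_def by (intro tendsto_mult tendsto_const tendsto_sum tendsto_norm tendsto_diff) (use s(2) in simp_all)
  then have hlim: "(\<lambda>k. ennreal (h k)) \<longlonglongrightarrow> ennreal 0"
    by (intro tendsto_ennrealI) simp
  have lim: "(\<lambda>k. M (\<lambda>z. T (kernel_sum \<alpha> N w (\<lambda>i. b i * f (s k) (w i))) z - ?g z)) \<longlonglongrightarrow> 0"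
  proof (rule tendsto_sandwich[where f = "\<lambda>_. 0" and h = "\<lambda>k. ennreal (h k)", rotated 2])
    show "(\<lambda>_. 0 :: ennreal) \<longlonglongrightarrow> 0" by (rule tendsto_const)
    show "(\<lambda>k. ennreal (h k)) \<longlonglongrightarrow> 0" using hlim by simp
  qed (use le in simp_all)
  show "\<exists>g\<in>Y. \<exists>s :: nat \<Rightarrow> nat. strict_mono s \<and> (\<lambda>k. M (\<lambda>z. T (kernel_sum \<alpha> N w (\<lambda>i. b i * f (s k) (w i))) z - g z)) \<longlonglongrightarrow> 0"
    by (rule bexI[OF _ TY], rule exI[of _ s], rule conjI[OF s(1) lim])
qed

lemma essential_norm_le:
  fixes w :: "nat \<Rightarrow> complex ^ 'n::finite"
  assumes \<alpha>: "\<alpha> > 0" and r: "r \<ge> 1"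
    and T: "bounded_op (fock_sobolev m \<alpha> (ennreal r)) (fs_norm m \<alpha> (ennreal r)) Y M (weighted_comp u \<psi>)"
    and le: "\<And>f. entire_fun f \<Longrightarrow> fs_norm m \<alpha> (ennreal r) f \<le> 1 \<Longrightarrow>
      M (weighted_comp u \<psi> (remainder \<alpha> N w b f)) \<le> B"
  shows "essential_norm (fock_sobolev m \<alpha> (ennreal r)) (fs_norm m \<alpha> (ennreal r)) Y M (weighted_comp u \<psi>) \<le> B"
  unfolding essential_norm_def
proof (rule INF_lower2)
  let ?K = "\<lambda>f. weighted_comp u \<psi> (kernel_sum \<alpha> N w (\<lambda>i. b i * f (w i)))"
  show "?K \<in> {K. compact_op (fock_sobolev m \<alpha> (ennreal r)) (fs_norm m \<alpha> (ennreal r)) Y M K}"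
    using compact_op_finite_rank[OF \<alpha> r T] by simp
  have eq: "(\<lambda>z. weighted_comp u \<psi> f z - ?K f z) = weighted_comp u \<psi> (remainder \<alpha> N w b f)" for f
    by (simp add: weighted_comp_def algebra_simps)
  show "op_norm (fock_sobolev m \<alpha> (ennreal r)) (fs_norm m \<alpha> (ennreal r)) M (\<lambda>f z. weighted_comp u \<psi> f z - ?K f z) \<le> B"
    unfolding op_norm_def eq
  proof (rule SUP_least)
    fix f :: "complex ^ 'n \<Rightarrow> complex" assume "f \<in> {f \<in> fock_sobolev m \<alpha> (ennreal r). fs_norm m \<alpha> (ennreal r) f \<le> 1}"
    then have "entire_fun f" "fs_norm m \<alpha> (ennreal r) f \<le> 1" by (simp_all add: fock_sobolev_def)
    then show "M (weighted_comp u \<psi> (remainder \<alpha> N w b f)) \<le> B" by (rule le)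
  qed
qed

section \<open>Upper bounds for the essential norm\<close>

lemma essential_norm_upper_infinite:
  fixes r :: real
  assumes \<alpha>: "\<alpha> > 0" and r: "r \<ge> 1"
  shows "\<exists>C>0. \<forall>(u :: complex ^ 'n::finite \<Rightarrow> complex) \<psi>. 
    bounded_op_fs m \<alpha> (ennreal r) \<infinity> (weighted_comp u \<psi>) \<longrightarrow>
    essential_norm_fs m \<alpha> (ennreal r) \<infinity> (weighted_comp u \<psi>)
      \<le> ennreal C * limsup_along \<psi> (berezin_inf m \<alpha> u \<psi>)"
proof -
  define I where "I = 1 / fs_const m \<alpha> r CARD('n)"
  have I: "I > 0" unfolding I_def using fs_const_pos[of \<alpha> r "CARD('n)" m] \<alpha> r by simp
  obtain C0 where C0: "C0 > 0" and approx: "\<forall>R0 \<epsilon>. \<epsilon> > 0 \<longrightarrow> (\<exists>N (w :: nat \<Rightarrow> complex ^ 'n) b. \<forall>f. entire_fun f \<longrightarrow>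
      (energy m \<alpha> r f) \<le> ennreal I \<longrightarrow>
      (\<forall>z. norm z \<le> R0 \<longrightarrow> Wmod m \<alpha> (remainder \<alpha> N w b f) z \<le> \<epsilon>) \<and>
      (\<forall>z. ennreal (Wmod m \<alpha> (remainder \<alpha> N w b f) z) \<le>
        ennreal C0 * exp_avg (wmod m \<alpha> f) z))"
    using finite_rank_approximation[OF \<alpha> r I, of m, where 'n = 'n] by (elim exE conjE) (rule that)
  define A where "A = (C0 powr r * exp_mass TYPE('n) powr (r - 1) * I) powr (1 / r)"
  have A: "A > 0" using C0 I exp_mass_pos[where 'n = 'n] by (simp add: A_def)
  show ?thesis
  proof (rule exI[of _ A], intro conjI allI impI A)
    fix u :: "complex ^ 'n \<Rightarrow> complex" and \<psi>
    assume T: "bounded_op_fs m \<alpha> (ennreal r) \<infinity> (weighted_comp u \<psi>)"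
    obtain B where B: "B \<ge> 0" "\<And>w :: complex ^ 'n. fs_norm m \<alpha> \<infinity> (weighted_comp u \<psi> (test_fun m \<alpha> w)) \<le> ennreal B"
      using bounded_op_test_fun_bound[OF \<alpha> r T] by blast
    have pwB: "pull_weight m \<alpha> u \<psi> z \<le> B" for z
      using order_trans[OF pull_weight_le_test_fun B(2)] B(1) by simp
    show "essential_norm_fs m \<alpha> (ennreal r) \<infinity> (weighted_comp u \<psi>)
      \<le> ennreal A * limsup_along \<psi> (berezin_inf m \<alpha> u \<psi>)"
    proof (rule ennreal_le_mult_limit[OF A])
      fix y assume y: "y > 0" "limsup_along \<psi> (berezin_inf m \<alpha> u \<psi>) < ennreal y"
      then obtain \<delta> where \<delta>: "(SUP w\<in>{w. \<delta> \<le> norm (\<psi> w)}. berezin_inf m \<alpha> u \<psi> w) < ennreal y"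
        unfolding limsup_along_eq_Inf by (auto simp: INF_less_iff)
      have far: "pull_weight m \<alpha> u \<psi> z \<le> y" if "\<delta> \<le> norm (\<psi> z)" for z
      proof -
        have "ennreal (pull_weight m \<alpha> u \<psi> z) \<le> (SUP w\<in>{w. \<delta> \<le> norm (\<psi> w)}. berezin_inf m \<alpha> u \<psi> w)"
          unfolding berezin_inf_eq by (rule SUP_upper) (use that in simp)
        then have "ennreal (pull_weight m \<alpha> u \<psi> z) \<le> ennreal y" using \<delta> by simp
        then show ?thesis using y by simp
      qed
      \<comment> \<open>\<open>B\<close> bounds the weight everywhere, so an error of size \<open>\<epsilon>\<close> contributes at most \<open>A y\<close> where \<open>|\<psi>| \<le> \<delta>\<close>\<close>
      define \<epsilon> where "\<epsilon> = y * A / (B + 1)"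
      have \<epsilon>: "\<epsilon> > 0" using y A B(1) by (simp add: \<epsilon>_def)
      obtain N and w :: "nat \<Rightarrow> complex ^ 'n" and b where ap: "\<forall>f. entire_fun f \<longrightarrow>
      (energy m \<alpha> r f) \<le> ennreal I \<longrightarrow>
      (\<forall>z. norm z \<le> \<delta> \<longrightarrow> Wmod m \<alpha> (remainder \<alpha> N w b f) z \<le> \<epsilon>) \<and>
      (\<forall>z. ennreal (Wmod m \<alpha> (remainder \<alpha> N w b f) z) \<le>
        ennreal C0 * exp_avg (wmod m \<alpha> f) z)"
        using approx[THEN spec, THEN spec, THEN mp, OF \<epsilon>, of \<delta>] by (elim exE) (rule that)
      show "essential_norm_fs m \<alpha> (ennreal r) \<infinity> (weighted_comp u \<psi>) \<le> ennreal (A * y)"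
      proof (rule essential_norm_le[OF \<alpha> r T])
        fix f :: "complex ^ 'n \<Rightarrow> complex" assume f: "entire_fun f" "fs_norm m \<alpha> (ennreal r) f \<le> 1"
        have fI: "energy m \<alpha> r f \<le> ennreal I"
          unfolding I_def by (rule unit_ball_integral_le[OF \<alpha> r f(2)])
        note ap' = ap[THEN spec, THEN mp, THEN mp, OF f(1) fI]
        define g where "g = (remainder \<alpha> N w b f)"
        have near: "Wmod m \<alpha> g z \<le> \<epsilon>" if "norm z \<le> \<delta>" for z
          unfolding g_def by (rule ap'[THEN conjunct1, rule_format, OF that])
        have gA: "Wmod m \<alpha> g z \<le> A" for z
        proof -
          have "ennreal (Wmod m \<alpha> g z) \<le> ennreal C0 * exp_avg (wmod m \<alpha> f) z"
            unfolding g_def by (rule ap'[THEN conjunct2, rule_format])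
          then show ?thesis
            unfolding A_def by (intro bound_of_exp_mean[OF f(1) r _ C0 _ fI]) (use I in simp_all)
        qed
        have "pull_weight m \<alpha> u \<psi> z * Wmod m \<alpha> g (\<psi> z) \<le> A * y" for z
        proof (cases "\<delta> \<le> norm (\<psi> z)")
          case True
          have "pull_weight m \<alpha> u \<psi> z * Wmod m \<alpha> g (\<psi> z) \<le> y * A"
            using far[OF True] gA y by (intro mult_mono) auto
          then show ?thesis by (simp add: mult.commute)
        next
          case False
          have "pull_weight m \<alpha> u \<psi> z * Wmod m \<alpha> g (\<psi> z) \<le> (B + 1) * \<epsilon>"
            using pwB[of z] near[of "\<psi> z"] False B(1) by (intro mult_mono) auto
          also have "\<dots> = A * y" using B(1) by (simp add: \<epsilon>_def)
          finally show ?thesis .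
        qed
        then show "fs_norm m \<alpha> \<infinity> (weighted_comp u \<psi> (remainder \<alpha> N w b f)) \<le> ennreal (A * y)"
          unfolding g_def[symmetric] fs_norm_infinite wmod_weighted_comp by (intro SUP_least ennreal_leI)
      qed
    qed
  qed
qed

text \<open>
A unit ball around \<open>z\<close> with \<open>|z| > R + 1\<close> stays in \<open>|w| \<ge> R\<close>, so only the values of the transform there are used.
\<close>

lemma far_exp_le_gauss_mean:
  fixes z y :: "complex ^ 'n::finite" and \<alpha> s R :: real
  assumes \<alpha>: "\<alpha> > 0" and s: "s \<ge> 1"
  shows "indicator {R + 1<..} (norm z) * ennreal (exp (- norm (z - y))) \<le>
    ennreal (exp 1 / measure lborel (ball (0 :: complex ^ 'n) 1) * exp (\<alpha> * s / 2)) *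
    (\<integral>\<^sup>+w. indicator {R..} (norm w) * ennreal (exp (- (\<alpha> * s / 2) * (norm (z - w))\<^sup>2) * exp (- norm (y - w))) \<partial>lborel)"
proof (cases "R + 1 < norm z")
  case True
  define v where "v = exp 1 / measure lborel (ball (0 :: complex ^ 'n) 1)"
  have v: "v > 0" unfolding v_def using content_ball_pos[of 1 "0 :: complex ^ 'n"] by simp
  have "indicator {R + 1<..} (norm z) * ennreal (exp (- norm (z - y))) \<le> ennreal v * (\<integral>\<^sup>+w. indicator (ball z 1) w * ennreal (exp (- norm (y - w))) \<partial>lborel)"
    using True exp_norm_le_ball_mean[of z y] by (simp add: v_def)
  also have "\<dots> \<le> ennreal v * (\<integral>\<^sup>+w. ennreal (exp (\<alpha> * s / 2)) * (indicator {R..} (norm w) * ennreal (exp (- (\<alpha> * s / 2) * (norm (z - w))\<^sup>2) * exp (- norm (y - w)))) \<partial>lborel)"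
  proof (intro mult_left_mono nn_integral_mono)
    fix w
    show "indicator (ball z 1) w * ennreal (exp (- norm (y - w))) \<le> 
       ennreal (exp (\<alpha> * s / 2)) * (indicator {R..} (norm w) * ennreal (exp (- (\<alpha> * s / 2) * (norm (z - w))\<^sup>2) * exp (- norm (y - w))))"
    proof (cases "w \<in> ball z 1")
      case w: True
      then have n: "norm (z - w) < 1" by (simp add: dist_norm)
      then have "R \<le> norm w" using True norm_triangle_sub[of z w] by simp
      moreover have "1 * exp (- norm (y - w)) \<le> (exp (\<alpha> * s / 2) * exp (- (\<alpha> * s / 2) * (norm (z - w))\<^sup>2)) * exp (- norm (y - w))"
      proof (rule mult_right_mono)
        have "(norm (z - w))\<^sup>2 \<le> 1" using n by (simp add: power_le_one)
        then have "\<alpha> * s / 2 * (norm (z - w))\<^sup>2 \<le> \<alpha> * s / 2 * 1" using \<alpha> s by (intro mult_left_mono) auto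
        then show "1 \<le> exp (\<alpha> * s / 2) * exp (- (\<alpha> * s / 2) * (norm (z - w))\<^sup>2)"
          unfolding exp_add[symmetric] by simp
      qed simp
      ultimately show ?thesis using w by (simp add: ennreal_mult'[symmetric] ennreal_leI mult.assoc)
    qed simp
  qed simp
  also have "\<dots> = ennreal (v * exp (\<alpha> * s / 2)) * (\<integral>\<^sup>+w. indicator {R..} (norm w) * ennreal (exp (- (\<alpha> * s / 2) * (norm (z - w))\<^sup>2) * exp (- norm (y - w))) \<partial>lborel)"
    using v by (subst nn_integral_cmult) (auto simp: mult.assoc[symmetric] ennreal_mult'[symmetric])
  finally show ?thesis by (simp add: v_def)
qed simp

text \<open>
A Carleson measure estimate. The image under \<open>\<psi>\<close> of the measure with density \<open>\<lambda>\<^sup>s\<close> gives a unit ball far out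
at most a constant times the transform at its centre. By Tonelli's theorem, integrating a mean against
\<open>e\<^bsup>-|\<psi>(z)-y|\<^esup>\<close> over the far part multiplies the integral of \<open>h\<close> by at most that size.
\<close>

lemma truncated_transform_bound:
  fixes \<alpha> s :: real
  assumes \<alpha>: "\<alpha> > 0" and s: "s \<ge> 1"
  shows "\<exists>C>0. \<forall>(u :: complex ^ 'n::finite \<Rightarrow> complex) \<psi> R t h. entire_fun u \<longrightarrow> entire_map \<psi> \<longrightarrow> t \<ge> 0 \<longrightarrow>
    (\<forall>w. R \<le> norm w \<longrightarrow> berezin m \<alpha> s u \<psi> w \<le> ennreal t) \<longrightarrow> h \<in> borel_measurable borel \<longrightarrow> (\<forall>y. 0 \<le> h y) \<longrightarrow>
    (\<integral>\<^sup>+z. ennreal (pull_weight m \<alpha> u \<psi> z powr s) * (indicator {R + 1<..} (norm (\<psi> z)) * exp_avg h (\<psi> z)) \<partial>lborel)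
      \<le> ennreal (C * t) * (\<integral>\<^sup>+y. ennreal (h y) \<partial>lborel)"
proof -
  define c where "c = exp 1 / measure lborel (ball (0 :: complex ^ 'n) 1) * exp (\<alpha> * s / 2)"
  have c: "c > 0" unfolding c_def using content_ball_pos[of 1 "0 :: complex ^ 'n"] by simp
  define k where "k = exp_mass TYPE('n)"
  have k: "k > 0" unfolding k_def by (rule exp_mass_pos)
  show ?thesis
  proof (rule exI[of _ "c * k"], intro conjI allI impI)
    show "c * k > 0" using c k by simp
    fix u :: "complex ^ 'n \<Rightarrow> complex" and \<psi> and R t :: real and h :: "complex ^ 'n \<Rightarrow> real"
    assume u: "entire_fun u" and \<psi>: "entire_map \<psi>" and t: "t \<ge> 0"
      and bt: "\<forall>w. R \<le> norm w \<longrightarrow> berezin m \<alpha> s u \<psi> w \<le> ennreal t"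
      and [measurable]: "h \<in> borel_measurable borel" and h: "\<forall>y. 0 \<le> h y"
    note [measurable] = entire_fun_measurable[OF u] entire_map_measurable[OF \<psi>]
    note [measurable] = pull_weight_measurable[OF entire_fun_measurable[OF u] entire_map_measurable[OF \<psi>], of m \<alpha>]
    let ?W = "\<lambda>z. ennreal (pull_weight m \<alpha> u \<psi> z powr s)"
    let ?I = "\<lambda>z. indicator {R + 1<..} (norm (\<psi> z)) :: ennreal"
    have inner: "(\<integral>\<^sup>+z. ?W z * (?I z * ennreal (exp (- norm (\<psi> z - y)))) \<partial>lborel) \<le> ennreal (c * k * t)" for y
    proof -
      have "(\<integral>\<^sup>+z. ?W z * (?I z * ennreal (exp (- norm (\<psi> z - y)))) \<partial>lborel) \<le>
        (\<integral>\<^sup>+z. ?W z * (ennreal c * (\<integral>\<^sup>+w. indicator {R..} (norm w) * ennreal (exp (- (\<alpha> * s / 2) * (norm (\<psi> z - w))\<^sup>2) * exp (- norm (y - w))) \<partial>lborel)) \<partial>lborel)"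
        unfolding c_def by (intro nn_integral_mono mult_left_mono far_exp_le_gauss_mean[OF \<alpha> s]) simp
      also have "\<dots> = (\<integral>\<^sup>+z. ennreal c * (\<integral>\<^sup>+w. (indicator {R..} (norm w) * ennreal (exp (- norm (y - w)))) * ennreal (pull_weight m \<alpha> u \<psi> z powr s * exp (- (\<alpha> * s / 2) * (norm (\<psi> z - w))\<^sup>2)) \<partial>lborel) \<partial>lborel)"
      proof (rule nn_integral_cong)
        fix z
        have "?W z * (\<integral>\<^sup>+w. indicator {R..} (norm w) * ennreal (exp (- (\<alpha> * s / 2) * (norm (\<psi> z - w))\<^sup>2) * exp (- norm (y - w))) \<partial>lborel)
          = (\<integral>\<^sup>+w. ?W z * (indicator {R..} (norm w) * ennreal (exp (- (\<alpha> * s / 2) * (norm (\<psi> z - w))\<^sup>2) * exp (- norm (y - w)))) \<partial>lborel)"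
          by (rule nn_integral_cmult[symmetric]) measurable
        also have "\<dots> = (\<integral>\<^sup>+w. (indicator {R..} (norm w) * ennreal (exp (- norm (y - w)))) * ennreal (pull_weight m \<alpha> u \<psi> z powr s * exp (- (\<alpha> * s / 2) * (norm (\<psi> z - w))\<^sup>2)) \<partial>lborel)"
          by (intro nn_integral_cong) (simp add: indicator_def ennreal_mult'[symmetric] mult_ac)
        finally show "?W z * (ennreal c * (\<integral>\<^sup>+w. indicator {R..} (norm w) * ennreal (exp (- (\<alpha> * s / 2) * (norm (\<psi> z - w))\<^sup>2) * exp (- norm (y - w))) \<partial>lborel))
          = ennreal c * (\<integral>\<^sup>+w. (indicator {R..} (norm w) * ennreal (exp (- norm (y - w)))) * ennreal (pull_weight m \<alpha> u \<psi> z powr s * exp (- (\<alpha> * s / 2) * (norm (\<psi> z - w))\<^sup>2)) \<partial>lborel)"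
          by (simp only: mult.left_commute)
      qed
      also have "\<dots> = ennreal c * (\<integral>\<^sup>+z. \<integral>\<^sup>+w. (indicator {R..} (norm w) * ennreal (exp (- norm (y - w)))) * ennreal (pull_weight m \<alpha> u \<psi> z powr s * exp (- (\<alpha> * s / 2) * (norm (\<psi> z - w))\<^sup>2)) \<partial>lborel \<partial>lborel)"
        by (rule nn_integral_cmult) measurable
      also have "(\<integral>\<^sup>+z. \<integral>\<^sup>+w. (indicator {R..} (norm w) * ennreal (exp (- norm (y - w)))) * ennreal (pull_weight m \<alpha> u \<psi> z powr s * exp (- (\<alpha> * s / 2) * (norm (\<psi> z - w))\<^sup>2)) \<partial>lborel \<partial>lborel)
        = (\<integral>\<^sup>+w. \<integral>\<^sup>+z. (indicator {R..} (norm w) * ennreal (exp (- norm (y - w)))) * ennreal (pull_weight m \<alpha> u \<psi> z powr s * exp (- (\<alpha> * s / 2) * (norm (\<psi> z - w))\<^sup>2)) \<partial>lborel \<partial>lborel)"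
        by (rule lborel_pair.Fubini') measurable
      also have "\<dots> = (\<integral>\<^sup>+w. (indicator {R..} (norm w) * ennreal (exp (- norm (y - w)))) * berezin m \<alpha> s u \<psi> w \<partial>lborel)"
        unfolding berezin_eq by (intro nn_integral_cong nn_integral_cmult) measurable
      also have "\<dots> \<le> (\<integral>\<^sup>+w. ennreal (exp (- norm (y - w))) * ennreal t \<partial>lborel)"
        by (intro nn_integral_mono) (use bt in \<open>auto simp: indicator_def intro!: mult_left_mono\<close>)
      also have "\<dots> = ennreal k * ennreal t"
        by (subst nn_integral_multc) (auto simp: exp_mass_translate k_def)
      finally show ?thesis
        using c k t by (simp add: ennreal_mult' mult_left_mono mult.assoc)
    qed
    have "(\<integral>\<^sup>+z. ?W z * (?I z * exp_avg h (\<psi> z)) \<partial>lborel)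
       = (\<integral>\<^sup>+z. \<integral>\<^sup>+y. ennreal (h y) * (?W z * (?I z * ennreal (exp (- norm (\<psi> z - y))))) \<partial>lborel \<partial>lborel)"
    proof (rule nn_integral_cong)
      fix z
      have "?W z * (?I z * exp_avg h (\<psi> z)) 
         = (\<integral>\<^sup>+y. (?W z * ?I z) * ennreal (exp (- norm (\<psi> z - y)) * h y) \<partial>lborel)"
        unfolding mult.assoc[symmetric] by (rule nn_integral_cmult[symmetric]) measurable
      also have "\<dots> = (\<integral>\<^sup>+y. ennreal (h y) * (?W z * (?I z * ennreal (exp (- norm (\<psi> z - y))))) \<partial>lborel)"
        by (intro nn_integral_cong) (use h in \<open>simp add: ennreal_mult' mult_ac\<close>)
      finally show "?W z * (?I z * exp_avg h (\<psi> z)) = (\<integral>\<^sup>+y. ennreal (h y) * (?W z * (?I z * ennreal (exp (- norm (\<psi> z - y))))) \<partial>lborel)" .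
    qed
    also have "\<dots> = (\<integral>\<^sup>+y. \<integral>\<^sup>+z. ennreal (h y) * (?W z * (?I z * ennreal (exp (- norm (\<psi> z - y))))) \<partial>lborel \<partial>lborel)"
      by (rule lborel_pair.Fubini') measurable
    also have "\<dots> = (\<integral>\<^sup>+y. ennreal (h y) * (\<integral>\<^sup>+z. ?W z * (?I z * ennreal (exp (- norm (\<psi> z - y)))) \<partial>lborel) \<partial>lborel)"
      by (intro nn_integral_cong nn_integral_cmult) measurable
    also have "\<dots> \<le> (\<integral>\<^sup>+y. ennreal (h y) * ennreal (c * k * t) \<partial>lborel)"
      by (intro nn_integral_mono mult_left_mono inner) simp
    also have "\<dots> = ennreal (c * k * t) * (\<integral>\<^sup>+y. ennreal (h y) \<partial>lborel)"
      by (subst nn_integral_multc) (auto simp: mult.commute)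
    finally show "(\<integral>\<^sup>+z. ?W z * (?I z * exp_avg h (\<psi> z)) \<partial>lborel) \<le> ennreal (c * k * t) * (\<integral>\<^sup>+y. ennreal (h y) \<partial>lborel)" .
  qed
qed

text \<open>
The unit ball for the exponent \<open>r\<close> is bounded pointwise, hence also for every larger exponent.
\<close>

lemma unit_ball_embedding:
  fixes r s M :: real
  assumes r: "r \<ge> 1" and rs: "r \<le> s" and M: "M > 0"
  shows "\<exists>I>0. \<forall>f :: complex ^ 'n::finite \<Rightarrow> complex. entire_fun f \<longrightarrow>
    (energy m \<alpha> r f) \<le> ennreal M \<longrightarrow> (energy m \<alpha> s f) \<le> ennreal I"
proof -
  obtain A where A: "A > 0" "\<forall>f :: complex ^ 'n \<Rightarrow> complex. entire_fun f \<longrightarrow>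
    (energy m \<alpha> r f) \<le> ennreal M \<longrightarrow> (\<forall>z. Wmod m \<alpha> f z \<le> A)"
    using unit_ball_growth[OF r M, of m \<alpha>, where 'n = 'n] by (elim exE conjE) (rule that)
  show ?thesis
  proof (rule exI[of _ "A powr (s - r) * M"], intro conjI allI impI)
    show "A powr (s - r) * M > 0" using A(1) M by simp
    fix f :: "complex ^ 'n \<Rightarrow> complex"
    assume f: "entire_fun f" and I: "energy m \<alpha> r f \<le> ennreal M"
    note [measurable] = wmod_measurable[OF entire_fun_measurable[OF f]]
    have le: "wmod m \<alpha> f z \<le> A" for z
      using order_trans[OF wmod_le_Wmod A(2)[rule_format, OF f I]] .
    have "energy m \<alpha> s f \<le> (\<integral>\<^sup>+z. ennreal (A powr (s - r)) * ennreal (wmod m \<alpha> f z powr r) \<partial>lborel)"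
    proof (rule nn_integral_mono)
      fix z
      have "wmod m \<alpha> f z powr s = wmod m \<alpha> f z powr (s - r) * wmod m \<alpha> f z powr r"
        by (simp add: powr_add[symmetric])
      also have "\<dots> \<le> A powr (s - r) * wmod m \<alpha> f z powr r"
        using le rs by (intro mult_right_mono powr_mono2) auto
      finally show "ennreal (wmod m \<alpha> f z powr s) \<le> ennreal (A powr (s - r)) * ennreal (wmod m \<alpha> f z powr r)"
        by (simp add: ennreal_mult'[symmetric] ennreal_leI)
    qed
    also have "\<dots> = ennreal (A powr (s - r)) * energy m \<alpha> r f"
      by (rule nn_integral_cmult) measurable
    also have "\<dots> \<le> ennreal (A powr (s - r)) * ennreal M"
      by (intro mult_left_mono I) simp
    finally show "energy m \<alpha> s f \<le> ennreal (A powr (s - r) * M)"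
      by (simp add: ennreal_mult')
  qed
qed

text \<open>
The normalised kernel at \<open>0\<close> is the constant \<open>1\<close>, and the norm of its image dominates the transform at \<open>0\<close>.
\<close>

lemma berezin_zero_finite:
  fixes u :: "complex ^ 'n::finite \<Rightarrow> complex"
  assumes \<alpha>: "\<alpha> > 0" and r: "r \<ge> 1" and s: "s \<ge> 1"
    and T: "bounded_op_fs m \<alpha> (ennreal r) (ennreal s) (weighted_comp u \<psi>)"
  shows "berezin m \<alpha> s u \<psi> 0 < \<infinity>"
proof -
  obtain B where B: "B \<ge> 0" "\<forall>w :: complex ^ 'n. fs_norm m \<alpha> (ennreal s) (weighted_comp u \<psi> (test_fun m \<alpha> w)) \<le> ennreal B"
    using bounded_op_test_fun_bound[OF \<alpha> r T] by (elim exE conjE) (rule that)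
  have "berezin m \<alpha> s u \<psi> 0 \<le> energy m \<alpha> s (weighted_comp u \<psi> (test_fun m \<alpha> 0))"
    unfolding berezin_eq wmod_weighted_comp
  proof (rule nn_integral_mono)
    fix z
    have "1 * exp (- (\<alpha> / 2) * (norm (\<psi> z))\<^sup>2) \<le> Wmod m \<alpha> (test_fun m \<alpha> 0) (\<psi> z)"
      unfolding Wmod_test_fun by (simp add: one_le_power)
    then have "exp (- (\<alpha> / 2) * (norm (\<psi> z))\<^sup>2) powr s \<le> Wmod m \<alpha> (test_fun m \<alpha> 0) (\<psi> z) powr s"
      using s by (intro powr_mono2) auto
    also have "exp (- (\<alpha> / 2) * (norm (\<psi> z))\<^sup>2) powr s = exp (- (\<alpha> * s / 2) * (norm (\<psi> z - 0))\<^sup>2)"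
      by (simp add: exp_powr_real mult_ac)
    finally show "ennreal (pull_weight m \<alpha> u \<psi> z powr s * exp (- (\<alpha> * s / 2) * (norm (\<psi> z - 0))\<^sup>2)) \<le>
       ennreal ((pull_weight m \<alpha> u \<psi> z * Wmod m \<alpha> (test_fun m \<alpha> 0) (\<psi> z)) powr s)"
      unfolding powr_mult by (intro ennreal_leI mult_left_mono) simp_all
  qed
  also have "\<dots> < \<infinity>"
  proof -
    have c: "fs_const m \<alpha> s CARD('n) > 0" by (rule fs_const_pos) (use \<alpha> s in auto)
    have "ennreal (fs_const m \<alpha> s CARD('n)) * energy m \<alpha> s (weighted_comp u \<psi> (test_fun m \<alpha> 0)) \<le> ennreal (B powr s)"
      using B(2)[THEN spec, of 0] B(1) s by (subst (asm) fs_norm_le_iff) auto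
    also have "\<dots> < \<infinity>" by simp
    finally show ?thesis using c by (auto simp: ennreal_mult_less_top)
  qed
  finally show ?thesis .
qed

text \<open>
The compact operator is \<open>u C\<^sub>\<psi> P\<close> with \<open>P\<close> from \<open>finite_rank_approximation\<close>, and the integral is split at
\<open>|\<psi>(z)| = R + 1\<close>. The part near the origin is small because \<open>\<lambda>\<^sup>s\<close> has finite mass there, which is read off from the
value of the transform at \<open>0\<close>.
\<close>

lemma essential_norm_upper_finite:
  fixes r s :: real
  assumes \<alpha>: "\<alpha> > 0" and r: "r \<ge> 1" and rs: "r \<le> s"
  shows "\<exists>C>0. \<forall>(u :: complex ^ 'n::finite \<Rightarrow> complex) \<psi>. entire_fun u \<longrightarrow> entire_map \<psi> \<longrightarrow>
    bounded_op_fs m \<alpha> (ennreal r) (ennreal s) (weighted_comp u \<psi>) \<longrightarrow>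
    essential_norm_fs m \<alpha> (ennreal r) (ennreal s) (weighted_comp u \<psi>)
      \<le> ennreal C * epowr (Limsup at_infinity (berezin m \<alpha> s u \<psi>)) (1 / s)"
proof -
  have s: "s \<ge> 1" using r rs by simp
  define I where "I = 1 / fs_const m \<alpha> r CARD('n)"
  have I: "I > 0" unfolding I_def using fs_const_pos[of \<alpha> r "CARD('n)" m] \<alpha> r by simp
  define c where "c = fs_const m \<alpha> s CARD('n)"
  have c: "c > 0" unfolding c_def by (rule fs_const_pos) (use \<alpha> s in auto)
  obtain C0 where C0: "C0 > 0" and approx: "\<forall>R0 \<epsilon>. \<epsilon> > 0 \<longrightarrow> (\<exists>N (w :: nat \<Rightarrow> complex ^ 'n) b. \<forall>f. entire_fun f \<longrightarrow>
      (energy m \<alpha> r f) \<le> ennreal I \<longrightarrow>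
      (\<forall>z. norm z \<le> R0 \<longrightarrow> Wmod m \<alpha> (remainder \<alpha> N w b f) z \<le> \<epsilon>) \<and>
      (\<forall>z. ennreal (Wmod m \<alpha> (remainder \<alpha> N w b f) z) \<le>
        ennreal C0 * exp_avg (wmod m \<alpha> f) z))"
    using finite_rank_approximation[OF \<alpha> r I, of m, where 'n = 'n] by (elim exE conjE) (rule that)
  obtain J where J: "J > 0" "\<forall>f :: complex ^ 'n \<Rightarrow> complex. entire_fun f \<longrightarrow>
    (energy m \<alpha> r f) \<le> ennreal I \<longrightarrow> (energy m \<alpha> s f) \<le> ennreal J"
    using unit_ball_embedding[OF r rs I, of m \<alpha>, where 'n = 'n] by (elim exE conjE) (rule that)
  obtain C3 where C3: "C3 > 0" and trunc: "\<forall>(u :: complex ^ 'n \<Rightarrow> complex) \<psi> R t h. entire_fun u \<longrightarrow> entire_map \<psi> \<longrightarrow> t \<ge> 0 \<longrightarrow>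
    (\<forall>w. R \<le> norm w \<longrightarrow> berezin m \<alpha> s u \<psi> w \<le> ennreal t) \<longrightarrow> h \<in> borel_measurable borel \<longrightarrow> (\<forall>y. 0 \<le> h y) \<longrightarrow>
    (\<integral>\<^sup>+z. ennreal (pull_weight m \<alpha> u \<psi> z powr s) * (indicator {R + 1<..} (norm (\<psi> z)) * exp_avg h (\<psi> z)) \<partial>lborel)
      \<le> ennreal (C3 * t) * (\<integral>\<^sup>+y. ennreal (h y) \<partial>lborel)"
    using truncated_transform_bound[OF \<alpha> s, of m, where 'n = 'n] by (elim exE conjE) (rule that)
  define C2 where "C2 = C0 powr s * exp_mass TYPE('n) powr (s - 1)"
  have C2: "C2 > 0" unfolding C2_def using C0 exp_mass_pos[where 'n = 'n] by simp
  define Q where "Q = c * (1 + C2 * C3 * J)"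
  have Q: "Q > 0" unfolding Q_def using c C2 C3 J(1) by (intro mult_pos_pos add_pos_nonneg) auto
  define C where "C = 2 * Q powr (1 / s)"
  have C: "C > 0" using Q by (simp add: C_def)
  show ?thesis
  proof (rule exI[of _ C], intro conjI allI impI C)
    fix u :: "complex ^ 'n \<Rightarrow> complex" and \<psi>
    assume u: "entire_fun u" and \<psi>: "entire_map \<psi>"
      and T: "bounded_op_fs m \<alpha> (ennreal r) (ennreal s) (weighted_comp u \<psi>)"
    note [measurable] = entire_fun_measurable[OF u] entire_map_measurable[OF \<psi>]
    note [measurable] = pull_weight_measurable[OF entire_fun_measurable[OF u] entire_map_measurable[OF \<psi>], of m \<alpha>]
    obtain b0 where b0: "berezin m \<alpha> s u \<psi> 0 = ennreal b0" "b0 \<ge> 0"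
      using berezin_zero_finite[OF \<alpha> r s T] by (cases "berezin m \<alpha> s u \<psi> 0") auto
    show "essential_norm_fs m \<alpha> (ennreal r) (ennreal s) (weighted_comp u \<psi>)
      \<le> ennreal C * epowr (Limsup at_infinity (berezin m \<alpha> s u \<psi>)) (1 / s)"
    proof (rule ennreal_le_mult_limit[OF C])
      fix y assume y: "y > 0" "epowr (Limsup at_infinity (berezin m \<alpha> s u \<psi>)) (1 / s) < ennreal y"
      \<comment> \<open>the factor \<open>2\<close> gives a strict inequality, as needed to pass from the upper limit to a neighbourhood of infinity\<close>
      define t where "t = (2 * y) powr s"
      have t: "t > 0" using y by (simp add: t_def)
      have "Limsup at_infinity (berezin m \<alpha> s u \<psi>) \<le> ennreal (y powr s)"
        using less_imp_le[OF y(2)] y(1) s by (subst (asm) epowr_le_iff) auto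
      also have "ennreal (y powr s) < ennreal t"
        using y s by (simp add: t_def ennreal_less_iff powr_less_mono2)
      finally have "\<forall>\<^sub>F w in at_infinity. berezin m \<alpha> s u \<psi> w < ennreal t" by (rule Limsup_lessD)
      then obtain R where R: "\<And>w. R \<le> norm w \<Longrightarrow> berezin m \<alpha> s u \<psi> w < ennreal t"
        by (auto simp: eventually_at_infinity)
      have bt: "\<forall>w. R \<le> norm w \<longrightarrow> berezin m \<alpha> s u \<psi> w \<le> ennreal t"
        using R by (simp add: less_imp_le)
      define P where "P = exp (\<alpha> * s / 2 * (R + 1)\<^sup>2) * b0"
      have P: "P \<ge> 0" using b0 by (simp add: P_def)
      \<comment> \<open>\<open>P\<close> bounds the integral of \<open>\<lambda>\<^sup>s\<close> over \<open>|\<psi>| \<le> R + 1\<close>; this \<open>\<epsilon>\<close> makes that part of the integral at most \<open>t\<close>\<close>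
      define \<epsilon> where "\<epsilon> = (t / (P + 1)) powr (1 / s)"
      have \<epsilon>: "\<epsilon> > 0" "\<epsilon> powr s = t / (P + 1)"
        using t P s by (auto simp: \<epsilon>_def powr_powr add_nonneg_eq_0_iff)
      obtain N and w :: "nat \<Rightarrow> complex ^ 'n" and b where ap: "\<forall>f. entire_fun f \<longrightarrow>
        (energy m \<alpha> r f) \<le> ennreal I \<longrightarrow>
        (\<forall>z. norm z \<le> R + 1 \<longrightarrow> Wmod m \<alpha> (remainder \<alpha> N w b f) z \<le> \<epsilon>) \<and>
        (\<forall>z. ennreal (Wmod m \<alpha> (remainder \<alpha> N w b f) z) \<le>
          ennreal C0 * exp_avg (wmod m \<alpha> f) z)"
        using approx[THEN spec, THEN spec, THEN mp, OF \<epsilon>(1), of "R + 1"] by (elim exE) (rule that)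
      show "essential_norm_fs m \<alpha> (ennreal r) (ennreal s) (weighted_comp u \<psi>) \<le> ennreal (C * y)"
      proof (rule essential_norm_le[OF \<alpha> r T])
        fix f :: "complex ^ 'n \<Rightarrow> complex" assume f: "entire_fun f" "fs_norm m \<alpha> (ennreal r) f \<le> 1"
        note [measurable] = wmod_measurable[OF entire_fun_measurable[OF f(1)]]
        have fI: "energy m \<alpha> r f \<le> ennreal I"
          unfolding I_def by (rule unit_ball_integral_le[OF \<alpha> r f(2)])
        note ap' = ap[THEN spec, THEN mp, THEN mp, OF f(1) fI]
        define g where "g = (remainder \<alpha> N w b f)"
        have near: "Wmod m \<alpha> g z \<le> \<epsilon>" if "norm z \<le> R + 1" for z
          unfolding g_def by (rule ap'[THEN conjunct1, rule_format, OF that])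
        have gC: "ennreal (Wmod m \<alpha> g z) \<le> ennreal C0 * exp_avg (wmod m \<alpha> f) z" for z
          unfolding g_def by (rule ap'[THEN conjunct2, rule_format])
        let ?W = "pull_weight m \<alpha> u \<psi>"
        let ?m = "\<lambda>z. exp_avg (\<lambda>y. wmod m \<alpha> f y powr s) (\<psi> z)"
        have gs: "ennreal (Wmod m \<alpha> g (\<psi> z) powr s) \<le> ennreal C2 * ?m z" for z
          unfolding C2_def by (rule powr_le_exp_mean[OF f(1) s _ C0 gC]) simp
        have "energy m \<alpha> s (weighted_comp u \<psi> g) \<le>
          (\<integral>\<^sup>+z. ennreal (\<epsilon> powr s * exp (\<alpha> * s / 2 * (R + 1)\<^sup>2)) * ennreal (?W z powr s * exp (- (\<alpha> * s / 2) * (norm (\<psi> z - 0))\<^sup>2)) + 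
             ennreal C2 * (ennreal (?W z powr s) * (indicator {R + 1<..} (norm (\<psi> z)) * ?m z)) \<partial>lborel)"
        proof (rule nn_integral_mono)
          fix z
          have eq: "ennreal (wmod m \<alpha> (weighted_comp u \<psi> g) z powr s) = ennreal (?W z powr s) * ennreal (Wmod m \<alpha> g (\<psi> z) powr s)"
            by (simp add: wmod_weighted_comp powr_mult ennreal_mult')
          show "ennreal (wmod m \<alpha> (weighted_comp u \<psi> g) z powr s) \<le>
            ennreal (\<epsilon> powr s * exp (\<alpha> * s / 2 * (R + 1)\<^sup>2)) * ennreal (?W z powr s * exp (- (\<alpha> * s / 2) * (norm (\<psi> z - 0))\<^sup>2)) + 
             ennreal C2 * (ennreal (?W z powr s) * (indicator {R + 1<..} (norm (\<psi> z)) * ?m z))"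
          proof (cases "norm (\<psi> z) \<le> R + 1")
            case True
            have "Wmod m \<alpha> g (\<psi> z) powr s \<le> \<epsilon> powr s"
              using s by (intro powr_mono2 near True) auto
            moreover have "1 \<le> exp (\<alpha> * s / 2 * (R + 1)\<^sup>2) * exp (- (\<alpha> * s / 2) * (norm (\<psi> z))\<^sup>2)"
            proof -
              have "(norm (\<psi> z))\<^sup>2 \<le> (R + 1)\<^sup>2" using True by (intro power_mono) auto
              then have "\<alpha> * s / 2 * (norm (\<psi> z))\<^sup>2 \<le> \<alpha> * s / 2 * (R + 1)\<^sup>2" using \<alpha> s by (intro mult_left_mono) auto
              then show ?thesis unfolding exp_add[symmetric] by simp
            qed
            ultimately have "Wmod m \<alpha> g (\<psi> z) powr s * 1 \<le> \<epsilon> powr s * (exp (\<alpha> * s / 2 * (R + 1)\<^sup>2) * exp (- (\<alpha> * s / 2) * (norm (\<psi> z))\<^sup>2))"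
              by (intro mult_mono) auto
            then have "?W z powr s * (Wmod m \<alpha> g (\<psi> z) powr s * 1) \<le> ?W z powr s * (\<epsilon> powr s * (exp (\<alpha> * s / 2 * (R + 1)\<^sup>2) * exp (- (\<alpha> * s / 2) * (norm (\<psi> z))\<^sup>2)))"
              by (rule mult_left_mono) simp
            then have "ennreal (?W z powr s * Wmod m \<alpha> g (\<psi> z) powr s) \<le> ennreal ((\<epsilon> powr s * exp (\<alpha> * s / 2 * (R + 1)\<^sup>2)) * (?W z powr s * exp (- (\<alpha> * s / 2) * (norm (\<psi> z - 0))\<^sup>2)))"
              by (intro ennreal_leI) (simp add: mult_ac)
            then show ?thesis unfolding eq
              using True by (simp add: ennreal_mult'[symmetric])
          next
            case False
            have "ennreal (?W z powr s) * ennreal (Wmod m \<alpha> g (\<psi> z) powr s) \<le> ennreal (?W z powr s) * (ennreal C2 * ?m z)"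
              by (intro mult_left_mono gs) simp
            then show ?thesis unfolding eq
              using False by (simp add: mult.left_commute add_increasing)
          qed
        qed
        also have "\<dots> = ennreal (\<epsilon> powr s * exp (\<alpha> * s / 2 * (R + 1)\<^sup>2)) * berezin m \<alpha> s u \<psi> 0 +
            ennreal C2 * (\<integral>\<^sup>+z. ennreal (?W z powr s) * (indicator {R + 1<..} (norm (\<psi> z)) * ?m z) \<partial>lborel)"
          unfolding berezin_eq by (rule nn_integral_lincomb) measurable
        also have "\<dots> \<le> ennreal t + ennreal C2 * (ennreal (C3 * t) * ennreal J)"
        proof (intro add_mono mult_left_mono)
          have "\<epsilon> powr s * exp (\<alpha> * s / 2 * (R + 1)\<^sup>2) * b0 = t * (P / (P + 1))"
            unfolding \<epsilon>(2) by (simp add: P_def)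
          also have "\<dots> \<le> t * 1"
            using P t by (intro mult_left_mono) (auto simp: divide_le_eq_1 add_nonneg_pos)
          finally show "ennreal (\<epsilon> powr s * exp (\<alpha> * s / 2 * (R + 1)\<^sup>2)) * berezin m \<alpha> s u \<psi> 0 \<le> ennreal t"
            unfolding b0(1) by (simp add: ennreal_mult'[symmetric] ennreal_leI)
          have mm: "(\<lambda>y. wmod m \<alpha> f y powr s) \<in> borel_measurable borel" by measurable
          have "(\<integral>\<^sup>+z. ennreal (?W z powr s) * (indicator {R + 1<..} (norm (\<psi> z)) * ?m z) \<partial>lborel) \<le> ennreal (C3 * t) * energy m \<alpha> s f"
            using trunc[rule_format, OF u \<psi> less_imp_le[OF t] bt[rule_format] mm] by simp
          also have "\<dots> \<le> ennreal (C3 * t) * ennreal J"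
            by (intro mult_left_mono J(2)[rule_format, OF f(1) fI]) simp
          finally show "(\<integral>\<^sup>+z. ennreal (?W z powr s) * (indicator {R + 1<..} (norm (\<psi> z)) * ?m z) \<partial>lborel) \<le> ennreal (C3 * t) * ennreal J" .
        qed simp
        also have "\<dots> = ennreal (t * (1 + C2 * C3 * J))"
          using t C2 C3 J(1) by (simp add: ennreal_mult'[symmetric] ennreal_plus[symmetric] algebra_simps del: ennreal_plus)
        finally have "ennreal c * energy m \<alpha> s (weighted_comp u \<psi> g) \<le> ennreal c * ennreal (t * (1 + C2 * C3 * J))"
          by (rule mult_left_mono) simp
        also have "\<dots> = ennreal (Q * t)"
          using c by (simp add: ennreal_mult'[symmetric] Q_def mult_ac)
        also have "Q * t = (C * y) powr s"
        proof -
          have "(C * y) powr s = (Q powr (1 / s) * (2 * y)) powr s" by (simp add: C_def mult_ac)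
          also have "\<dots> = Q * t" using Q s by (simp add: powr_mult powr_powr t_def)
          finally show ?thesis ..
        qed
        finally show "fs_norm m \<alpha> (ennreal s) (weighted_comp u \<psi> (remainder \<alpha> N w b f)) \<le> ennreal (C * y)"
          unfolding g_def[symmetric] c_def using s C y(1) by (subst fs_norm_le_iff) auto
      qed
    qed
  qed
qed

section \<open>Lower bounds for the essential norm\<close>

lemma op_norm_near_essential_norm:
  assumes "essential_norm X N Y M T < ennreal y"
  obtains K where "compact_op X N Y M K" "op_norm X N M (\<lambda>f z. T f z - K f z) \<le> ennreal y"
  using assms unfolding essential_norm_def by (auto simp: INF_less_iff intro: less_imp_le)

lemma essential_norm_lower_infinite:
  fixes r :: real
  assumes \<alpha>: "\<alpha> > 0" and r: "r > 1"
  shows "\<exists>C>0. \<forall>(u :: complex ^ 'n::finite \<Rightarrow> complex) \<psi>. 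
    bounded_op_fs m \<alpha> (ennreal r) \<infinity> (weighted_comp u \<psi>) \<longrightarrow>
    limsup_along \<psi> (berezin_inf m \<alpha> u \<psi>) \<le> ennreal C *
    essential_norm_fs m \<alpha> (ennreal r) \<infinity> (weighted_comp u \<psi>)"
proof -
  obtain D where D: "D > 0" "\<forall>(T :: (complex ^ 'n \<Rightarrow> complex) \<Rightarrow> (complex ^ 'n \<Rightarrow> complex)) K A. bounded_op_fs m \<alpha> (ennreal r) \<infinity> T \<longrightarrow>
    compact_op_fs m \<alpha> (ennreal r) \<infinity> K \<longrightarrow>
    A > 0 \<longrightarrow> op_norm_fs m \<alpha> (ennreal r) \<infinity> (\<lambda>f z. T f z - K f z) \<le> ennreal A \<longrightarrow>
    (\<exists>R. \<forall>w :: complex ^ 'n. norm w \<ge> R \<longrightarrow> fs_norm m \<alpha> \<infinity> (T (test_fun m \<alpha> w)) \<le> ennreal (D * A))"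
    using compact_perturbation_test_fun[OF \<alpha> r disjI1[OF refl], of m, where 'n = 'n] by (elim exE conjE) (rule that)
  show ?thesis
  proof (rule exI[of _ D], intro conjI allI impI D(1))
    fix u :: "complex ^ 'n \<Rightarrow> complex" and \<psi>
    assume T: "bounded_op_fs m \<alpha> (ennreal r) \<infinity> (weighted_comp u \<psi>)"
    show "limsup_along \<psi> (berezin_inf m \<alpha> u \<psi>) \<le> ennreal D *
      essential_norm_fs m \<alpha> (ennreal r) \<infinity> (weighted_comp u \<psi>)"
    proof (rule ennreal_le_mult_limit[OF D(1)])
      fix y assume y: "y > 0" "essential_norm_fs m \<alpha> (ennreal r) \<infinity> (weighted_comp u \<psi>) < ennreal y"
      from op_norm_near_essential_norm[OF y(2)] obtain K where 
        K: "compact_op_fs m \<alpha> (ennreal r) \<infinity> K"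
        "op_norm_fs m \<alpha> (ennreal r) \<infinity> (\<lambda>f z. weighted_comp u \<psi> f z - K f z) \<le> ennreal y" .
      from D(2)[THEN spec, THEN spec, THEN spec, THEN mp, THEN mp, THEN mp, THEN mp, OF T K(1) y(1) K(2)]
      obtain R where R: "\<forall>w :: complex ^ 'n. norm w \<ge> R \<longrightarrow> fs_norm m \<alpha> \<infinity> (weighted_comp u \<psi> (test_fun m \<alpha> w)) \<le> ennreal (D * y)" ..
      show "limsup_along \<psi> (berezin_inf m \<alpha> u \<psi>) \<le> ennreal (D * y)"
        by (rule limsup_along_le_test_fun[OF R[rule_format]])
    qed
  qed
qed

lemma essential_norm_lower_finite:
  fixes r s :: real
  assumes \<alpha>: "\<alpha> > 0" and r: "r > 1" and s: "s \<ge> 1"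
  shows "\<exists>C>0. \<forall>(u :: complex ^ 'n::finite \<Rightarrow> complex) \<psi>. entire_fun u \<longrightarrow> entire_map \<psi> \<longrightarrow>
    bounded_op_fs m \<alpha> (ennreal r) (ennreal s) (weighted_comp u \<psi>) \<longrightarrow>
    epowr (Limsup at_infinity (berezin m \<alpha> s u \<psi>)) (1 / s) \<le> ennreal C *
    essential_norm_fs m \<alpha> (ennreal r) (ennreal s) (weighted_comp u \<psi>)"
proof -
  have q: "ennreal s = \<infinity> \<or> (\<exists>s'\<ge>1. ennreal s = ennreal s')" using s by auto
  obtain D where D: "D > 0" "\<forall>(T :: (complex ^ 'n \<Rightarrow> complex) \<Rightarrow> (complex ^ 'n \<Rightarrow> complex)) K A. bounded_op_fs m \<alpha> (ennreal r) (ennreal s) T \<longrightarrow>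
    compact_op_fs m \<alpha> (ennreal r) (ennreal s) K \<longrightarrow>
    A > 0 \<longrightarrow> op_norm_fs m \<alpha> (ennreal r) (ennreal s) (\<lambda>f z. T f z - K f z) \<le> ennreal A \<longrightarrow>
    (\<exists>R. \<forall>w :: complex ^ 'n. norm w \<ge> R \<longrightarrow> fs_norm m \<alpha> (ennreal s) (T (test_fun m \<alpha> w)) \<le> ennreal (D * A))"
    using compact_perturbation_test_fun[OF \<alpha> r q, of m, where 'n = 'n] by (elim exE conjE) (rule that)
  obtain C where C: "C > 0" "\<forall>(u :: complex ^ 'n \<Rightarrow> complex) \<psi> R B B0. entire_fun u \<longrightarrow> entire_map \<psi> \<longrightarrow> B > 0 \<longrightarrow>
    (\<forall>w. R \<le> norm w \<longrightarrow> fs_norm m \<alpha> (ennreal s) (weighted_comp u \<psi> (test_fun m \<alpha> w)) \<le> ennreal B) \<longrightarrow>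
    (\<forall>w. fs_norm m \<alpha> (ennreal s) (weighted_comp u \<psi> (test_fun m \<alpha> w)) \<le> ennreal B0) \<longrightarrow>
    epowr (Limsup at_infinity (berezin m \<alpha> s u \<psi>)) (1 / s) \<le> ennreal (C * B)"
    using berezin_le_test_fun[OF \<alpha> s, of m, where 'n = 'n] by (elim exE conjE) (rule that)
  have CD: "C * D > 0" using C D by simp
  show ?thesis
  proof (rule exI[of _ "C * D"], intro conjI allI impI CD)
    fix u :: "complex ^ 'n \<Rightarrow> complex" and \<psi>
    assume u: "entire_fun u" and \<psi>: "entire_map \<psi>"
      and T: "bounded_op_fs m \<alpha> (ennreal r) (ennreal s) (weighted_comp u \<psi>)"
    obtain B0 where B0: "B0 \<ge> 0" "\<forall>w :: complex ^ 'n. fs_norm m \<alpha> (ennreal s) (weighted_comp u \<psi> (test_fun m \<alpha> w)) \<le> ennreal B0"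
      using bounded_op_test_fun_bound[OF \<alpha> less_imp_le[OF r] T] by (elim exE conjE) (rule that)
    show "epowr (Limsup at_infinity (berezin m \<alpha> s u \<psi>)) (1 / s) \<le> ennreal (C * D) *
      essential_norm_fs m \<alpha> (ennreal r) (ennreal s) (weighted_comp u \<psi>)"
    proof (rule ennreal_le_mult_limit[OF CD])
      fix y assume y: "y > 0" "essential_norm_fs m \<alpha> (ennreal r) (ennreal s) (weighted_comp u \<psi>) < ennreal y"
      from op_norm_near_essential_norm[OF y(2)] obtain K where 
        K: "compact_op_fs m \<alpha> (ennreal r) (ennreal s) K"
        "op_norm_fs m \<alpha> (ennreal r) (ennreal s) (\<lambda>f z. weighted_comp u \<psi> f z - K f z) \<le> ennreal y" .
      from D(2)[THEN spec, THEN spec, THEN spec, THEN mp, THEN mp, THEN mp, THEN mp, OF T K(1) y(1) K(2)]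
      obtain R where R: "\<forall>w :: complex ^ 'n. norm w \<ge> R \<longrightarrow> fs_norm m \<alpha> (ennreal s) (weighted_comp u \<psi> (test_fun m \<alpha> w)) \<le> ennreal (D * y)" ..
      have "D * y > 0" using D(1) y(1) by simp
      from C(2)[THEN spec, THEN spec, THEN spec, THEN spec, THEN spec, THEN mp, THEN mp, THEN mp, THEN mp, THEN mp, OF u \<psi> this R B0(2)]
      show "epowr (Limsup at_infinity (berezin m \<alpha> s u \<psi>)) (1 / s) \<le> ennreal (C * D * y)" by (simp add: mult.assoc)
    qed
  qed
qed

theorem theorem3p7:
  fixes m :: nat and \<alpha> :: real and p q :: ennreal
  assumes "\<alpha> > 0" and "1 < p" and "p \<le> q" and "p \<noteq> \<infinity>"
  shows "\<exists>C::real. C > 0 \<and>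
    (\<forall>(u :: complex ^ 'n \<Rightarrow> complex) (\<psi> :: complex ^ 'n \<Rightarrow> complex ^ 'n).
       entire_fun u \<longrightarrow> entire_map \<psi> \<longrightarrow>
       bounded_op (fock_sobolev m \<alpha> p) (fs_norm m \<alpha> p)
                  (fock_sobolev m \<alpha> q) (fs_norm m \<alpha> q) (weighted_comp u \<psi>) \<longrightarrow>
       (let U = essential_norm (fock_sobolev m \<alpha> p) (fs_norm m \<alpha> p)
                               (fock_sobolev m \<alpha> q) (fs_norm m \<alpha> q) (weighted_comp u \<psi>);
            V = (if q = \<infinity> then limsup_along \<psi> (berezin_inf m \<alpha> u \<psi>)
                 else epowr (Limsup at_infinity (berezin m \<alpha> (enn2real q) u \<psi>))
                            (1 / enn2real q))
        in U \<le> ennreal C * V \<and> V \<le> ennreal C * U))"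
proof -
  define U where "U u \<psi> = essential_norm (fock_sobolev m \<alpha> p) (fs_norm m \<alpha> p)
      (fock_sobolev m \<alpha> q) (fs_norm m \<alpha> q) (weighted_comp u \<psi>)" for u :: "complex ^ 'n \<Rightarrow> complex" and \<psi>
  define V where "V u \<psi> = (if q = \<infinity> then limsup_along \<psi> (berezin_inf m \<alpha> u \<psi>)
      else epowr (Limsup at_infinity (berezin m \<alpha> (enn2real q) u \<psi>)) (1 / enn2real q))" for u :: "complex ^ 'n \<Rightarrow> complex" and \<psi>
  define adm where "adm u \<psi> \<longleftrightarrow> entire_fun u \<and> entire_map \<psi> \<and> bounded_op (fock_sobolev m \<alpha> p) (fs_norm m \<alpha> p)
      (fock_sobolev m \<alpha> q) (fs_norm m \<alpha> q) (weighted_comp u \<psi>)" for u :: "complex ^ 'n \<Rightarrow> complex" and \<psi>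
  obtain r where r: "p = ennreal r" "r > 1"
    using assms(2,4) by (cases p) (auto simp: one_less_ennreal)
  have "\<exists>C1>0. \<exists>C2>0. \<forall>u \<psi>. adm u \<psi> \<longrightarrow> U u \<psi> \<le> ennreal C1 * V u \<psi> \<and> V u \<psi> \<le> ennreal C2 * U u \<psi>"
  proof (cases "q = \<infinity>")
    case True
    obtain C1 C2 where C: "C1 > 0" "C2 > 0" "\<forall>u \<psi>. adm u \<psi> \<longrightarrow> U u \<psi> \<le> ennreal C1 * V u \<psi>" "\<forall>u \<psi>. adm u \<psi> \<longrightarrow> V u \<psi> \<le> ennreal C2 * U u \<psi>"
      using essential_norm_upper_infinite[OF assms(1) less_imp_le[OF r(2)], of m, where 'n = 'n]
        essential_norm_lower_infinite[OF assms(1) r(2), of m, where 'n = 'n]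
      unfolding adm_def U_def V_def True r(1) by auto
    then show ?thesis by blast
  next
    case False
    obtain s where s: "q = ennreal s" "s \<ge> 0" using False by (cases q) auto
    have rs: "r \<le> s" using assms(3) r s by (simp add: ennreal_le_iff)
    then have s1: "s \<ge> 1" using r(2) by simp
    have es: "enn2real q = s" using s by simp
    obtain C1 C2 where C: "C1 > 0" "C2 > 0" "\<forall>u \<psi>. adm u \<psi> \<longrightarrow> U u \<psi> \<le> ennreal C1 * V u \<psi>" "\<forall>u \<psi>. adm u \<psi> \<longrightarrow> V u \<psi> \<le> ennreal C2 * U u \<psi>"
      using essential_norm_upper_finite[OF assms(1) less_imp_le[OF r(2)] rs, of m, where 'n = 'n]
        essential_norm_lower_finite[OF assms(1) r(2) s1, of m, where 'n = 'n]
      unfolding adm_def U_def V_def es unfolding s(1) r(1) by auto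
    then show ?thesis by blast
  qed
  then obtain C1 C2 where C: "C1 > 0" "C2 > 0" 
    "\<And>u \<psi>. adm u \<psi> \<Longrightarrow> U u \<psi> \<le> ennreal C1 * V u \<psi> \<and> V u \<psi> \<le> ennreal C2 * U u \<psi>" by blast
  have le: "ennreal C1 * x \<le> ennreal (C1 + C2) * x" "ennreal C2 * x \<le> ennreal (C1 + C2) * x" for x
    using C by (auto intro!: mult_right_mono ennreal_leI)
  show ?thesis
    unfolding Let_def U_def[symmetric] V_def[symmetric]
  proof (rule exI[of _ "C1 + C2"], intro conjI allI impI)
    show "C1 + C2 > 0" using C by simp
    fix u :: "complex ^ 'n \<Rightarrow> complex" and \<psi>
    assume "entire_fun u" "entire_map \<psi>" "bounded_op (fock_sobolev m \<alpha> p) (fs_norm m \<alpha> p)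
      (fock_sobolev m \<alpha> q) (fs_norm m \<alpha> q) (weighted_comp u \<psi>)"
    then have "adm u \<psi>" by (simp add: adm_def)
    from C(3)[OF this] show "U u \<psi> \<le> ennreal (C1 + C2) * V u \<psi>" "V u \<psi> \<le> ennreal (C1 + C2) * U u \<psi>"
      using le order_trans by blast+
  qed
qed

end
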